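(* Let $c>0$, $\sigma>0$, $\rho=\sigma^2/c$, let $n\ge 0$ be an integer and let $\gamma=-nc$. Let $A_2$ be the two-dimensional Ornstein-Uhlenbeck operator (generator in $L^2_\mu$) with differential expression $$A_2=(-cx+y)\frac{\partial}{\partial x}-cy\frac{\partial}{\partial y}+\sigma^2\Big(\frac{\partial^2}{\partial x^2}+\frac{\partial^2}{\partial y^2}\Big).$$ Then the geometric multiplicity of the eigenvalue $\gamma$ of $A_2$ is $1$. Moreover, set $$G_i(x)=\sum_{j=0}^{\lfloor i/2\rfloor}\frac{1}{2^j}\,\frac{1}{j!\,(i-2j)!}\Big(-\frac{\rho}{2c^2}\Big)^jH_{i-2j}(x),\qquad i=0,1,\dots,$$ and let $f=G_n$ (as a function of $(x,y)$ depending only on $x$). Then $\{f,(\gamma-A_2)f,(\gamma-A_2)^2f,\dots,(\gamma-A_2)^nf\}$ is a basis of the spectral subspace associated to $\gamma$, and for $k=0,1,\dots,n$, $$(\gamma-A_2)^kf=(-1)^k\sum_{i=\max\{0,\,n-2k\}}^{n-k}\Big(-\frac{\rho}{2c}\Big)^{n-k-i}\binom{k}{n-k-i}G_i(x)H_{2k-n+i}(y).$$ In particular, $(\gamma-A_2)^nf=(-1)^nH_n(y)$ is the eigenfunction associated to $\gamma$.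
   Context: Hermite polynomials (with parameter $\rho$): $H_0=1$ and $H_m(x)=(-\rho)^m e^{x^2/(2\rho)}\frac{d^m}{dx^m}e^{-x^2/(2\rho)}$ for $m\ge1$. Operator: let $B=\begin{bmatrix}-c&1\\0&-c\end{bmatrix}$ and $Q_t=\sigma^2\int_0^te^{sB}e^{sB^*}\,ds$, where $B^*$ is the transpose of $B$. The Ornstein-Uhlenbeck semigroup is $(T(t)f)(x)=\frac{1}{4\pi(\det Q_t)^{1/2}}\int_{\mathbb R^2}e^{-\langle Q_t^{-1}y,y\rangle/4}f(e^{tB}x-y)\,dy$ for $t>0$, $T(0)=\mathrm{Id}$. It has a unique invariant probability measure $\mu$ and extends to a strongly continuous contraction semigroup on the real Hilbert space $L^2_\mu=L^2(\mathbb R^2,d\mu)$; its generator is $A_2$. Polynomials lie in the domain of $A_2$, and on them $A_2$ acts as the displayed differential expression. It is known that the spectrum of $A_2$ is $\{-nc:n=0,1,2,\dots\}$ and that all generalised eigenfunctions are polynomials. The geometric multiplicity of $\gamma$ is $\dim\mathrm{Ker}(\gamma-A_2)$. The spectral subspace associated to $\gamma=-nc$ is $\mathrm{Ker}\,(\gamma-A_2)^{\nu}$, where $\nu=1+n$ is the index of the eigenvalue $\gamma$. *)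

theory Defs
  imports "HOL-Probability.Probability"
begin

text \<open>
  Classes of Borel functions on the plane modulo equality almost everywhere. Almost everywhere
  refers to Lebesgue measure; the invariant measure of the (nondegenerate) Ornstein-Uhlenbeck
  semigroup below is a Gaussian measure with positive density, so it has the same null sets, and
  its \<open>L\<^sup>2\<close> space is a subspace of this space.
\<close>

quotient_type aefun = "real^2 \<Rightarrow> real" / partial:
  "\<lambda>f g. f \<in> borel_measurable borel \<and> g \<in> borel_measurable borel \<and> (AE x in lborel. f x = g x)"
  morphisms rep_aefun ae_class
proof (rule part_equivpI)
  show "\<exists>f::real^2 \<Rightarrow> real. f \<in> borel_measurable borel \<and> f \<in> borel_measurable borel \<and>
      (AE x in lborel. f x = f x)"
    by (rule exI[of _ "\<lambda>_. 0"]) simp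
qed (auto simp: symp_def transp_def elim: eventually_rev_mp eventually_mono)

instantiation aefun :: real_vector
begin

lift_definition zero_aefun :: aefun is "\<lambda>_. 0" by simp

lift_definition plus_aefun :: "aefun \<Rightarrow> aefun \<Rightarrow> aefun" is "\<lambda>f g x. f x + g x"
  by (auto elim!: eventually_rev_mp)

lift_definition minus_aefun :: "aefun \<Rightarrow> aefun \<Rightarrow> aefun" is "\<lambda>f g x. f x - g x"
  by (auto elim!: eventually_rev_mp)

lift_definition uminus_aefun :: "aefun \<Rightarrow> aefun" is "\<lambda>f x. - f x"
  by (auto elim!: eventually_rev_mp)

lift_definition scaleR_aefun :: "real \<Rightarrow> aefun \<Rightarrow> aefun" is "\<lambda>a f x. a * f x"
  by (auto elim!: eventually_rev_mp)

instance
  by standard (transfer, auto simp: algebra_simps)+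

end

definition mat_exp :: "real^2^2 \<Rightarrow> real^2^2" where
  "mat_exp A = (\<Sum>n. (1 / fact n) *\<^sub>R (((**) A) ^^ n) (mat 1))"

text \<open>
  The drift \<open>x \<mapsto> B x\<close> together with the diffusion matrix \<open>\<sigma>\<^sup>2 I\<close> gives the differential
  expression \<open>\<langle>B x, \<nabla>\<rangle> + \<sigma>\<^sup>2 \<Delta>\<close>, that is,
  \<open>(- c x + y) \<partial>\<^sub>x - c y \<partial>\<^sub>y + \<sigma>\<^sup>2 (\<partial>\<^sub>x\<^sup>2 + \<partial>\<^sub>y\<^sup>2)\<close>, for the generator of the semigroup below.
\<close>

definition ou_B :: "real \<Rightarrow> real^2^2" where
  "ou_B c = vector [vector [-c, 1], vector [0, -c]]"

definition ou_Q :: "real \<Rightarrow> real \<Rightarrow> real \<Rightarrow> real^2^2" where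
  "ou_Q c \<sigma> t = \<sigma>\<^sup>2 *\<^sub>R
     integral {0..t} (\<lambda>s. mat_exp (s *\<^sub>R ou_B c) ** mat_exp (s *\<^sub>R transpose (ou_B c)))"

definition ou_semigroup :: "real \<Rightarrow> real \<Rightarrow> real \<Rightarrow> (real^2 \<Rightarrow> real) \<Rightarrow> real^2 \<Rightarrow> real" where
  "ou_semigroup c \<sigma> t f x =
     (if t = 0 then f x
      else 1 / (4 * pi * sqrt (det (ou_Q c \<sigma> t))) *
        (LINT y|lborel. exp (- ((matrix_inv (ou_Q c \<sigma> t) *v y) \<bullet> y) / 4) *
           f (mat_exp (t *\<^sub>R ou_B c) *v x - y)))"

definition ou_invariant :: "real \<Rightarrow> real \<Rightarrow> (real^2) measure \<Rightarrow> bool" where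
  "ou_invariant c \<sigma> \<mu> \<longleftrightarrow> prob_space \<mu> \<and> sets \<mu> = sets borel \<and>
     (\<forall>t\<ge>0. \<forall>f. continuous_on UNIV f \<and> bounded (range f) \<longrightarrow>
        (LINT x|\<mu>. ou_semigroup c \<sigma> t f x) = (LINT x|\<mu>. f x))"

text \<open>The square of the norm of \<open>L\<^sup>2\<close>, with value infinity outside that space.\<close>

definition L2_normsq :: "(real^2) measure \<Rightarrow> aefun \<Rightarrow> ennreal" where
  "L2_normsq \<mu> F = (\<integral>\<^sup>+x. ennreal ((rep_aefun F x)\<^sup>2) \<partial>\<mu>)"

definition L2 :: "(real^2) measure \<Rightarrow> aefun set" where
  "L2 \<mu> = {F. L2_normsq \<mu> F < \<infinity>}"

text \<open>
  On \<open>L\<^sup>2\<close> of the invariant measure, the continuous extension of the semigroup is given by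
  the same integral formula: for \<open>t > 0\<close> the integrand is integrable for every \<open>x\<close>, and the
  result does not depend on the representative.
\<close>

definition ou_T2 :: "real \<Rightarrow> real \<Rightarrow> real \<Rightarrow> aefun \<Rightarrow> aefun" where
  "ou_T2 c \<sigma> t F = ae_class (ou_semigroup c \<sigma> t (rep_aefun F))"

definition ou_gen_graph :: "real \<Rightarrow> real \<Rightarrow> (real^2) measure \<Rightarrow> aefun \<Rightarrow> aefun \<Rightarrow> bool" where
  "ou_gen_graph c \<sigma> \<mu> F G \<longleftrightarrow> F \<in> L2 \<mu> \<and> G \<in> L2 \<mu> \<and>
     ((\<lambda>t. L2_normsq \<mu> ((1 / t) *\<^sub>R (ou_T2 c \<sigma> t F - F) - G)) \<longlongrightarrow> 0) (at_right 0)"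

definition ou_domain :: "real \<Rightarrow> real \<Rightarrow> (real^2) measure \<Rightarrow> aefun set" where
  "ou_domain c \<sigma> \<mu> = {F. \<exists>G. ou_gen_graph c \<sigma> \<mu> F G}"

definition ou_A2 :: "real \<Rightarrow> real \<Rightarrow> (real^2) measure \<Rightarrow> aefun \<Rightarrow> aefun" where
  "ou_A2 c \<sigma> \<mu> F = (THE G. ou_gen_graph c \<sigma> \<mu> F G)"

text \<open>
  The powers \<open>(\<gamma> - A\<^sub>2)\<^sup>k\<close> of the unbounded operator: the value is meaningful only on the
  domain, where all the intermediate iterates lie in the domain of the generator.
\<close>

definition ou_pow :: "real \<Rightarrow> real \<Rightarrow> (real^2) measure \<Rightarrow> real \<Rightarrow> nat \<Rightarrow> aefun \<Rightarrow> aefun" where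
  "ou_pow c \<sigma> \<mu> \<gamma> k = (\<lambda>F. \<gamma> *\<^sub>R F - ou_A2 c \<sigma> \<mu> F) ^^ k"

definition ou_pow_domain :: "real \<Rightarrow> real \<Rightarrow> (real^2) measure \<Rightarrow> real \<Rightarrow> nat \<Rightarrow> aefun set" where
  "ou_pow_domain c \<sigma> \<mu> \<gamma> k =
     {F \<in> L2 \<mu>. \<forall>j<k. ou_pow c \<sigma> \<mu> \<gamma> j F \<in> ou_domain c \<sigma> \<mu>}"

definition ou_ker_pow :: "real \<Rightarrow> real \<Rightarrow> (real^2) measure \<Rightarrow> real \<Rightarrow> nat \<Rightarrow> aefun set" where
  "ou_ker_pow c \<sigma> \<mu> \<gamma> k = {F \<in> ou_pow_domain c \<sigma> \<mu> \<gamma> k. ou_pow c \<sigma> \<mu> \<gamma> k F = 0}"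

definition geometric_multiplicity :: "real \<Rightarrow> real \<Rightarrow> (real^2) measure \<Rightarrow> real \<Rightarrow> nat" where
  "geometric_multiplicity c \<sigma> \<mu> \<gamma> = dim (ou_ker_pow c \<sigma> \<mu> \<gamma> 1)"

definition eigenfunction :: "real \<Rightarrow> real \<Rightarrow> (real^2) measure \<Rightarrow> real \<Rightarrow> aefun \<Rightarrow> bool" where
  "eigenfunction c \<sigma> \<mu> \<gamma> F \<longleftrightarrow>
     F \<in> ou_domain c \<sigma> \<mu> \<and> F \<noteq> 0 \<and> ou_A2 c \<sigma> \<mu> F = \<gamma> *\<^sub>R F"

text \<open>The spectral subspace of the eigenvalue \<open>- n c\<close>, whose index is \<open>1 + n\<close>.\<close>

definition spectral_subspace :: "real \<Rightarrow> real \<Rightarrow> (real^2) measure \<Rightarrow> nat \<Rightarrow> aefun set" where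
  "spectral_subspace c \<sigma> \<mu> n = ou_ker_pow c \<sigma> \<mu> (- real n * c) (1 + n)"

definition Hermite :: "real \<Rightarrow> nat \<Rightarrow> real \<Rightarrow> real" where
  "Hermite \<rho> m x =
     (- \<rho>) ^ m * exp (x\<^sup>2 / (2 * \<rho>)) * (deriv ^^ m) (\<lambda>u. exp (- u\<^sup>2 / (2 * \<rho>))) x"

definition G_poly :: "real \<Rightarrow> real \<Rightarrow> nat \<Rightarrow> real \<Rightarrow> real" where
  "G_poly c \<rho> i x = (\<Sum>j = 0..i div 2.
     1 / 2 ^ j * (1 / (fact j * fact (i - 2 * j))) * (- (\<rho> / (2 * c\<^sup>2))) ^ j *
     Hermite \<rho> (i - 2 * j) x)"

end

(* The invariant measure mu is the Gaussian measure with covariance matrix 2 Q_infinity, and the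
   functions E_w(z) = exp(<z,w> - <Q_infinity w,w>) satisfy T(t) E_w = E_w' with w' = exp(tB)^* w
   = exp(-ct) (w_1, w_2 + t w_1). Hence, for w = (1,tau), the terms Q_n(tau) of degree n in the
   expansion of E_(sw) in powers of s satisfy T(t) Q_n(tau) = exp(-nct) Q_n(tau + t).
   Writing Q_n(tau) = sum_k tau^k/k! R_k, this says that A_2 R_k = -nc R_k + R_(k+1) with
   R_0 = G_n, R_n = H_n(y) and R_(n+1) = 0, so gamma - A_2 acts on R_0, ..., R_n as minus a shift.

   There are no further eigenfunctions: for F in L^2(mu) the mean Phi_F(u) of F under the translate
   of mu by u satisfies Phi_(T(t)F)(u) = Phi_F(exp(tB)u), because mu is invariant. If
   A_2 F = -nc F, then Phi_F(exp(tB)u) = exp(-nct) Phi_F(u). Comparing the lowest nonvanishing terms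
   of the expansion of Phi_F at 0 shows that only the coefficient of u_2^n can be nonzero, and a
   function all of whose moments vanish is zero. So the eigenspace is spanned by R_n, and the kernels
   of the powers of gamma - A_2 follow by linear algebra. *)
theory Submission
  imports Defs "HOL-Real_Asymp.Real_Asymp"
begin

section \<open>Hermite polynomials with variable variance\<close>

text \<open>In terms of \<open>herm\<close>, Q_n(tau) is the Hermite polynomial in x + tau y whose
  variance is that of x + tau y under mu. Its law of motion reduces to the balance Q_infinity - Q_t
  = exp(tB) Q_infinity exp(tB)^*, tested on (1, tau). For fixed n only finitely many terms occur, so
  the expansion in s is a matter of formal power series.

  The obstacle is uniqueness. An eigenfunction is an L^2 class of which only a one-sided limit at t
  = 0 is given. The continuous functionals Phi_F(u) convert this limit into a right derivative along
  flow lines. Since Phi_F is a Gaussian factor times a Laplace transform, it is differentiable, so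
  the right derivative is a derivative and a linear scalar equation can be solved. The exponential
  moments of functions in L^2(mu) also make their moments determine them.

  The measure mu is given through invariance on bounded continuous functions; that it is Gaussian
  comes from the limit of T(t)f as t tends to infinity. Standard normal pairs under triangular maps
  reduce Gaussian integrals to one-dimensional ones.\<close>

definition heat_fps :: "real \<Rightarrow> real \<Rightarrow> real fps" where
  "heat_fps v x = fps_exp x * (fps_exp (- v / 2) oo fps_X ^ 2)"

text \<open>
  The coefficient of \<open>s\<^sup>n\<close> in \<open>exp (x s - v s\<^sup>2 / 2)\<close>: the Hermite polynomial for the variance \<open>v\<close>,
  divided by \<open>n!\<close>. All real values of \<open>v\<close> are allowed; for \<open>v = - 1\<close> and \<open>x = 0\<close> one obtains the
  moments of the standard normal distribution, divided by \<open>n!\<close>.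
\<close>

definition herm :: "real \<Rightarrow> nat \<Rightarrow> real \<Rightarrow> real" where
  "herm v n x = fps_nth (heat_fps v x) n"

lemma heat_fps_add: "heat_fps (v + v') (x + x') = heat_fps v x * heat_fps v' x'"
proof -
  have "fps_exp (- (v + v') / 2) = fps_exp (- v / 2) * fps_exp (- v' / 2)"
    by (simp add: fps_exp_add_mult [symmetric] add_divide_distrib diff_divide_distrib)
  then show ?thesis
    by (simp add: heat_fps_def fps_exp_add_mult fps_compose_mult_distrib mult_ac)
qed

text \<open>Product of generating functions: the exponents x s and -v s^2/2 are both additive.
  Taking v' = 0 gives the Taylor expansion in x, taking x' = 0 the change of variance.\<close>

lemma herm_add:
  "herm (v + v') n (x + x') = (\<Sum>k\<le>n. herm v k x * herm v' (n - k) x')"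
  by (simp add: herm_def heat_fps_add fps_mult_nth atLeast0AtMost)

lemma fps_nth_compose_X_square:
  "fps_nth (a oo fps_X ^ 2) n = (if even n then fps_nth a (n div 2) else 0)"
proof -
  have "fps_nth (a oo fps_X ^ 2) n = (\<Sum>i\<in>{0..n}. if n = 2 * i then fps_nth a i else 0)"
    by (auto simp: fps_compose_nth fps_X_power_nth power_mult [symmetric] intro!: sum.cong)
  also have "\<dots> = (\<Sum>i\<in>(if even n then {n div 2} else {}). fps_nth a i)"
    by (rule sum.mono_neutral_cong_right) (auto split: if_splits elim!: evenE)
  finally show ?thesis by (auto split: if_splits)
qed

lemma herm_at_0: "herm v n 0 = (if even n then (- v / 2) ^ (n div 2) / fact (n div 2) else 0)"
proof -
  have "heat_fps v 0 = fps_exp (- v / 2) oo fps_X ^ 2"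
    by (simp add: heat_fps_def)
  then show ?thesis
    by (simp add: herm_def fps_nth_compose_X_square)
qed

lemma herm_var_0: "herm 0 n x = x ^ n / fact n"
  by (simp add: herm_def heat_fps_def)

lemma herm_0 [simp]: "herm v 0 x = 1"
  by (simp add: herm_def heat_fps_def)

text \<open>Coefficient of s^n in F' = (x - v s) F for F(s) = exp(x s - v s^2/2). For n = 0 the term
  v s F contributes nothing, which the conditional records.\<close>

lemma herm_rec:
  "real (Suc n) * herm v (Suc n) x = x * herm v n x - v * (if n = 0 then 0 else herm v (n - 1) x)"
proof -
  have "fps_deriv (fps_exp (- v / 2) oo fps_X ^ 2)
      = fps_const (- v) * fps_X * (fps_exp (- v / 2) oo fps_X ^ 2)"
  proof -
    let ?E = "fps_exp (- v / 2) oo fps_X ^ 2"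
    have "fps_deriv ?E = (fps_const (- v / 2) * fps_exp (- v / 2) oo fps_X ^ 2) * fps_deriv (fps_X ^ 2)"
      by (subst fps_compose_deriv) simp_all
    also have "fps_const (- v / 2) * fps_exp (- v / 2) oo fps_X ^ 2 = fps_const (- v / 2) * ?E"
      by (subst fps_compose_mult_distrib) simp_all
    also have "fps_deriv (fps_X ^ 2) = fps_const 2 * (fps_X :: real fps)"
      by (simp add: fps_deriv_power numeral_fps_const)
    also have "fps_const (- v / 2) * ?E * (fps_const 2 * fps_X) = (fps_const (- v / 2) * fps_const 2) * fps_X * ?E"
      by (simp only: mult_ac)
    also have "fps_const (- v / 2) * fps_const 2 = fps_const (- v)"
      by (subst fps_const_mult) simp
    finally show ?thesis .
  qed
  then have d: "fps_deriv (fps_exp (- v / 2) oo fps_X ^ 2)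
      = - fps_const v * fps_X * (fps_exp (- v / 2) oo fps_X ^ 2)"
    by simp
  have "e * (- c * X * E) + x * e * E = x * (e * E) - c * (X * (e * E))" for e c X E x :: "real fps"
    by (simp add: algebra_simps)
  then have "fps_deriv (heat_fps v x) = fps_const x * heat_fps v x - fps_const v * (fps_X * heat_fps v x)"
    unfolding heat_fps_def fps_deriv_mult fps_exp_deriv d .
  then have "fps_nth (fps_deriv (heat_fps v x)) n = fps_nth (fps_const x * heat_fps v x - fps_const v * (fps_X * heat_fps v x)) n"
    by simp
  then show ?thesis
    by (simp add: herm_def del: of_nat_Suc)
qed

lemma herm_1 [simp]: "herm v (Suc 0) x = x"
  using herm_rec[of 0 v x] by simp

lemma herm_step:
  "herm v (Suc (Suc n)) x = (x * herm v (Suc n) x - v * herm v n x) / real (Suc (Suc n))"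
  using herm_rec[of "Suc n" v x] by (subst eq_divide_eq) (simp add: mult.commute)

lemma herm_scale: "herm (l\<^sup>2 * v) n (l * x) = l ^ n * herm v n x"
proof (induction n rule: induct_nat_012)
  case (ge2 n)
  then show ?case
    by (simp add: herm_step power2_eq_square algebra_simps del: of_nat_Suc)
qed simp_all

text \<open>The generating function satisfies dF/dx = s F. Since \<open>herm\<close> is defined by
  coefficients in s, the derivative in x is obtained from the recurrence, by induction over two
  predecessors.\<close>

lemma herm_has_derivative:
  "(herm v (Suc n) has_real_derivative herm v n x) (at x)"
proof (induction n rule: induct_nat_012)
  case 0
  have "herm v (Suc 0) = (\<lambda>x. x)" by (rule ext) simp
  then show ?case by simp
next
  case 1
  have eq: "herm v (Suc (Suc 0)) = (\<lambda>x. (x * x - v) / 2)" by (rule ext) (simp add: herm_step)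
  show ?case unfolding eq by (auto intro!: derivative_eq_intros)
next
  case (ge2 n)
  have eq: "herm v (Suc (Suc (Suc n))) =
      (\<lambda>x. (x * herm v (Suc (Suc n)) x - v * herm v (Suc n) x) / real (Suc (Suc (Suc n))))"
    by (rule ext) (rule herm_step)
  have r: "x * herm v (Suc n) x - v * herm v n x = real (Suc (Suc n)) * herm v (Suc (Suc n)) x"
    using herm_rec[of "Suc n" v x] by simp
  have "1 * herm v (Suc (Suc n)) x + herm v (Suc n) x * x - v * herm v n x
      = real (Suc (Suc (Suc n))) * herm v (Suc (Suc n)) x"
    using r by (simp add: algebra_simps)
  with DERIV_diff[OF DERIV_mult[OF DERIV_ident ge2(2)] DERIV_cmult[OF ge2(1), of v]]
  have d: "((\<lambda>x. x * herm v (Suc (Suc n)) x - v * herm v (Suc n) x)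
      has_real_derivative real (Suc (Suc (Suc n))) * herm v (Suc (Suc n)) x) (at x)"
    by simp
  show ?case unfolding eq
    by (rule DERIV_cdivide[OF d, THEN DERIV_cong]) simp
qed

lemma herm_continuous: "continuous_on A (herm v n)"
proof (cases n)
  case 0
  then have "herm v n = (\<lambda>_. 1)" by auto
  then show ?thesis by simp
next
  case (Suc m)
  then show ?thesis
    using DERIV_isCont[OF herm_has_derivative] continuous_at_imp_continuous_on by blast
qed

lemma herm_borel [measurable]: "herm v n \<in> borel_measurable borel"
  by (intro borel_measurable_continuous_onI herm_continuous)

lemma herm_not_zero: "\<exists>x. herm v n x \<noteq> 0"
proof (induction n)
  case (Suc n)
  show ?case
  proof (rule ccontr)
    assume "\<nexists>x. herm v (Suc n) x \<noteq> 0"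
    then have "herm v (Suc n) = (\<lambda>_. 0)" by auto
    then have "((\<lambda>_. 0) has_real_derivative herm v n x) (at x)" for x
      using herm_has_derivative[of v n x] by simp
    then have "herm v n x = 0" for x
      using DERIV_unique[OF _ DERIV_const] by blast
    with Suc show False by auto
  qed
qed simp

text \<open>Differentiating \<open>herm\<close> times the Gaussian produces -1/rho times the bracket
  x h_m - rho h_m', and by \<open>herm_rec\<close> this bracket is (m + 1) h_(m+1). So each
  derivative raises the degree by one, with the factor that the Rodrigues formula
  compensates.\<close>

lemma Hermite_eq_herm:
  assumes "\<rho> > 0"
  shows "Hermite \<rho> m x = fact m * herm \<rho> m x"
proof -
  have "(deriv ^^ m) (\<lambda>u. exp (- u\<^sup>2 / (2 * \<rho>))) =
      (\<lambda>x. (- 1 / \<rho>) ^ m * (fact m * herm \<rho> m x) * exp (- x\<^sup>2 / (2 * \<rho>)))"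
  proof (induction m)
    case (Suc m)
    have "deriv (\<lambda>x. (- 1 / \<rho>) ^ m * (fact m * herm \<rho> m x) * exp (- x\<^sup>2 / (2 * \<rho>))) x
      = (- 1 / \<rho>) ^ Suc m * (fact (Suc m) * herm \<rho> (Suc m) x) * exp (- x\<^sup>2 / (2 * \<rho>))" for x
    proof (rule DERIV_imp_deriv)
      let ?h' = "if m = 0 then 0 else herm \<rho> (m - 1) x"
      have h: "(herm \<rho> m has_real_derivative ?h') (at x)"
      proof (cases m)
        case 0
        then have "herm \<rho> m = (\<lambda>_. 1)" by auto
        then show ?thesis using 0 by simp
      next
        case (Suc k)
        then show ?thesis using herm_has_derivative[of \<rho> k x] by simp
      qed
      have r: "fact (Suc m) * herm \<rho> (Suc m) x = fact m * (x * herm \<rho> m x - \<rho> * ?h')"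
        using herm_rec[of m \<rho> x] by (simp add: mult_ac)
      show "((\<lambda>x. (- 1 / \<rho>) ^ m * (fact m * herm \<rho> m x) * exp (- x\<^sup>2 / (2 * \<rho>)))
        has_real_derivative (- 1 / \<rho>) ^ Suc m * (fact (Suc m) * herm \<rho> (Suc m) x)
          * exp (- x\<^sup>2 / (2 * \<rho>))) (at x)"
      proof -
        have nz: "\<rho> \<noteq> 0" using assms by simp
        have e: "((\<lambda>x. exp (- x\<^sup>2 / (2 * \<rho>))) has_real_derivative
            exp (- x\<^sup>2 / (2 * \<rho>)) * (- (2 * x) / (2 * \<rho>))) (at x)"
          using nz by (auto intro!: derivative_eq_intros)
        show ?thesis
          unfolding r
          by (rule DERIV_cong[OF DERIV_mult[OF DERIV_cmult[OF DERIV_cmult[OF h]] e]])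
            (simp add: nz algebra_simps)
      qed
    qed
    then show ?case using Suc by simp
  qed simp
  then have "Hermite \<rho> m x = ((- \<rho>) ^ m * (- 1 / \<rho>) ^ m) *
      (exp (x\<^sup>2 / (2 * \<rho>)) * exp (- x\<^sup>2 / (2 * \<rho>))) * (fact m * herm \<rho> m x)"
    unfolding Hermite_def by (simp only: mult_ac)
  also have "(- \<rho>) ^ m * (- 1 / \<rho>) ^ m = 1"
    using assms by (simp flip: power_mult_distrib)
  also have "exp (x\<^sup>2 / (2 * \<rho>)) * exp (- x\<^sup>2 / (2 * \<rho>)) = 1"
    by (simp flip: exp_add)
  finally show ?thesis by simp
qed

text \<open>\<open>herm_add\<close> with one argument equal to 0: only the even coefficients of
  exp(-w s^2/2) survive.\<close>

lemma herm_add_var: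
  "herm (v + w) n x = (\<Sum>j\<le>n div 2. (- w / 2) ^ j / fact j * herm v (n - 2 * j) x)"
proof -
  have "herm (v + w) n x = herm (w + v) n (0 + x)"
    by (simp add: add.commute)
  also have "\<dots> = (\<Sum>k\<le>n. herm w k 0 * herm v (n - k) x)"
    by (rule herm_add)
  also have "\<dots> = (\<Sum>k | k \<le> n \<and> even k. (- w / 2) ^ (k div 2) / fact (k div 2) * herm v (n - k) x)"
    by (rule sum.mono_neutral_cong_right) (auto simp: herm_at_0)
  also have "\<dots> = (\<Sum>j\<le>n div 2. (- w / 2) ^ j / fact j * herm v (n - 2 * j) x)"
    by (rule sum.reindex_bij_witness[where i = "\<lambda>j. 2 * j" and j = "\<lambda>k. k div 2"]) auto
  finally show ?thesis .
qed

text \<open>The coefficients of \<open>G_poly\<close> are those of a change of variance by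
  rho/(2c^2). Hence G_i is a Hermite polynomial for the variance of x under mu, which makes G_n the
  first link of the chain.\<close>

lemma G_poly_eq_herm:
  assumes "\<rho> > 0"
  shows "G_poly c \<rho> n x = herm (\<rho> + \<rho> / (2 * c\<^sup>2)) n x"
proof -
  have "1 / 2 ^ j * (1 / (fact j * fact m)) * (- w) ^ j * (fact m * h) = (- w / 2) ^ j / fact j * h"
    for j m :: nat and w h :: real
    unfolding power_divide by simp
  then show ?thesis
    by (simp add: G_poly_def herm_add_var Hermite_eq_herm[OF assms] atLeast0AtMost)
qed

text \<open>
  Equal to \<open>k!\<close> times the coefficient of \<open>s\<^bsup>n-k\<^esup> t\<^sup>k\<close> in
  \<open>exp (x s + y t - (v s\<^sup>2 + 2 b s t + w t\<^sup>2) / 2)\<close>.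
\<close>

definition bherm :: "real \<Rightarrow> real \<Rightarrow> real \<Rightarrow> nat \<Rightarrow> nat \<Rightarrow> real \<Rightarrow> real \<Rightarrow> real" where
  "bherm v b w n k x y = (if k \<le> n then fact k *
     (\<Sum>i = n - 2 * k..n - k. (- b) ^ (n - k - i) / fact (n - k - i) * herm v i x *
        herm w (2 * k + i - n) y) else 0)"

text \<open>\<open>herm_add\<close> splits off the x part with variance v; in the remaining factor
  \<open>herm_add_var\<close> separates the cross term 2 b tau from w tau^2. The powers of tau can
  then be read off.\<close>

lemma herm_plane_wave:
  "herm (v + 2 * b * \<tau> + w * \<tau>\<^sup>2) n (x + \<tau> * y) =
    (\<Sum>k\<le>n. \<tau> ^ k / fact k * bherm v b w n k x y)"
proof -
  \<comment> \<open>Here i is the degree in x and p = n - k - i counts the factors from the cross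
    term. Such a term carries tau^p from the cross term and tau^(n - i - 2p) from the y part, so k =
    n - i - p.\<close>
  define T where "T i k = (- b) ^ (n - k - i) / fact (n - k - i) * herm v i x *
        herm w (2 * k + i - n) y * \<tau> ^ k" for i k
  have "herm (v + 2 * b * \<tau> + w * \<tau>\<^sup>2) n (x + \<tau> * y) =
      (\<Sum>i\<le>n. herm v i x * herm (w * \<tau>\<^sup>2 + 2 * b * \<tau>) (n - i) (\<tau> * y))"
    using herm_add[of v "w * \<tau>\<^sup>2 + 2 * b * \<tau>"] by (simp add: add_ac)
  also have "\<dots> = (\<Sum>i\<le>n. \<Sum>p\<le>(n - i) div 2. T i (n - i - p))"
  proof (rule sum.cong[OF refl])
    fix i assume i: "i \<in> {..n}"
    have "herm v i x * herm (w * \<tau>\<^sup>2 + 2 * b * \<tau>) (n - i) (\<tau> * y) =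
       (\<Sum>p\<le>(n - i) div 2. herm v i x * ((- (b * \<tau>)) ^ p / fact p * herm (\<tau>\<^sup>2 * w) (n - i - 2 * p) (\<tau> * y)))"
      by (simp add: herm_add_var sum_distrib_left mult_ac)
    also have "\<dots> = (\<Sum>p\<le>(n - i) div 2. T i (n - i - p))"
    proof (rule sum.cong[OF refl])
      fix p assume p: "p \<in> {..(n - i) div 2}"
      then have "2 * p \<le> n - i" by auto
      then obtain m where "n - i = 2 * p + m"
        using le_Suc_ex by blast
      then have n: "n = i + 2 * p + m"
        using i p by auto
      have "(- (b * \<tau>)) ^ p = (- b) ^ p * \<tau> ^ p"
        by (simp add: power_mult_distrib [symmetric])
      then show "herm v i x * ((- (b * \<tau>)) ^ p / fact p * herm (\<tau>\<^sup>2 * w) (n - i - 2 * p) (\<tau> * y))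
          = T i (n - i - p)"
        by (simp add: n T_def herm_scale power_add)
    qed
    finally show "herm v i x * herm (w * \<tau>\<^sup>2 + 2 * b * \<tau>) (n - i) (\<tau> * y)
        = (\<Sum>p\<le>(n - i) div 2. T i (n - i - p))" .
  qed
  \<comment> \<open>With p = n - k - i the bound 2 p \<le> n - i becomes n - 2 k \<le> i.\<close>
  also have "\<dots> = (\<Sum>k\<le>n. \<Sum>i = n - 2 * k..n - k. T i k)"
    unfolding sum.Sigma[OF finite_atMost ballI[OF finite_atMost]]
      sum.Sigma[OF finite_atMost ballI[OF finite_atLeastAtMost]]
    by (rule sum.reindex_bij_witness[where
        i = "\<lambda>(k, i). (i, n - k - i)" and j = "\<lambda>(i, p). (n - i - p, i)"]) auto
  also have "\<dots> = (\<Sum>k\<le>n. \<tau> ^ k / fact k * bherm v b w n k x y)"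
    by (rule sum.cong) (auto simp: bherm_def T_def sum_distrib_left mult_ac)
  finally show ?thesis .
qed

text \<open>The degree in y is k - (n - k - i) = 2 k + i - n, so k!/(n - k - i)! is a binomial
  coefficient times the factorial that turns \<open>herm\<close> into \<open>Hermite\<close>.
  Truncated subtraction in \<open>n - 2 * k\<close> plays the part of max{0, n - 2k}.\<close>

lemma bherm_eq_G_Hermite:
  assumes "\<rho> > 0" "k \<le> n"
  shows "bherm (\<rho> + \<rho> / (2 * c\<^sup>2)) b \<rho> n k x y =
    (\<Sum>i = n - 2 * k..n - k. (- b) ^ (n - k - i) * real (k choose (n - k - i)) *
       G_poly c \<rho> i x * Hermite \<rho> (2 * k + i - n) y)"
proof -
  have *: "fact k / fact (n - k - i) = real (k choose (n - k - i)) * fact (2 * k + i - n)"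
    if "i \<in> {n - 2 * k..n - k}" for i
  proof -
    have "n - k - i \<le> k" "k - (n - k - i) = 2 * k + i - n"
      using that assms by auto
    then show ?thesis by (simp add: binomial_fact)
  qed
  have "fact k * ((- b) ^ (n - k - i) / fact (n - k - i) * herm (\<rho> + \<rho> / (2 * c\<^sup>2)) i x *
        herm \<rho> (2 * k + i - n) y) = (- b) ^ (n - k - i) * real (k choose (n - k - i)) *
       G_poly c \<rho> i x * Hermite \<rho> (2 * k + i - n) y"
    if "i \<in> {n - 2 * k..n - k}" for i
  proof -
    have "f * (B / F * g * h) = B * C * g * (D * h)" if "f / F = C * D" for f B C D F g h :: real
    proof -
      have "f * (B / F * g * h) = B * (f / F) * g * h" by simp
      then show ?thesis unfolding that by (simp only: mult_ac)
    qed
    from this[OF *[OF that]] show ?thesis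
      unfolding G_poly_eq_herm[OF assms(1)] Hermite_eq_herm[OF assms(1)] .
  qed
  then show ?thesis
    unfolding bherm_def sum_distrib_left using assms(2) by (auto intro!: sum.cong)
qed

section \<open>The standard Gaussian measure on the plane\<close>

abbreviation N1 :: "real measure" where
  "N1 \<equiv> density lborel std_normal_density"

text \<open>A product measure on pairs rather than a measure on \<open>real^2\<close>, so that
  Fubini applies directly; points of \<open>real^2\<close> enter through \<open>tri\<close>.\<close>

definition N2 :: "(real \<times> real) measure" where
  "N2 = N1 \<Otimes>\<^sub>M N1"

interpretation N1: prob_space N1
  by (rule prob_space_normal_density) simp

interpretation N2_pair: pair_prob_space N1 N1 ..

interpretation N2: prob_space N2
  unfolding N2_def by (rule N2_pair.P.prob_space_axioms)

lemma sets_N2 [measurable_cong, simp]: "sets N2 = sets borel"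
proof -
  have "sets N2 = sets ((borel :: real measure) \<Otimes>\<^sub>M (borel :: real measure))"
    unfolding N2_def by (rule sets_pair_measure_cong) simp_all
  then show ?thesis unfolding borel_prod .
qed

lemma borel_measurable_fst_snd [measurable]:
  "fst \<in> borel_measurable (borel :: (real \<times> real) measure)"
  "snd \<in> borel_measurable (borel :: (real \<times> real) measure)"
  by (auto intro!: borel_measurable_continuous_onI continuous_intros)

declare borel_measurable_Pair [measurable (raw)]

lemma space_N2 [simp]: "space N2 = UNIV"
  by (simp add: N2_def space_pair_measure)

lemma nn_integral_N2:
  assumes [measurable]: "h \<in> borel_measurable borel"
  shows "(\<integral>\<^sup>+p. h p \<partial>N2) = (\<integral>\<^sup>+y. \<integral>\<^sup>+x. h (x, y) \<partial>N1 \<partial>N1)"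
proof -
  have "h \<in> borel_measurable (N1 \<Otimes>\<^sub>M N1)"
    using assms sets_N2 by (metis N2_def measurable_cong_sets)
  then show ?thesis
    unfolding N2_def by (rule N2_pair.nn_integral_snd [symmetric])
qed

text \<open>Completing the square: phi(x + h) exp(h (x + h) - h^2/2) = phi(x) for the normal density
  phi. This is the one-dimensional Cameron-Martin formula.\<close>

lemma nn_integral_N1_shift:
  assumes [measurable]: "g \<in> borel_measurable borel"
  shows "(\<integral>\<^sup>+x. g (x + h) \<partial>N1) = (\<integral>\<^sup>+x. ennreal (exp (h * x - h\<^sup>2 / 2)) * g x \<partial>N1)"
proof -
  have "(\<integral>\<^sup>+x. ennreal (exp (h * x - h\<^sup>2 / 2)) * g x \<partial>N1) =
      (\<integral>\<^sup>+x. ennreal (std_normal_density x) * (ennreal (exp (h * x - h\<^sup>2 / 2)) * g x) \<partial>lborel)"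
    by (subst nn_integral_density) auto
  also have "\<dots> = (\<integral>\<^sup>+x. ennreal (std_normal_density (h + 1 * x)) *
      (ennreal (exp (h * (h + 1 * x) - h\<^sup>2 / 2)) * g (h + 1 * x)) \<partial>lborel)"
    by (subst nn_integral_real_affine[where c = 1 and t = h]) auto
  also have "\<dots> = (\<integral>\<^sup>+x. ennreal (std_normal_density x) * g (x + h) \<partial>lborel)"
  proof (rule nn_integral_cong)
    fix x
    have "std_normal_density (h + 1 * x) * exp (h * (h + 1 * x) - h\<^sup>2 / 2) = std_normal_density x"
      by (simp add: std_normal_density_def flip: exp_add)
        (simp add: field_simps power2_eq_square)
    then show "ennreal (std_normal_density (h + 1 * x)) *
        (ennreal (exp (h * (h + 1 * x) - h\<^sup>2 / 2)) * g (h + 1 * x)) =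
        ennreal (std_normal_density x) * g (x + h)"
      by (simp add: mult.assoc [symmetric] ennreal_mult' [symmetric] add.commute)
  qed
  also have "\<dots> = (\<integral>\<^sup>+x. g (x + h) \<partial>N1)"
    by (subst nn_integral_density) auto
  finally show ?thesis ..
qed

lemma nn_integral_N2_shift:
  assumes [measurable]: "g \<in> borel_measurable borel"
  shows "(\<integral>\<^sup>+(x, y). g (x + h, y + k) \<partial>N2) =
    (\<integral>\<^sup>+(x, y). ennreal (exp (h * x + k * y - (h\<^sup>2 + k\<^sup>2) / 2)) * g (x, y) \<partial>N2)"
proof -
  have "(\<integral>\<^sup>+(x, y). g (x + h, y + k) \<partial>N2) = (\<integral>\<^sup>+y. \<integral>\<^sup>+x. g (x + h, y + k) \<partial>N1 \<partial>N1)"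
    by (subst nn_integral_N2) (auto simp: split_beta')
  also have "\<dots> = (\<integral>\<^sup>+y. \<integral>\<^sup>+x. ennreal (exp (h * x - h\<^sup>2 / 2)) * g (x, y + k) \<partial>N1 \<partial>N1)"
    by (intro nn_integral_cong nn_integral_N1_shift) simp
  also have "\<dots> = (\<integral>\<^sup>+y. ennreal (exp (k * y - k\<^sup>2 / 2)) *
      (\<integral>\<^sup>+x. ennreal (exp (h * x - h\<^sup>2 / 2)) * g (x, y) \<partial>N1) \<partial>N1)"
    by (rule nn_integral_N1_shift) simp
  also have "\<dots> = (\<integral>\<^sup>+y. \<integral>\<^sup>+x. ennreal (exp (h * x + k * y - (h\<^sup>2 + k\<^sup>2) / 2)) * g (x, y) \<partial>N1 \<partial>N1)"
  proof (intro nn_integral_cong)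
    fix y
    have e: "exp (k * y - k\<^sup>2 / 2) * exp (h * x - h\<^sup>2 / 2) = exp (h * x + k * y - (h\<^sup>2 + k\<^sup>2) / 2)" for x
      by (simp add: algebra_simps add_divide_distrib flip: exp_add)
    have "ennreal (exp (k * y - k\<^sup>2 / 2)) * (\<integral>\<^sup>+x. ennreal (exp (h * x - h\<^sup>2 / 2)) * g (x, y) \<partial>N1)
      = (\<integral>\<^sup>+x. ennreal (exp (k * y - k\<^sup>2 / 2)) * (ennreal (exp (h * x - h\<^sup>2 / 2)) * g (x, y)) \<partial>N1)"
      by (rule nn_integral_cmult [symmetric]) simp
    then show "ennreal (exp (k * y - k\<^sup>2 / 2)) * (\<integral>\<^sup>+x. ennreal (exp (h * x - h\<^sup>2 / 2)) * g (x, y) \<partial>N1)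
      = (\<integral>\<^sup>+x. ennreal (exp (h * x + k * y - (h\<^sup>2 + k\<^sup>2) / 2)) * g (x, y) \<partial>N1)"
      by (simp add: mult.assoc [symmetric] ennreal_mult' [symmetric] e)
  qed
  also have "\<dots> = (\<integral>\<^sup>+(x, y). ennreal (exp (h * x + k * y - (h\<^sup>2 + k\<^sup>2) / 2)) * g (x, y) \<partial>N2)"
    by (subst nn_integral_N2) (auto simp: split_beta')
  finally show ?thesis .
qed

text \<open>As an identity of measures, the shift formula passes to Bochner integrals, both for
  integrability and for values.\<close>

lemma distr_N2_shift:
  "distr N2 borel (\<lambda>(x, y). (x + h, y + k)) =
    density N2 (\<lambda>(x, y). exp (h * x + k * y - (h\<^sup>2 + k\<^sup>2) / 2))" (is "?L = ?R")
proof (rule measure_eqI)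
  fix A assume "A \<in> sets ?L"
  then have A [measurable]: "A \<in> sets borel" by simp
  have "emeasure ?L A = (\<integral>\<^sup>+p. indicator A p \<partial>?L)"
    by simp
  also have "\<dots> = (\<integral>\<^sup>+(x, y). indicator A (x + h, y + k) \<partial>N2)"
    by (subst nn_integral_distr) (auto simp: split_beta')
  also have "\<dots> = (\<integral>\<^sup>+(x, y). ennreal (exp (h * x + k * y - (h\<^sup>2 + k\<^sup>2) / 2)) * indicator A (x, y) \<partial>N2)"
    by (rule nn_integral_N2_shift) simp
  also have "\<dots> = emeasure ?R A"
    by (subst emeasure_density) (auto simp: split_beta')
  finally show "emeasure ?L A = emeasure ?R A" .
qed simp

lemma integral_N2_shift:
  fixes g :: "real \<times> real \<Rightarrow> real"
  assumes [measurable]: "g \<in> borel_measurable borel"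
  shows "integrable N2 (\<lambda>(x, y). g (x + h, y + k)) \<longleftrightarrow>
      integrable N2 (\<lambda>(x, y). exp (h * x + k * y - (h\<^sup>2 + k\<^sup>2) / 2) * g (x, y))" (is ?I)
    and "(\<integral>(x, y). g (x + h, y + k) \<partial>N2) =
      (\<integral>(x, y). exp (h * x + k * y - (h\<^sup>2 + k\<^sup>2) / 2) * g (x, y) \<partial>N2)" (is ?E)
proof -
  let ?s = "\<lambda>(x, y). (x + h, y + k)" and ?d = "\<lambda>(x, y). exp (h * x + k * y - (h\<^sup>2 + k\<^sup>2) / 2)"
  have [measurable]: "?s \<in> N2 \<rightarrow>\<^sub>M borel" "?d \<in> borel_measurable N2" by (simp_all add: split_beta')
  have 1: "(\<lambda>(x, y). g (x + h, y + k)) = (\<lambda>p. g (?s p))"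
    and 2: "(\<lambda>(x, y). exp (h * x + k * y - (h\<^sup>2 + k\<^sup>2) / 2) * g (x, y)) = (\<lambda>p. ?d p *\<^sub>R g p)"
    by auto
  have "integrable N2 (\<lambda>p. g (?s p)) \<longleftrightarrow> integrable (distr N2 borel ?s) g"
    by (rule integrable_distr_eq [symmetric]) simp_all
  also have "\<dots> \<longleftrightarrow> integrable N2 (\<lambda>p. ?d p *\<^sub>R g p)"
    unfolding distr_N2_shift by (rule integrable_density) auto
  finally show ?I unfolding 1 2 .
  have "(\<integral>p. g (?s p) \<partial>N2) = integral\<^sup>L (distr N2 borel ?s) g"
    by (rule integral_distr [symmetric]) simp_all
  also have "\<dots> = (\<integral>p. ?d p *\<^sub>R g p \<partial>N2)"
    unfolding distr_N2_shift by (rule integral_density) auto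
  finally show ?E unfolding 1 2 .
qed

text \<open>The shift formula with constant g shows that the exponential moment is
  exp(a^2/2).\<close>

lemma integrable_N1_exp: "integrable N1 (\<lambda>x. exp (a * x))"
proof (rule integrableI_bounded)
  have "(\<integral>\<^sup>+x. norm (exp (a * x)) \<partial>N1) =
      (\<integral>\<^sup>+x. ennreal (exp (a\<^sup>2 / 2)) * (ennreal (exp (a * x - a\<^sup>2 / 2)) * 1) \<partial>N1)"
    by (intro nn_integral_cong) (simp flip: ennreal_mult' exp_add)
  also have "\<dots> = ennreal (exp (a\<^sup>2 / 2)) * (\<integral>\<^sup>+x. ennreal (exp (a * x - a\<^sup>2 / 2)) * 1 \<partial>N1)"
    by (rule nn_integral_cmult) simp
  also have "\<dots> = ennreal (exp (a\<^sup>2 / 2))"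
    by (subst nn_integral_N1_shift [symmetric]) (auto simp: N1.emeasure_space_1[simplified])
  finally show "(\<integral>\<^sup>+x. norm (exp (a * x)) \<partial>N1) < \<infinity>" by simp
qed simp

lemma integrable_N1_exp_abs: "integrable N1 (\<lambda>x. exp (a * \<bar>x\<bar>))"
proof (rule Bochner_Integration.integrable_bound)
  show "integrable N1 (\<lambda>x. exp (a * x) + exp (- a * x))"
    by (intro Bochner_Integration.integrable_add integrable_N1_exp)
  show "AE x in N1. norm (exp (a * \<bar>x\<bar>)) \<le> norm (exp (a * x) + exp (- a * x))"
  proof (rule AE_I2)
    fix x
    have "exp (a * \<bar>x\<bar>) \<le> exp (a * x) + exp (- a * x)"
      by (cases "x \<ge> 0") auto
    then show "norm (exp (a * \<bar>x\<bar>)) \<le> norm (exp (a * x) + exp (- a * x))"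
      by simp
  qed
qed simp

lemma integrable_N2_exp_abs: "integrable N2 (\<lambda>(x, y). exp (a * (\<bar>x\<bar> + \<bar>y\<bar>)))"
proof -
  let ?e = "\<lambda>x. ennreal (exp (a * \<bar>x\<bar>))"
  have fin: "(\<integral>\<^sup>+x. ?e x \<partial>N1) < \<infinity>"
    using integrable_N1_exp_abs[of a] by (simp add: integrable_iff_bounded)
  have "(\<integral>\<^sup>+p. norm (case p of (x, y) \<Rightarrow> exp (a * (\<bar>x\<bar> + \<bar>y\<bar>))) \<partial>N2) = (\<integral>\<^sup>+y. \<integral>\<^sup>+x. ?e y * ?e x \<partial>N1 \<partial>N1)"
    by (subst nn_integral_N2)
      (auto simp: split_beta' distrib_left exp_add ennreal_mult' mult.commute intro!: nn_integral_cong)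
  also have "\<dots> = (\<integral>\<^sup>+x. ?e x \<partial>N1) * (\<integral>\<^sup>+x. ?e x \<partial>N1)"
    by (simp add: nn_integral_cmult nn_integral_multc)
  also have "\<dots> < \<infinity>"
    using fin by (simp add: ennreal_mult_less_top)
  finally show ?thesis
    by (intro integrableI_bounded) (auto simp: split_beta')
qed

section \<open>Coordinates in \<open>real^2\<close> and Lebesgue measure\<close>

definition vec2 :: "real \<Rightarrow> real \<Rightarrow> real^2" where
  "vec2 x y = vector [x, y]"

lemma vec2_nth [simp]: "vec2 x y $ 1 = x" "vec2 x y $ 2 = y"
  by (simp_all add: vec2_def)

lemma vec2_add: "vec2 a b + vec2 c d = vec2 (a + c) (b + d)"
  by (simp add: vec_eq_iff forall_2)

lemma continuous_on_vec2 [continuous_intros]: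
  assumes "continuous_on A f" "continuous_on A g"
  shows "continuous_on A (\<lambda>x. vec2 (f x) (g x))"
proof (rule continuous_on_vec_lambda[THEN continuous_on_eq, of _ "\<lambda>i x. if i = 1 then f x else g x"])
  show "continuous_on A (\<lambda>x. if i = 1 then f x else g x)" for i :: 2
    using assms by (cases "i = 1") auto
qed (auto simp: vec_eq_iff forall_2)

lemma tendsto_vec2 [tendsto_intros]:
  assumes "(f \<longlongrightarrow> a) F" "(g \<longlongrightarrow> b) F"
  shows "((\<lambda>x. vec2 (f x) (g x)) \<longlongrightarrow> vec2 a b) F"
proof (rule vec_tendstoI)
  show "((\<lambda>x. vec2 (f x) (g x) $ i) \<longlongrightarrow> vec2 a b $ i) F" for i
    using assms exhaust_2[of i] by auto
qed

lemma borel_measurable_vec2 [measurable (raw)]: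
  assumes [measurable]: "f \<in> borel_measurable M" "g \<in> borel_measurable M"
  shows "(\<lambda>x. vec2 (f x) (g x)) \<in> borel_measurable M"
proof -
  have "(\<lambda>p. vec2 (fst p) (snd p)) \<in> borel_measurable borel"
    by (intro borel_measurable_continuous_onI continuous_intros)
  then have "(\<lambda>x. (\<lambda>p. vec2 (fst p) (snd p)) (f x, g x)) \<in> borel_measurable M"
    by (rule measurable_compose_rev) measurable
  then show ?thesis by simp
qed

lemma borel_measurable_vec_nth2 [measurable]: "(\<lambda>z::real^2. z $ i) \<in> borel_measurable borel"
  by (intro borel_measurable_continuous_onI continuous_intros)

text \<open>Lebesgue measure is determined by its values on boxes, and \<open>vec2\<close> pulls
  boxes of \<open>real^2\<close> back to boxes of pairs.\<close>

lemma lborel_vec2: "(lborel :: (real^2) measure) = distr lborel borel (\<lambda>(x, y). vec2 x y)"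
proof (rule lborel_eqI)
  fix l u :: "real^2"
  assume le: "\<And>b. b \<in> Basis \<Longrightarrow> l \<bullet> b \<le> u \<bullet> b"
  have B: "(Basis :: (real^2) set) = {axis 1 1, axis 2 1}"
    by (auto simp: Basis_vec_def UNIV_2)
  have ne: "axis 1 1 \<noteq> (axis 2 1 :: real^2)"
    by (simp add: axis_eq_axis)
  have lu: "l $ 1 \<le> u $ 1" "l $ 2 \<le> u $ 2"
    using le[of "axis 1 1"] le[of "axis 2 1"] by (auto simp: B inner_axis)
  have "(\<lambda>(x, y). vec2 x y) -` box l u = box (l $ 1, l $ 2) (u $ 1, u $ 2)"
    by (auto simp: box_def B inner_axis Basis_prod_def)
  then have "emeasure (distr lborel borel (\<lambda>(x, y). vec2 x y)) (box l u)
      = emeasure lborel (box (l $ 1, l $ 2) (u $ 1, u $ 2))"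
    by (subst emeasure_distr) (auto simp: split_beta')
  also have "\<dots> = (u $ 1 - l $ 1) * (u $ 2 - l $ 2)"
    using lu by (subst emeasure_lborel_box) (auto simp: Basis_prod_def)
  also have "\<dots> = (\<Prod>b\<in>Basis. (u - l) \<bullet> b)"
    unfolding B using ne by (simp add: inner_axis)
  finally show "emeasure (distr lborel borel (\<lambda>(x, y). vec2 x y)) (box l u) = (\<Prod>b\<in>Basis. (u - l) \<bullet> b)" .
qed simp

lemma nn_integral_lborel_vec2:
  assumes [measurable]: "g \<in> borel_measurable borel"
  shows "(\<integral>\<^sup>+z. g z \<partial>(lborel :: (real^2) measure)) = (\<integral>\<^sup>+y. \<integral>\<^sup>+x. g (vec2 x y) \<partial>lborel \<partial>lborel)"
proof -
  have "(\<integral>\<^sup>+z. g z \<partial>(lborel :: (real^2) measure)) = (\<integral>\<^sup>+(x, y). g (vec2 x y) \<partial>lborel)"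
    unfolding lborel_vec2 by (subst nn_integral_distr) (auto simp: split_beta')
  also have "\<dots> = (\<integral>\<^sup>+p. g (vec2 (fst p) (snd p)) \<partial>(lborel \<Otimes>\<^sub>M lborel))"
    by (simp add: lborel_prod split_beta')
  also have "\<dots> = (\<integral>\<^sup>+y. \<integral>\<^sup>+x. g (vec2 x y) \<partial>lborel \<partial>lborel)"
    by (subst lborel_pair.nn_integral_snd [symmetric]) auto
  finally show ?thesis .
qed

text \<open>
  Gaussian vectors are written as \<open>tri a b d\<close> of a standard Gaussian vector, where
  \<open>a, b, d\<close> are the entries of an upper triangular Cholesky factor of the covariance matrix.
  This factor is preserved in shape by the upper triangular flow of the drift.
\<close>

definition tri :: "real \<Rightarrow> real \<Rightarrow> real \<Rightarrow> real \<times> real \<Rightarrow> real^2" where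
  "tri a b d = (\<lambda>(x, y). vec2 (a * x + b * y) (d * y))"

text \<open>Density of the law of \<open>tri a b d\<close> under \<open>N2\<close>: the standard
  normal density at the preimage ((z1 - b z2/d)/a, z2/d), divided by the absolute determinant |a
  d|.\<close>

definition gdens :: "real \<Rightarrow> real \<Rightarrow> real \<Rightarrow> real^2 \<Rightarrow> real" where
  "gdens a b d z = exp (- (((z $ 1 - b * (z $ 2 / d)) / a)\<^sup>2 + (z $ 2 / d)\<^sup>2) / 2) / (2 * pi * \<bar>a * d\<bar>)"

lemma tri_borel [measurable]: "tri a b d \<in> borel_measurable borel"
  unfolding tri_def by (simp add: split_beta')

lemma gdens_borel [measurable]: "gdens a b d \<in> borel_measurable borel"
  unfolding gdens_def by measurable

lemma gdens_pos: "a \<noteq> 0 \<Longrightarrow> d \<noteq> 0 \<Longrightarrow> gdens a b d z > 0"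
  by (simp add: gdens_def)

lemma gdens_tri:
  assumes "a \<noteq> 0" "d \<noteq> 0"
  shows "\<bar>a * d\<bar> * gdens a b d (tri a b d (x, y)) = std_normal_density x * std_normal_density y"
proof -
  have "sqrt (2 * pi) * sqrt (2 * pi) = 2 * pi" by simp
  then show ?thesis
    using assms by (simp add: gdens_def tri_def std_normal_density_def flip: exp_add)
qed

text \<open>Two affine substitutions on the line, y -> d y and then x -> a x + b y for fixed y,
  replace a substitution in the plane; this is where the triangular shape pays off.\<close>

lemma nn_integral_tri:
  assumes "a \<noteq> 0" "d \<noteq> 0" and [measurable]: "g \<in> borel_measurable borel"
  shows "(\<integral>\<^sup>+p. g (tri a b d p) \<partial>N2) = (\<integral>\<^sup>+z. ennreal (gdens a b d z) * g z \<partial>lborel)"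
proof -
  have "(\<integral>\<^sup>+z. ennreal (gdens a b d z) * g z \<partial>lborel)
     = (\<integral>\<^sup>+y. \<integral>\<^sup>+x. ennreal (gdens a b d (vec2 x y)) * g (vec2 x y) \<partial>lborel \<partial>lborel)"
    by (rule nn_integral_lborel_vec2) simp
  also have "\<dots> = \<bar>d\<bar> * (\<integral>\<^sup>+y. \<integral>\<^sup>+x. ennreal (gdens a b d (vec2 x (d * y))) * g (vec2 x (d * y)) \<partial>lborel \<partial>lborel)"
    using assms by (subst nn_integral_real_affine[where c = d and t = 0]) auto
  also have "\<dots> = \<bar>d\<bar> * (\<integral>\<^sup>+y. \<bar>a\<bar> * (\<integral>\<^sup>+x. ennreal (gdens a b d (tri a b d (x, y))) * g (tri a b d (x, y)) \<partial>lborel) \<partial>lborel)"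
  proof (intro arg_cong2[where f = "(*)"] refl nn_integral_cong)
    fix y
    show "(\<integral>\<^sup>+x. ennreal (gdens a b d (vec2 x (d * y))) * g (vec2 x (d * y)) \<partial>lborel) =
      \<bar>a\<bar> * (\<integral>\<^sup>+x. ennreal (gdens a b d (tri a b d (x, y))) * g (tri a b d (x, y)) \<partial>lborel)"
      using assms(1) by (subst nn_integral_real_affine[where c = a and t = "b * y"])
        (auto simp: tri_def add.commute)
  qed
  also have "\<dots> = (\<integral>\<^sup>+y. \<integral>\<^sup>+x. \<bar>d\<bar> * (\<bar>a\<bar> * (ennreal (gdens a b d (tri a b d (x, y))) * g (tri a b d (x, y)))) \<partial>lborel \<partial>lborel)"
    by (simp add: nn_integral_cmult)
  also have "\<dots> = (\<integral>\<^sup>+y. \<integral>\<^sup>+x. ennreal (std_normal_density y) * (ennreal (std_normal_density x) * g (tri a b d (x, y))) \<partial>lborel \<partial>lborel)"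
  proof (intro nn_integral_cong)
    fix x y
    have "\<bar>d\<bar> * \<bar>a\<bar> * gdens a b d (tri a b d (x, y)) = std_normal_density y * std_normal_density x"
      using gdens_tri[OF assms(1,2), of b x y] by (simp add: abs_mult mult_ac)
    then have "ennreal \<bar>d\<bar> * ennreal \<bar>a\<bar> * ennreal (gdens a b d (tri a b d (x, y))) =
        ennreal (std_normal_density y) * ennreal (std_normal_density x)"
      by (simp flip: ennreal_mult')
    then show "\<bar>d\<bar> * (\<bar>a\<bar> * (ennreal (gdens a b d (tri a b d (x, y))) * g (tri a b d (x, y)))) =
        ennreal (std_normal_density y) * (ennreal (std_normal_density x) * g (tri a b d (x, y)))"
      by (simp add: mult.assoc [symmetric])
  qed
  also have "\<dots> = (\<integral>\<^sup>+y. \<integral>\<^sup>+x. g (tri a b d (x, y)) \<partial>N1 \<partial>N1)"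
    by (simp add: nn_integral_density nn_integral_cmult)
  also have "\<dots> = (\<integral>\<^sup>+p. g (tri a b d p) \<partial>N2)"
    by (rule nn_integral_N2 [symmetric]) simp
  finally show ?thesis ..
qed

lemma distr_N2_tri:
  assumes "a \<noteq> 0" "d \<noteq> 0"
  shows "distr N2 borel (tri a b d) = density lborel (gdens a b d)" (is "?L = ?R")
proof (rule measure_eqI)
  fix A assume "A \<in> sets ?L"
  then have A [measurable]: "A \<in> sets borel" by simp
  have "emeasure ?L A = (\<integral>\<^sup>+p. indicator A p \<partial>?L)"
    by simp
  also have "\<dots> = (\<integral>\<^sup>+p. indicator A (tri a b d p) \<partial>N2)"
    by (subst nn_integral_distr) auto
  also have "\<dots> = emeasure ?R A"
    by (subst nn_integral_tri[OF assms]) (auto simp: emeasure_density)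
  finally show "emeasure ?L A = emeasure ?R A" .
qed simp

section \<open>Functions of at most exponential growth\<close>

definition exp_growth :: "(real \<times> real \<Rightarrow> real) \<Rightarrow> bool" where
  "exp_growth f \<longleftrightarrow> f \<in> borel_measurable borel \<and>
     (\<exists>C a. \<forall>p. \<bar>f p\<bar> \<le> C * exp (a * (\<bar>fst p\<bar> + \<bar>snd p\<bar>)))"

lemma exp_growthI:
  assumes "f \<in> borel_measurable borel"
    and "\<And>p. \<bar>f p\<bar> \<le> C * exp (a * (\<bar>fst p\<bar> + \<bar>snd p\<bar>))"
  shows "exp_growth f"
  unfolding exp_growth_def using assms by blast

lemma exp_growthE:
  assumes "exp_growth f"
  obtains C a where "0 \<le> C" "0 \<le> a" "\<And>p. \<bar>f p\<bar> \<le> C * exp (a * (\<bar>fst p\<bar> + \<bar>snd p\<bar>))"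
proof -
  obtain C a where Ca: "\<And>p. \<bar>f p\<bar> \<le> C * exp (a * (\<bar>fst p\<bar> + \<bar>snd p\<bar>))"
    using assms unfolding exp_growth_def by blast
  have "0 \<le> C"
    using Ca[of "(0, 0)"] abs_ge_zero[of "f (0, 0)"] by simp
  moreover have "\<bar>f p\<bar> \<le> C * exp (\<bar>a\<bar> * (\<bar>fst p\<bar> + \<bar>snd p\<bar>))" for p
    by (rule order_trans[OF Ca]) (intro mult_left_mono \<open>0 \<le> C\<close>, simp add: mult_right_mono)
  ultimately show ?thesis
    using that[of C "\<bar>a\<bar>"] by simp
qed

lemma exp_growth_measurable: "exp_growth f \<Longrightarrow> f \<in> borel_measurable borel"
  by (simp add: exp_growth_def)

lemma exp_growth_const: "exp_growth (\<lambda>_. k)"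
  by (rule exp_growthI[where C = "\<bar>k\<bar>" and a = 0]) simp_all

lemma abs_le_exp_abs: "\<bar>x\<bar> \<le> exp \<bar>x::real\<bar>"
  using exp_ge_add_one_self[of "\<bar>x\<bar>"] by linarith

lemma exp_growth_fst: "exp_growth fst" and exp_growth_snd: "exp_growth snd"
proof -
  have "\<bar>x\<bar> \<le> exp (\<bar>x\<bar> + \<bar>y\<bar>)" for x y :: real
    by (rule order_trans[OF abs_le_exp_abs]) simp
  from this[of "fst p" "snd p" for p] this[of "snd p" "fst p" for p]
  show "exp_growth fst" "exp_growth snd"
    by (intro exp_growthI[where C = 1 and a = 1]; simp add: add.commute)+
qed

lemma exp_growth_add:
  assumes "exp_growth f" "exp_growth g"
  shows "exp_growth (\<lambda>p. f p + g p)"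
proof -
  obtain C a where f: "0 \<le> C" "0 \<le> a" "\<And>p. \<bar>f p\<bar> \<le> C * exp (a * (\<bar>fst p\<bar> + \<bar>snd p\<bar>))"
    using exp_growthE[OF assms(1)] by blast
  obtain D b where g: "0 \<le> D" "0 \<le> b" "\<And>p. \<bar>g p\<bar> \<le> D * exp (b * (\<bar>fst p\<bar> + \<bar>snd p\<bar>))"
    using exp_growthE[OF assms(2)] by blast
  have "\<bar>f p + g p\<bar> \<le> (C + D) * exp ((a + b) * (\<bar>fst p\<bar> + \<bar>snd p\<bar>))" for p
  proof -
    have "C * exp (a * (\<bar>fst p\<bar> + \<bar>snd p\<bar>)) \<le> C * exp ((a + b) * (\<bar>fst p\<bar> + \<bar>snd p\<bar>))"
      using f g by (intro mult_left_mono) (auto intro!: mult_right_mono)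
    moreover have "D * exp (b * (\<bar>fst p\<bar> + \<bar>snd p\<bar>)) \<le> D * exp ((a + b) * (\<bar>fst p\<bar> + \<bar>snd p\<bar>))"
      using f g by (intro mult_left_mono) (auto intro!: mult_right_mono)
    ultimately show ?thesis
      using f(3)[of p] g(3)[of p] abs_triangle_ineq[of "f p" "g p"] by (simp add: distrib_right)
  qed
  then show ?thesis
    using assms[THEN exp_growth_measurable] by (intro exp_growthI) simp_all
qed

lemma exp_growth_mult:
  assumes "exp_growth f" "exp_growth g"
  shows "exp_growth (\<lambda>p. f p * g p)"
proof -
  obtain C a where f: "0 \<le> C" "0 \<le> a" "\<And>p. \<bar>f p\<bar> \<le> C * exp (a * (\<bar>fst p\<bar> + \<bar>snd p\<bar>))"
    using exp_growthE[OF assms(1)] by blast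
  obtain D b where g: "0 \<le> D" "0 \<le> b" "\<And>p. \<bar>g p\<bar> \<le> D * exp (b * (\<bar>fst p\<bar> + \<bar>snd p\<bar>))"
    using exp_growthE[OF assms(2)] by blast
  have "\<bar>f p * g p\<bar> \<le> (C * D) * exp ((a + b) * (\<bar>fst p\<bar> + \<bar>snd p\<bar>))" for p
    using mult_mono[OF f(3)[of p] g(3)[of p]] f g
    by (simp add: abs_mult distrib_right exp_add mult_ac)
  then show ?thesis
    using assms[THEN exp_growth_measurable] by (intro exp_growthI) simp_all
qed

lemma exp_growth_cmult: "exp_growth f \<Longrightarrow> exp_growth (\<lambda>p. k * f p)"
  by (intro exp_growth_mult exp_growth_const)

lemma exp_growth_diff: "exp_growth f \<Longrightarrow> exp_growth g \<Longrightarrow> exp_growth (\<lambda>p. f p - g p)"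
  using exp_growth_add[of f "\<lambda>p. (- 1) * g p"] exp_growth_cmult[of g "- 1"] by simp

lemma exp_growth_sum:
  "(\<And>i. i \<in> I \<Longrightarrow> exp_growth (f i)) \<Longrightarrow> exp_growth (\<lambda>p. \<Sum>i\<in>I. f i p)"
  by (induction I rule: infinite_finite_induct) (auto intro: exp_growth_add exp_growth_const)

lemma exp_growth_power: "exp_growth f \<Longrightarrow> exp_growth (\<lambda>p. f p ^ n)"
  by (induction n) (auto intro: exp_growth_mult exp_growth_const)

lemma exp_growth_herm: 
  assumes "exp_growth f"
  shows "exp_growth (\<lambda>p. herm v n (f p))"
proof (induction n rule: induct_nat_012)
  case (ge2 n)
  then have "exp_growth (\<lambda>p. (1 / real (Suc (Suc n))) * (f p * herm v (Suc n) (f p) - v * herm v n (f p)))"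
    by (intro exp_growth_cmult exp_growth_diff exp_growth_mult assms)
  then show ?case by (simp add: herm_step)
qed (simp_all add: exp_growth_const assms)

lemma exp_growth_exp: "exp_growth (\<lambda>p. exp (h * fst p + k * snd p))"
proof -
  have "h * fst p + k * snd p \<le> (\<bar>h\<bar> + \<bar>k\<bar>) * (\<bar>fst p\<bar> + \<bar>snd p\<bar>)" for p
  proof -
    have "h * fst p + k * snd p \<le> \<bar>h\<bar> * \<bar>fst p\<bar> + \<bar>k\<bar> * \<bar>snd p\<bar>"
      using abs_ge_self[of "h * fst p"] abs_ge_self[of "k * snd p"] by (simp add: abs_mult)
    also have "\<dots> \<le> (\<bar>h\<bar> + \<bar>k\<bar>) * (\<bar>fst p\<bar> + \<bar>snd p\<bar>)"
      by (simp add: algebra_simps)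
    finally show ?thesis .
  qed
  then show ?thesis
    by (intro exp_growthI[where C = 1 and a = "\<bar>h\<bar> + \<bar>k\<bar>"]) simp_all
qed

text \<open>The bound exp(a (|x| + |y|)) is integrable under \<open>N2\<close>, so membership in
  this algebra serves as the integrability test for the polynomials and exponentials below.\<close>

lemma exp_growth_integrable:
  assumes "exp_growth f"
  shows "integrable N2 f"
proof -
  obtain C a where f: "\<And>p. \<bar>f p\<bar> \<le> C * exp (a * (\<bar>fst p\<bar> + \<bar>snd p\<bar>))"
    using exp_growthE[OF assms] by blast
  show ?thesis
  proof (rule Bochner_Integration.integrable_bound)
    show "integrable N2 (\<lambda>p. C * exp (a * (\<bar>fst p\<bar> + \<bar>snd p\<bar>)))"
      using integrable_N2_exp_abs[of a] by (simp add: split_beta')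
    show "AE p in N2. norm (f p) \<le> norm (C * exp (a * (\<bar>fst p\<bar> + \<bar>snd p\<bar>)))"
      using f by (intro AE_I2) (auto intro: order_trans[OF _ abs_ge_self])
  qed (use exp_growth_measurable[OF assms] in simp)
qed

lemma integral_N2_iterated:
  fixes f :: "real \<times> real \<Rightarrow> real"
  assumes "integrable N2 f"
  shows "(\<integral>p. f p \<partial>N2) = (\<integral>y. \<integral>x. f (x, y) \<partial>N1 \<partial>N1)"
  using N2_pair.integral_snd[of "\<lambda>x y. f (x, y)"] assms by (simp add: N2_def)

lemma integral_N1_power:
  "integrable N1 (\<lambda>x. x ^ k)"
  "(\<integral>x. x ^ k \<partial>N1) = fact k * herm (- 1) k 0"
proof -
  show "integrable N1 (\<lambda>x. x ^ k)"
    using integrable_std_normal_moment[of k] by (subst integrable_density) auto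
  have *: "(\<integral>x. x ^ k \<partial>N1) = (\<integral>x. std_normal_density x * x ^ k \<partial>lborel)"
    by (subst integral_density) auto
  show "(\<integral>x. x ^ k \<partial>N1) = fact k * herm (- 1) k 0"
  proof (cases "even k")
    case True
    then obtain j where "k = 2 * j" by blast
    then show ?thesis
      unfolding * using integral_std_normal_moment_even[of j] by (simp add: herm_at_0 power_divide)
  next
    case False
    then obtain j where "k = 2 * j + 1" using oddE by blast
    then show ?thesis
      unfolding * using integral_std_normal_moment_odd[of j] by (simp add: herm_at_0)
  qed
qed

text \<open>Averaging over Gaussian noise of variance q^2 is a heat flow and lowers the variance
  parameter by q^2: up to factorials the moments of q x are \<open>herm\<close> with parameter -q^2
  at 0, and \<open>herm_add\<close> resums the expansion.\<close>

lemma integral_N1_herm: "(\<integral>x. herm v n (x0 + q * x) \<partial>N1) = herm (v - q\<^sup>2) n x0"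
proof -
  have eq: "herm v n (x0 + q * x) = (\<Sum>k\<le>n. herm v k x0 * (q ^ (n - k) / fact (n - k)) * x ^ (n - k))" for x
    using herm_add[of v 0 n x0 "q * x"] by (simp add: herm_var_0 power_mult_distrib mult.assoc)
  have "(\<integral>x. herm v n (x0 + q * x) \<partial>N1) =
      (\<Sum>k\<le>n. herm v k x0 * (q ^ (n - k) / fact (n - k)) * (\<integral>x. x ^ (n - k) \<partial>N1))"
    unfolding eq by (subst Bochner_Integration.integral_sum) (auto intro!: integrable_mult_right integral_N1_power)
  also have "\<dots> = (\<Sum>k\<le>n. herm v k x0 * herm (- q\<^sup>2) (n - k) 0)"
    using herm_scale[of q "- 1" _ 0] by (auto simp: integral_N1_power intro!: sum.cong)
  also have "\<dots> = herm (v - q\<^sup>2) n x0"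
    using herm_add[of v "- q\<^sup>2" n x0 0] by simp
  finally show ?thesis .
qed

lemma exp_growth_linear: "exp_growth (\<lambda>p. x0 + a * fst p + b * snd p)"
  by (intro exp_growth_add exp_growth_cmult exp_growth_const exp_growth_fst exp_growth_snd)

lemma integral_N2_herm:
  "(\<integral>p. herm v n (x0 + a * fst p + b * snd p) \<partial>N2) = herm (v - a\<^sup>2 - b\<^sup>2) n x0"
proof -
  have "(\<integral>p. herm v n (x0 + a * fst p + b * snd p) \<partial>N2) =
      (\<integral>y. \<integral>x. herm v n ((x0 + b * y) + a * x) \<partial>N1 \<partial>N1)"
    by (subst integral_N2_iterated[OF exp_growth_integrable[OF exp_growth_herm[OF exp_growth_linear]]])
      (simp add: ac_simps)
  then show ?thesis
    by (simp only: integral_N1_herm)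
qed

section \<open>Explicit form of the semigroup\<close>

definition mat2 :: "real \<Rightarrow> real \<Rightarrow> real \<Rightarrow> real \<Rightarrow> real^2^2" where
  "mat2 a b c d = vector [vector [a, b], vector [c, d]]"

lemma mat2_nth [simp]:
  "mat2 a b c d $ 1 $ 1 = a" "mat2 a b c d $ 1 $ 2 = b"
  "mat2 a b c d $ 2 $ 1 = c" "mat2 a b c d $ 2 $ 2 = d"
  by (simp_all add: mat2_def)

lemma mat2_arith:
  "mat2 a b c d + mat2 a' b' c' d' = mat2 (a + a') (b + b') (c + c') (d + d')"
  "k *\<^sub>R mat2 a b c d = mat2 (k * a) (k * b) (k * c) (k * d)"
  "mat2 a b c d ** mat2 a' b' c' d' =
    mat2 (a * a' + b * c') (a * b' + b * d') (c * a' + d * c') (c * b' + d * d')"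
  "transpose (mat2 a b c d) = mat2 a c b d"
  "mat 1 = mat2 1 0 0 1"
  "mat2 a b c d *v z = vec2 (a * z $ 1 + b * z $ 2) (c * z $ 1 + d * z $ 2)"
  by (simp_all add: vec_eq_iff forall_2 matrix_matrix_mult_def matrix_vector_mult_def sum_2
      transpose_def mat_def)

lemma det_mat2: "det (mat2 a b c d) = a * d - b * c"
  by (simp add: det_2)

lemma matrix_inv_mat2:
  assumes "a * d - b * c \<noteq> 0"
  shows "matrix_inv (mat2 a b c d) =
    (1 / (a * d - b * c)) *\<^sub>R mat2 d (- b) (- c) a" (is "_ = ?P")
proof -
  define k where "k = 1 / (a * d - b * c)"
  have k: "k * (a * d - b * c) = 1"
    using assms by (simp add: k_def)
  have P: "?P = mat2 (k * d) (k * - b) (k * - c) (k * a)"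
    by (simp add: k_def mat2_arith)
  have e: "a * (k * d) + b * (k * - c) = k * (a * d - b * c)" "c * (k * - b) + d * (k * a) = k * (a * d - b * c)"
    "k * d * a + k * - b * c = k * (a * d - b * c)" "k * - c * b + k * a * d = k * (a * d - b * c)"
    "a * (k * - b) + b * (k * a) = 0" "c * (k * d) + d * (k * - c) = 0"
    "k * d * b + k * - b * d = 0" "k * - c * a + k * a * c = 0"
    by (simp_all add: algebra_simps)
  have 1: "mat2 a b c d ** ?P = mat 1" and 2: "?P ** mat2 a b c d = mat 1"
    unfolding P unfolding mat2_arith(3,5) e k by (rule refl)+
  have "invertible (mat2 a b c d)"
    unfolding invertible_def using 1 2 by blast
  \<comment> \<open>\<open>matrix_inv\<close> is a chosen inverse; being a left inverse, it has to
    agree with the explicit right inverse.\<close>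
  then have "matrix_inv (mat2 a b c d) ** mat2 a b c d = mat 1"
    unfolding matrix_inv_def invertible_def by (rule someI2_ex) simp
  then have "matrix_inv (mat2 a b c d) ** mat2 a b c d ** ?P = mat 1 ** ?P"
    by simp
  then show ?thesis
    by (simp only: matrix_mul_assoc [symmetric] 1 matrix_mul_rid matrix_mul_lid)
qed

lemma mat2_decomp:
  "mat2 a b c d = a *\<^sub>R mat2 1 0 0 0 + b *\<^sub>R mat2 0 1 0 0 + c *\<^sub>R mat2 0 0 1 0 + d *\<^sub>R mat2 0 0 0 1"
  by (simp add: mat2_arith)

lemma sums_mat2:
  assumes "f sums a" "g sums b" "h sums c" "k sums d"
  shows "(\<lambda>n. mat2 (f n) (g n) (h n) (k n)) sums mat2 a b c d"
  unfolding mat2_decomp[of "f _"] mat2_decomp[of a]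
  using assms by (intro sums_add sums_scaleR_left)

lemma has_integral_mat2:
  assumes "(f has_integral a) S" "(g has_integral b) S" "(h has_integral c) S" "(k has_integral d) S"
  shows "((\<lambda>s. mat2 (f s) (g s) (h s) (k s)) has_integral mat2 a b c d) S"
  unfolding mat2_decomp[of "f _"] mat2_decomp[of a]
  using assms by (intro has_integral_add has_integral_scaleR_left)

lemma sums_jordan:
  "(\<lambda>n. 1 / fact n * (real n * b * a ^ (n - 1))) sums (b * exp a)" for a b :: real
proof -
  have "(\<lambda>n. b * (inverse (fact n) *\<^sub>R a ^ n)) sums (b * exp a)"
    by (intro sums_mult exp_converges)
  then have "(\<lambda>n. 1 / fact (Suc n) * (real (Suc n) * b * a ^ (Suc n - 1))) sums (b * exp a)"
    by (simp add: field_simps del: of_nat_Suc)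
  from sums_Suc[where f = "\<lambda>n. 1 / fact n * (real n * b * a ^ (n - 1))", OF this]
  show ?thesis by simp
qed

lemma mat_exp_jordan: "mat_exp (mat2 a b 0 a) = mat2 (exp a) (b * exp a) 0 (exp a)"
proof -
  \<comment> \<open>Powers of a Jordan block. At n = 0 the truncated exponent n - 1 is harmless,
    since the factor n vanishes.\<close>
  have p: "(((**) (mat2 a b 0 a)) ^^ n) (mat 1) = mat2 (a ^ n) (real n * b * a ^ (n - 1)) 0 (a ^ n)" for n
  proof (induction n)
    case (Suc n)
    then show ?case
      by (cases n) (simp_all add: mat2_arith algebra_simps)
  qed (simp add: mat2_arith)
  have "(\<lambda>n. mat2 (1 / fact n * a ^ n) (1 / fact n * (real n * b * a ^ (n - 1))) 0 (1 / fact n * a ^ n))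
      sums mat2 (exp a) (b * exp a) 0 (exp a)"
    using exp_converges[of a] by (intro sums_mat2 sums_jordan sums_zero) (simp_all add: field_simps)
  then show ?thesis
    unfolding mat_exp_def p mat2_arith(2) by (simp add: sums_iff)
qed

lemma mat_exp_jordan_transpose: "mat_exp (mat2 a 0 b a) = mat2 (exp a) 0 (b * exp a) (exp a)"
proof -
  have p: "(((**) (mat2 a 0 b a)) ^^ n) (mat 1) = mat2 (a ^ n) 0 (real n * b * a ^ (n - 1)) (a ^ n)" for n
  proof (induction n)
    case (Suc n)
    then show ?case
      by (cases n) (simp_all add: mat2_arith algebra_simps)
  qed (simp add: mat2_arith)
  have "(\<lambda>n. mat2 (1 / fact n * a ^ n) 0 (1 / fact n * (real n * b * a ^ (n - 1))) (1 / fact n * a ^ n))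
      sums mat2 (exp a) 0 (b * exp a) (exp a)"
    using exp_converges[of a] by (intro sums_mat2 sums_jordan sums_zero) (simp_all add: field_simps)
  then show ?thesis
    unfolding mat_exp_def p mat2_arith(2) by (simp add: sums_iff)
qed

lemma ou_B_eq: "ou_B c = mat2 (- c) 1 0 (- c)"
  by (simp add: ou_B_def mat2_def)

definition ou_flow :: "real \<Rightarrow> real \<Rightarrow> real^2 \<Rightarrow> real^2" where
  "ou_flow c t z = vec2 (exp (- c * t) * (z $ 1 + t * z $ 2)) (exp (- c * t) * z $ 2)"

lemma mat_exp_ou_B: "mat_exp (t *\<^sub>R ou_B c) *v z = ou_flow c t z"
  by (simp add: ou_B_eq mat2_arith mat_exp_jordan ou_flow_def algebra_simps)

text \<open>The integrals over \<open>[0, t]\<close> of \<open>s\<^sup>j exp (- 2 c s)\<close> for \<open>j = 0, 1, 2\<close>, the entries of \<open>Q\<^sub>t\<close>.\<close>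

definition exp_int0 :: "real \<Rightarrow> real \<Rightarrow> real" where
  "exp_int0 c t = (1 - exp (- 2 * c * t)) / (2 * c)"

definition exp_int1 :: "real \<Rightarrow> real \<Rightarrow> real" where
  "exp_int1 c t = (1 - exp (- 2 * c * t) * (1 + 2 * c * t)) / (4 * c\<^sup>2)"

definition exp_int2 :: "real \<Rightarrow> real \<Rightarrow> real" where
  "exp_int2 c t = (1 - exp (- 2 * c * t) * (1 + 2 * c * t + 2 * c\<^sup>2 * t\<^sup>2)) / (4 * c ^ 3)"

lemma has_integral_exp_int:
  assumes "c > 0" "t \<ge> 0"
  shows "((\<lambda>s. exp (- 2 * c * s)) has_integral exp_int0 c t) {0..t}"
    and "((\<lambda>s. s * exp (- 2 * c * s)) has_integral exp_int1 c t) {0..t}"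
    and "((\<lambda>s. s\<^sup>2 * exp (- 2 * c * s)) has_integral exp_int2 c t) {0..t}"
proof -
  have e: "((\<lambda>s. exp (- 2 * c * s)) has_real_derivative - 2 * c * exp (- 2 * c * s)) (at s)" for s
    by (auto intro!: derivative_eq_intros)
  have nz: "c \<noteq> 0" using assms(1) by simp
  have d: "(exp_int0 c has_real_derivative exp (- 2 * c * s)) (at s)" for s
    unfolding exp_int0_def
    by (rule DERIV_cong[OF DERIV_cdivide[OF DERIV_diff[OF DERIV_const e]]])
      (simp add: nz)
  have p1: "((\<lambda>s. 1 + 2 * c * s) has_real_derivative 2 * c) (at s)" for s
    by (auto intro!: derivative_eq_intros)
  have d1: "(exp_int1 c has_real_derivative s * exp (- 2 * c * s)) (at s)" for s
    unfolding exp_int1_def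
    by (rule DERIV_cong[OF DERIV_cdivide[OF DERIV_diff[OF DERIV_const DERIV_mult[OF e p1]]]])
      (simp add: nz field_simps power2_eq_square)
  have p2: "((\<lambda>s. 1 + 2 * c * s + 2 * c\<^sup>2 * s\<^sup>2) has_real_derivative 2 * c + 4 * c\<^sup>2 * s) (at s)" for s
    by (auto intro!: derivative_eq_intros)
  have d2: "(exp_int2 c has_real_derivative s\<^sup>2 * exp (- 2 * c * s)) (at s)" for s
    unfolding exp_int2_def
    by (rule DERIV_cong[OF DERIV_cdivide[OF DERIV_diff[OF DERIV_const DERIV_mult[OF e p2]]]])
      (simp add: nz field_simps power2_eq_square power3_eq_cube)
  have z: "exp_int0 c 0 = 0" "exp_int1 c 0 = 0" "exp_int2 c 0 = 0"
    by (simp_all add: exp_int0_def exp_int1_def exp_int2_def)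
  have I: "(f has_integral F t - F 0) {0..t}"
    if "\<And>s. (F has_real_derivative f s) (at s)" for f F :: "real \<Rightarrow> real"
    using that by (intro fundamental_theorem_of_calculus assms(2))
      (simp add: has_real_derivative_iff_has_vector_derivative has_vector_derivative_at_within)
  show "((\<lambda>s. exp (- 2 * c * s)) has_integral exp_int0 c t) {0..t}"
    using I[OF d] z by simp
  show "((\<lambda>s. s * exp (- 2 * c * s)) has_integral exp_int1 c t) {0..t}"
    using I[OF d1] z by simp
  show "((\<lambda>s. s\<^sup>2 * exp (- 2 * c * s)) has_integral exp_int2 c t) {0..t}"
    using I[OF d2] z by simp
qed

lemma exp_int0_pos: "c > 0 \<Longrightarrow> t > 0 \<Longrightarrow> exp_int0 c t > 0"
  by (simp add: exp_int0_def)

text \<open>Cauchy-Schwarz for the weight exp(-2cs) on [0, t]: integrate (s - x)^2 against it, with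
  x the weighted mean of s, which minimises the integral.\<close>

lemma exp_int1_sq_le:
  assumes "c > 0" "t > 0"
  shows "(exp_int1 c t)\<^sup>2 \<le> exp_int0 c t * exp_int2 c t"
proof -
  define x where "x = exp_int1 c t / exp_int0 c t"
  note I = has_integral_exp_int[OF assms(1) less_imp_le[OF assms(2)]]
  have "((\<lambda>s. s\<^sup>2 * exp (- 2 * c * s) + (- 2 * x) * (s * exp (- 2 * c * s)) + x\<^sup>2 * exp (- 2 * c * s))
      has_integral exp_int2 c t + (- 2 * x) * exp_int1 c t + x\<^sup>2 * exp_int0 c t) {0..t}"
    by (intro has_integral_add has_integral_mult_right I)
  moreover have "s\<^sup>2 * exp (- 2 * c * s) + (- 2 * x) * (s * exp (- 2 * c * s)) + x\<^sup>2 * exp (- 2 * c * s)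
      = (s - x)\<^sup>2 * exp (- 2 * c * s)" for s
    by (simp add: power2_eq_square algebra_simps)
  ultimately have "0 \<le> exp_int2 c t + (- 2 * x) * exp_int1 c t + x\<^sup>2 * exp_int0 c t"
    by (auto intro: has_integral_nonneg)
  also have "\<dots> = exp_int2 c t - (exp_int1 c t)\<^sup>2 / exp_int0 c t"
    using exp_int0_pos[OF assms] by (simp add: x_def power2_eq_square field_simps)
  finally show ?thesis
    using exp_int0_pos[OF assms] by (simp add: field_simps)
qed

lemma ou_Q_eq:
  assumes "c > 0" "t \<ge> 0"
  shows "ou_Q c \<sigma> t = mat2 (\<sigma>\<^sup>2 * (exp_int0 c t + exp_int2 c t)) (\<sigma>\<^sup>2 * exp_int1 c t) (\<sigma>\<^sup>2 * exp_int1 c t) (\<sigma>\<^sup>2 * exp_int0 c t)"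
proof -
  note I = has_integral_exp_int[OF assms]
  have "mat_exp (s *\<^sub>R ou_B c) ** mat_exp (s *\<^sub>R transpose (ou_B c)) =
     mat2 (exp (- 2 * c * s) + s\<^sup>2 * exp (- 2 * c * s)) (s * exp (- 2 * c * s))
       (s * exp (- 2 * c * s)) (exp (- 2 * c * s))" for s
  proof -
    have "exp (- 2 * c * s) = exp (- c * s) * exp (- c * s)"
      by (simp flip: exp_add)
    then show ?thesis
      by (simp add: ou_B_eq mat2_arith mat_exp_jordan mat_exp_jordan_transpose power2_eq_square algebra_simps)
  qed
  moreover have "((\<lambda>s. mat2 (exp (- 2 * c * s) + s\<^sup>2 * exp (- 2 * c * s)) (s * exp (- 2 * c * s))
       (s * exp (- 2 * c * s)) (exp (- 2 * c * s))) has_integral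
      mat2 (exp_int0 c t + exp_int2 c t) (exp_int1 c t) (exp_int1 c t) (exp_int0 c t)) {0..t}"
    by (intro has_integral_mat2 has_integral_add I)
  ultimately show ?thesis
    by (simp add: ou_Q_def integral_unique mat2_arith)
qed

text \<open>The Cholesky factor of the covariance matrix \<open>2 Q\<^sub>t\<close>.\<close>

definition chol_d :: "real \<Rightarrow> real \<Rightarrow> real \<Rightarrow> real" where
  "chol_d c \<sigma> t = sqrt (2 * \<sigma>\<^sup>2 * exp_int0 c t)"

definition chol_b :: "real \<Rightarrow> real \<Rightarrow> real \<Rightarrow> real" where
  "chol_b c \<sigma> t = 2 * \<sigma>\<^sup>2 * exp_int1 c t / chol_d c \<sigma> t"

definition chol_a :: "real \<Rightarrow> real \<Rightarrow> real \<Rightarrow> real" where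
  "chol_a c \<sigma> t = sqrt (2 * \<sigma>\<^sup>2 * (exp_int0 c t + exp_int2 c t) - (chol_b c \<sigma> t)\<^sup>2)"

text \<open>By the Cauchy-Schwarz bound, b^2 is at most 2 sigma^2 \<open>exp_int2\<close>, so the
  radicand in \<open>chol_a\<close> is at least 2 sigma^2 \<open>exp_int0\<close>, which is
  positive.\<close>

lemma chol:
  assumes "c > 0" "\<sigma> > 0" "t > 0"
  shows "chol_d c \<sigma> t > 0" "chol_a c \<sigma> t > 0"
    "(chol_d c \<sigma> t)\<^sup>2 = 2 * \<sigma>\<^sup>2 * exp_int0 c t"
    "chol_b c \<sigma> t * chol_d c \<sigma> t = 2 * \<sigma>\<^sup>2 * exp_int1 c t"
    "(chol_a c \<sigma> t)\<^sup>2 + (chol_b c \<sigma> t)\<^sup>2 = 2 * \<sigma>\<^sup>2 * (exp_int0 c t + exp_int2 c t)"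
proof -
  note p = exp_int0_pos[OF assms(1,3)]
  show d: "chol_d c \<sigma> t > 0" using p assms(2) by (simp add: chol_d_def)
  show d2: "(chol_d c \<sigma> t)\<^sup>2 = 2 * \<sigma>\<^sup>2 * exp_int0 c t"
    using p by (simp add: chol_d_def)
  show "chol_b c \<sigma> t * chol_d c \<sigma> t = 2 * \<sigma>\<^sup>2 * exp_int1 c t"
    using d by (simp add: chol_b_def)
  have "(chol_b c \<sigma> t)\<^sup>2 = 2 * \<sigma>\<^sup>2 * ((exp_int1 c t)\<^sup>2 / exp_int0 c t)"
    using assms(2) p unfolding chol_b_def power_divide d2 by (simp add: power2_eq_square)
  also have "\<dots> \<le> 2 * \<sigma>\<^sup>2 * exp_int2 c t"
    using exp_int1_sq_le[OF assms(1,3)] p assms(2) by (intro mult_left_mono) (simp_all add: field_simps)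
  also have "\<dots> < 2 * \<sigma>\<^sup>2 * (exp_int0 c t + exp_int2 c t)"
    using p assms(2) by simp
  finally have "(chol_b c \<sigma> t)\<^sup>2 < 2 * \<sigma>\<^sup>2 * (exp_int0 c t + exp_int2 c t)" .
  then show "chol_a c \<sigma> t > 0"
    "(chol_a c \<sigma> t)\<^sup>2 + (chol_b c \<sigma> t)\<^sup>2 = 2 * \<sigma>\<^sup>2 * (exp_int0 c t + exp_int2 c t)"
    by (simp_all add: chol_a_def)
qed

text \<open>The covariance, factor times transpose, is 2 Q; half the quadratic form of its inverse
  is <Q^(-1) y, y>/4, and 4 pi sqrt(det Q) = 2 pi |a d|. The signs are reversed because the
  semigroup subtracts the noise y; the covariance does not see them.\<close>

lemma gdens_eq:
  assumes "a \<noteq> 0" "d \<noteq> 0"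
  shows "gdens (- a) (- b) (- d) y = exp (- ((matrix_inv ((1 / 2) *\<^sub>R mat2 (a\<^sup>2 + b\<^sup>2) (b * d) (b * d) (d\<^sup>2)) *v y) \<bullet> y) / 4)
      / (4 * pi * sqrt (det ((1 / 2) *\<^sub>R mat2 (a\<^sup>2 + b\<^sup>2) (b * d) (b * d) (d\<^sup>2))))"
proof -
  have D: "(1 / 2 * (a\<^sup>2 + b\<^sup>2)) * (1 / 2 * d\<^sup>2) - (1 / 2 * (b * d)) * (1 / 2 * (b * d)) = (a * d / 2)\<^sup>2"
    by (simp add: power2_eq_square algebra_simps)
  have "det ((1 / 2) *\<^sub>R mat2 (a\<^sup>2 + b\<^sup>2) (b * d) (b * d) (d\<^sup>2)) = (a * d / 2)\<^sup>2"
    unfolding mat2_arith det_mat2 D ..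
  then have 1: "4 * pi * sqrt (det ((1 / 2) *\<^sub>R mat2 (a\<^sup>2 + b\<^sup>2) (b * d) (b * d) (d\<^sup>2))) = 2 * pi * \<bar>- a * - d\<bar>"
    by simp
  have nz: "(a * d / 2)\<^sup>2 \<noteq> 0" using assms by simp
  have "(matrix_inv ((1 / 2) *\<^sub>R mat2 (a\<^sup>2 + b\<^sup>2) (b * d) (b * d) (d\<^sup>2)) *v y) \<bullet> y =
     1 / (a * d / 2)\<^sup>2 * (1 / 2 * d\<^sup>2 * (y $ 1)\<^sup>2 - b * d * (y $ 1 * y $ 2) + 1 / 2 * (a\<^sup>2 + b\<^sup>2) * (y $ 2)\<^sup>2)"
    unfolding mat2_arith matrix_inv_mat2[of "1 / 2 * (a\<^sup>2 + b\<^sup>2)" "1 / 2 * d\<^sup>2" "1 / 2 * (b * d)" "1 / 2 * (b * d)",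
        unfolded D, OF nz]
    using assms by (simp add: inner_vec_def sum_2 mat2_arith divide_simps) (simp add: power2_eq_square algebra_simps)
  also have "\<dots> = 2 * (((y $ 1 - b * (y $ 2 / d)) / a)\<^sup>2 + (y $ 2 / d)\<^sup>2)"
    using assms by (simp add: power2_eq_square field_simps)
  finally have 2: "- ((matrix_inv ((1 / 2) *\<^sub>R mat2 (a\<^sup>2 + b\<^sup>2) (b * d) (b * d) (d\<^sup>2)) *v y) \<bullet> y) / 4 =
     - (((y $ 1 - b * (y $ 2 / d)) / a)\<^sup>2 + (y $ 2 / d)\<^sup>2) / 2"
    by simp
  have 3: "((y $ 1 - - b * (y $ 2 / - d)) / - a)\<^sup>2 + (y $ 2 / - d)\<^sup>2 =
      ((y $ 1 - b * (y $ 2 / d)) / a)\<^sup>2 + (y $ 2 / d)\<^sup>2"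
    by (simp add: power_divide)
  show ?thesis
    unfolding gdens_def 1 2 3 ..
qed

text \<open>The kernel is the Gaussian density of covariance 2 Q_t, so the convolution is
  Kolmogorov's formula in probabilistic form: flow plus noise. Inverse and determinant of Q_t
  disappear from here on.\<close>

lemma ou_semigroup_eq:
  fixes f :: "real^2 \<Rightarrow> real"
  assumes "c > 0" "\<sigma> > 0" "t > 0" and [measurable]: "f \<in> borel_measurable borel"
  shows "ou_semigroup c \<sigma> t f z =
    (\<integral>p. f (ou_flow c t z + tri (chol_a c \<sigma> t) (chol_b c \<sigma> t) (chol_d c \<sigma> t) p) \<partial>N2)"
proof -
  define a b d where "a = chol_a c \<sigma> t" and "b = chol_b c \<sigma> t" and "d = chol_d c \<sigma> t"
  note ch = chol[OF assms(1-3), folded a_def b_def d_def]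
  have nz: "a \<noteq> 0" "d \<noteq> 0" "- a \<noteq> 0" "- d \<noteq> 0" using ch by auto
  have Q: "ou_Q c \<sigma> t = (1 / 2) *\<^sub>R mat2 (a\<^sup>2 + b\<^sup>2) (b * d) (b * d) (d\<^sup>2)"
    unfolding ch ou_Q_eq[OF assms(1) less_imp_le[OF assms(3)]] by (simp add: mat2_arith)
  have "ou_semigroup c \<sigma> t f z = (LINT y|lborel. gdens (- a) (- b) (- d) y * f (ou_flow c t z - y))"
    using assms(3)
    by (simp add: ou_semigroup_def mat_exp_ou_B gdens_eq[OF nz(1,2)] Q)
  also have "\<dots> = (LINT y|density lborel (gdens (- a) (- b) (- d)). f (ou_flow c t z - y))"
    using gdens_pos[OF nz(3,4)] by (subst integral_density) (auto intro: less_imp_le)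
  also have "\<dots> = (\<integral>p. f (ou_flow c t z - tri (- a) (- b) (- d) p) \<partial>N2)"
    unfolding distr_N2_tri[OF nz(3,4), symmetric] by (subst integral_distr) auto
  also have "\<dots> = (\<integral>p. f (ou_flow c t z + tri a b d p) \<partial>N2)"
  proof -
    have "ou_flow c t z - tri (- a) (- b) (- d) p = ou_flow c t z + tri a b d p" for p
      by (simp add: tri_def vec_eq_iff forall_2 split_beta)
    then show ?thesis by (simp only:)
  qed
  finally show ?thesis unfolding a_def b_def d_def .
qed

section \<open>The invariant measure\<close>

text \<open>Closed sets form an intersection-stable generator of the Borel sets, and the indicator
  of a closed set C is the limit of the bounded continuous functions max(0, 1 - k dist(x,
  C)).\<close>

lemma measure_eqI_bounded_continuous:
  fixes M N :: "'a::metric_space measure"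
  assumes "finite_measure M" "finite_measure N" and sets: "sets M = sets borel" "sets N = sets borel"
    and eq: "\<And>f :: 'a \<Rightarrow> real. continuous_on UNIV f \<Longrightarrow> bounded (range f) \<Longrightarrow>
      integral\<^sup>L M f = integral\<^sup>L N f"
  shows "M = N"
proof (rule measure_eqI_generator_eq[where E = "Collect closed" and \<Omega> = UNIV and A = "\<lambda>_. UNIV"])
  interpret M: finite_measure M by fact
  interpret N: finite_measure N by fact
  have B: "sets borel = sigma_sets UNIV (Collect closed :: 'a set set)"
    unfolding borel_eq_closed by (rule sets_measure_of) simp
  show "sets M = sigma_sets UNIV (Collect closed)" "sets N = sigma_sets UNIV (Collect closed)"
    using sets B by simp_all
  show "emeasure M UNIV \<noteq> \<infinity>" by simp
  show "emeasure M C = emeasure N C" if "C \<in> Collect closed" for C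
  \<comment> \<open>The empty set is set apart because \<open>infdist\<close> to it is 0, which
    would make \<open>g k\<close> constantly 1.\<close>
  proof (cases "C = {}")
    case False
    have C: "closed C" using that by simp
    define g where "g k x = max 0 (1 - real k * infdist x C)" for k x
    have cont: "continuous_on UNIV (g k)" for k
      unfolding g_def by (intro continuous_intros)
    have bnd: "\<bar>g k x\<bar> \<le> 1" for k x
      by (simp add: g_def infdist_nonneg)
    have lim: "(\<lambda>k. g k x) \<longlonglongrightarrow> indicator C x" for x
    proof (cases "x \<in> C")
      case True
      then show ?thesis by (simp add: g_def)
    next
      case xC: False
      then have pos: "infdist x C > 0"
        using C False by (simp add: infdist_pos_not_in_closed)
      then have "\<forall>\<^sub>F k in sequentially. 1 \<le> real k * infdist x C"
        by real_asymp
      then have "\<forall>\<^sub>F k in sequentially. g k x = 0"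
        by eventually_elim (simp add: g_def)
      then show ?thesis
        using xC by (simp add: tendsto_eventually)
    qed
    have meas: "(\<lambda>k. integral\<^sup>L K (g k)) \<longlonglongrightarrow> measure K C" if K: "finite_measure K" "sets K = sets borel" for K
    proof -
      interpret K: finite_measure K by fact
      have [measurable_cong]: "sets K = sets borel" by fact
      have "(\<lambda>k. integral\<^sup>L K (g k)) \<longlonglongrightarrow> integral\<^sup>L K (indicator C)"
      proof (rule integral_dominated_convergence[where w = "\<lambda>_. 1"])
        show "g k \<in> borel_measurable K" for k
          using borel_measurable_continuous_onI[OF cont] by (simp add: K(2) cong: measurable_cong_sets)
        show "indicator C \<in> borel_measurable K"
          using C by (intro borel_measurable_indicator) (simp add: K(2))
      qed (use lim bnd in auto)
      then show ?thesis
        using K(2) sets_eq_imp_space_eq[OF K(2)] by simp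
    qed
    have "integral\<^sup>L M (g k) = integral\<^sup>L N (g k)" for k
      by (rule eq[OF cont]) (use bnd in \<open>auto simp: bounded_iff\<close>)
    then have "measure M C = measure N C"
      using meas[of M] meas[of N] sets assms(1,2) by (auto intro: LIMSEQ_unique)
    then show ?thesis
      by (simp add: M.emeasure_eq_measure N.emeasure_eq_measure)
  qed simp
qed (auto simp: Int_stable_def)

section \<open>Square integrable functions of a standard normal pair\<close>

definition sq_int :: "(real \<times> real \<Rightarrow> real) \<Rightarrow> bool" where
  "sq_int f \<longleftrightarrow> f \<in> borel_measurable borel \<and> integrable N2 (\<lambda>p. (f p)\<^sup>2)"

lemma sq_int_mult_integrable:
  assumes "sq_int f" "sq_int g"
  shows "integrable N2 (\<lambda>p. f p * g p)"
proof (rule Bochner_Integration.integrable_bound)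
  have [measurable]: "f \<in> borel_measurable borel" "g \<in> borel_measurable borel"
    using assms by (simp_all add: sq_int_def)
  show "integrable N2 (\<lambda>p. (f p)\<^sup>2 + (g p)\<^sup>2)"
    using assms by (simp add: sq_int_def)
  show "(\<lambda>p. f p * g p) \<in> borel_measurable N2"
    by measurable
  show "AE p in N2. norm (f p * g p) \<le> norm ((f p)\<^sup>2 + (g p)\<^sup>2)"
  proof (rule AE_I2)
    fix p
    have "2 * (\<bar>f p\<bar> * \<bar>g p\<bar>) \<le> (f p)\<^sup>2 + (g p)\<^sup>2"
      using sum_squares_bound[of "\<bar>f p\<bar>" "\<bar>g p\<bar>"] by (simp add: mult.assoc)
    moreover have "0 \<le> \<bar>f p\<bar> * \<bar>g p\<bar>" by simp
    ultimately show "norm (f p * g p) \<le> norm ((f p)\<^sup>2 + (g p)\<^sup>2)"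
      unfolding real_norm_def abs_mult using abs_ge_self[of "(f p)\<^sup>2 + (g p)\<^sup>2"] by linarith
  qed
qed

lemma exp_growth_sq_int: "exp_growth f \<Longrightarrow> sq_int f"
  by (simp add: sq_int_def exp_growth_measurable exp_growth_integrable exp_growth_power)

lemma sq_int_exp_growth_integrable:
  "sq_int f \<Longrightarrow> exp_growth g \<Longrightarrow> integrable N2 (\<lambda>p. f p * g p)"
  using sq_int_mult_integrable exp_growth_sq_int by blast

lemma sq_int_integrable: "sq_int f \<Longrightarrow> integrable N2 f"
  using sq_int_exp_growth_integrable[OF _ exp_growth_const[of 1], of f] by simp

lemma sq_int_measurable: "sq_int f \<Longrightarrow> f \<in> borel_measurable borel"
  by (simp add: sq_int_def)

lemma ou_flow_borel [measurable]: "ou_flow c t \<in> borel_measurable borel"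
  unfolding ou_flow_def by measurable

lemma ou_flow_add: "ou_flow c t (u + v) = ou_flow c t u + ou_flow c t v"
  by (simp add: ou_flow_def vec2_add algebra_simps)

lemma tri_add: "tri a b d (x + h, y + k) = tri a b d (x, y) + tri a b d (h, k)"
  by (simp add: tri_def vec2_add algebra_simps)

section \<open>The process and its Gaussian stationary law\<close>

locale ou_process =
  fixes c \<sigma> :: real and \<mu> :: "(real^2) measure"
  assumes c_pos: "c > 0" and sigma_pos: "\<sigma> > 0" and invariant: "ou_invariant c \<sigma> \<mu>"
begin

definition \<rho> :: real where "\<rho> = \<sigma>\<^sup>2 / c"
text \<open>The limit of the Cholesky factor as \<open>t\<close> tends to infinity.\<close>

definition La :: real where "La = sqrt (\<rho> * (1 + 1 / (4 * c\<^sup>2)))"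
definition Lb :: real where "Lb = sqrt \<rho> / (2 * c)"
definition Ld :: real where "Ld = sqrt \<rho>"

abbreviation L :: "real \<times> real \<Rightarrow> real^2" where "L \<equiv> tri La Lb Ld"
abbreviation Lt :: "real \<Rightarrow> real \<times> real \<Rightarrow> real^2" where
  "Lt t \<equiv> tri (chol_a c \<sigma> t) (chol_b c \<sigma> t) (chol_d c \<sigma> t)"

lemma rho_pos: "\<rho> > 0"
  using c_pos sigma_pos by (simp add: \<rho>_def)

lemma L_pos: "La > 0" "Ld > 0"
  using rho_pos by (simp_all add: La_def Ld_def add_pos_nonneg)

text \<open>The entries of 2 Q_infinity: the variance of y, the covariance, and the variance of x.
  They are the source of the constants in \<open>G_poly\<close> and in the formula of the
  theorem.\<close>

lemma L_sq:
  "Ld\<^sup>2 = \<rho>" "Lb * Ld = \<rho> / (2 * c)" "La\<^sup>2 + Lb\<^sup>2 = \<rho> + \<rho> / (2 * c\<^sup>2)"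
proof -
  show "Ld\<^sup>2 = \<rho>" "Lb * Ld = \<rho> / (2 * c)"
    using rho_pos by (simp_all add: Ld_def Lb_def)
  have "La\<^sup>2 = \<rho> * (1 + 1 / (4 * c\<^sup>2))"
    using rho_pos by (simp add: La_def)
  moreover have "Lb\<^sup>2 = \<rho> / (4 * c\<^sup>2)"
    using rho_pos by (simp add: Lb_def power_divide power_mult_distrib)
  ultimately show "La\<^sup>2 + Lb\<^sup>2 = \<rho> + \<rho> / (2 * c\<^sup>2)"
    using c_pos by (simp add: field_simps)
qed

lemma tendsto_exp_int:
  "(exp_int0 c \<longlongrightarrow> 1 / (2 * c)) at_top" "(exp_int1 c \<longlongrightarrow> 1 / (4 * c\<^sup>2)) at_top" "(exp_int2 c \<longlongrightarrow> 1 / (4 * c ^ 3)) at_top"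
proof -
  have "((\<lambda>t. exp (- 2 * c * t)) \<longlongrightarrow> 0) at_top"
    "((\<lambda>t. exp (- 2 * c * t) * (1 + 2 * c * t)) \<longlongrightarrow> 0) at_top"
    "((\<lambda>t. exp (- 2 * c * t) * (1 + 2 * c * t + 2 * c\<^sup>2 * t\<^sup>2)) \<longlongrightarrow> 0) at_top"
    using c_pos by real_asymp+
  note T = this[THEN tendsto_diff[OF tendsto_const[of 1]]]
  show "(exp_int0 c \<longlongrightarrow> 1 / (2 * c)) at_top"
    using T(1)[THEN tendsto_divide[OF _ tendsto_const[of "2 * c"]]] c_pos by (simp add: exp_int0_def [abs_def])
  show "(exp_int1 c \<longlongrightarrow> 1 / (4 * c\<^sup>2)) at_top"
    using T(2)[THEN tendsto_divide[OF _ tendsto_const[of "4 * c\<^sup>2"]]] c_pos by (simp add: exp_int1_def [abs_def])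
  show "(exp_int2 c \<longlongrightarrow> 1 / (4 * c ^ 3)) at_top"
    using T(3)[THEN tendsto_divide[OF _ tendsto_const[of "4 * c ^ 3"]]] c_pos by (simp add: exp_int2_def [abs_def])
qed

lemma tendsto_chol:
  "(chol_d c \<sigma> \<longlongrightarrow> Ld) at_top" "(chol_b c \<sigma> \<longlongrightarrow> Lb) at_top" "(chol_a c \<sigma> \<longlongrightarrow> La) at_top"
proof -
  have "(chol_d c \<sigma> \<longlongrightarrow> sqrt (2 * \<sigma>\<^sup>2 * (1 / (2 * c)))) at_top"
    unfolding chol_d_def by (intro tendsto_intros tendsto_exp_int)
  then show d: "(chol_d c \<sigma> \<longlongrightarrow> Ld) at_top"
    by (simp add: Ld_def \<rho>_def)
  have "(chol_b c \<sigma> \<longlongrightarrow> 2 * \<sigma>\<^sup>2 * (1 / (4 * c\<^sup>2)) / Ld) at_top"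
    unfolding chol_b_def using L_pos by (intro tendsto_intros tendsto_exp_int d) simp
  moreover have "2 * \<sigma>\<^sup>2 * (1 / (4 * c\<^sup>2)) / Ld = Lb"
  proof -
    have "2 * \<sigma>\<^sup>2 * (1 / (4 * c\<^sup>2)) = Lb * Ld"
      unfolding L_sq using c_pos by (simp add: \<rho>_def power2_eq_square)
    then show ?thesis using L_pos by simp
  qed
  ultimately show b: "(chol_b c \<sigma> \<longlongrightarrow> Lb) at_top" by simp
  have "(chol_a c \<sigma> \<longlongrightarrow> sqrt (2 * \<sigma>\<^sup>2 * (1 / (2 * c) + 1 / (4 * c ^ 3)) - Lb\<^sup>2)) at_top"
    unfolding chol_a_def by (intro tendsto_intros tendsto_exp_int b)
  moreover have "2 * \<sigma>\<^sup>2 * (1 / (2 * c) + 1 / (4 * c ^ 3)) = La\<^sup>2 + Lb\<^sup>2"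
    unfolding L_sq using c_pos by (simp add: \<rho>_def field_simps power2_eq_square power3_eq_cube)
  ultimately show "(chol_a c \<sigma> \<longlongrightarrow> La) at_top"
    using L_pos by simp
qed

sublocale \<mu>: prob_space \<mu>
  using invariant by (simp add: ou_invariant_def)

lemma sets_mu [measurable_cong]: "sets \<mu> = sets borel"
  using invariant by (simp add: ou_invariant_def)

lemma semigroup_eq:
  "t > 0 \<Longrightarrow> f \<in> borel_measurable borel \<Longrightarrow>
    ou_semigroup c \<sigma> t f z = (\<integral>p. f (ou_flow c t z + Lt t p) \<partial>N2)"
  using ou_semigroup_eq c_pos sigma_pos by blast

lemma semigroup_measurable:
  assumes "t > 0" and [measurable]: "f \<in> borel_measurable borel"
  shows "ou_semigroup c \<sigma> t f \<in> borel_measurable borel"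
proof -
  have "(\<lambda>z. \<integral>p. f (ou_flow c t z + Lt t p) \<partial>N2) \<in> borel_measurable borel"
    by (rule N2.borel_measurable_lebesgue_integral) (simp add: split_beta')
  then show ?thesis
    using semigroup_eq[OF assms(1,2)] by presburger
qed

text \<open>T(t)f tends pointwise to the constant E f(L p), since the flow tends to 0 and the
  Cholesky factors converge. Integrated against mu, the left side stays equal to the integral of f
  by invariance.\<close>

lemma mu_eq: "\<mu> = distr N2 borel L"
proof (rule measure_eqI_bounded_continuous)
  show "finite_measure \<mu>" by (rule \<mu>.finite_measure_axioms)
  show "finite_measure (distr N2 borel L)"
    by (intro N2.finite_measure_distr) simp
  show "sets \<mu> = sets borel" by (rule sets_mu)
  fix f :: "real^2 \<Rightarrow> real" assume f: "continuous_on UNIV f" "bounded (range f)"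
  then obtain K where K: "\<And>z. \<bar>f z\<bar> \<le> K"
    by (auto simp: bounded_iff)
  have [measurable]: "f \<in> borel_measurable borel"
    using f(1) by (rule borel_measurable_continuous_onI)
  have lim: "((\<lambda>t. ou_semigroup c \<sigma> t f z) \<longlongrightarrow> (\<integral>p. f (L p) \<partial>N2)) at_top" for z
  proof -
    have "((\<lambda>t. \<integral>p. f (ou_flow c t z + Lt t p) \<partial>N2) \<longlongrightarrow> (\<integral>p. f (L p) \<partial>N2)) at_top"
    proof (rule integral_dominated_convergence_at_top[where w = "\<lambda>_. K"])
      show "AE p in N2. ((\<lambda>t. f (ou_flow c t z + Lt t p)) \<longlongrightarrow> f (L p)) at_top"
      proof (rule AE_I2)
        fix p :: "real \<times> real"
        have "((\<lambda>t. exp (- c * t) * (z $ 1 + t * z $ 2)) \<longlongrightarrow> 0) at_top"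
          "((\<lambda>t. exp (- c * t) * z $ 2) \<longlongrightarrow> 0) at_top"
          using c_pos by real_asymp+
        then have "((\<lambda>t. ou_flow c t z + Lt t p) \<longlongrightarrow> vec2 0 0 + L p) at_top"
          unfolding ou_flow_def tri_def split_beta
          by (intro tendsto_intros tendsto_chol)
        moreover have "vec2 0 0 + L p = L p"
          by (simp add: vec_eq_iff forall_2)
        ultimately have "((\<lambda>t. ou_flow c t z + Lt t p) \<longlongrightarrow> L p) at_top" by simp
        then show "((\<lambda>t. f (ou_flow c t z + Lt t p)) \<longlongrightarrow> f (L p)) at_top"
          using f(1) by (intro isCont_tendsto_compose[of _ f]) (simp_all add: continuous_on_eq_continuous_at)
      qed
    qed (use K in auto)
    moreover have "\<forall>\<^sub>F t in at_top. (\<integral>p. f (ou_flow c t z + Lt t p) \<partial>N2) = ou_semigroup c \<sigma> t f z"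
      using eventually_gt_at_top[of 0] by eventually_elim (simp add: semigroup_eq)
    ultimately show ?thesis
      by (rule Lim_transform_eventually)
  qed
  have bnd: "\<bar>ou_semigroup c \<sigma> t f z\<bar> \<le> K" if "t > 0" for t z
  proof -
    have "\<bar>\<integral>p. f (ou_flow c t z + Lt t p) \<partial>N2\<bar> \<le> (\<integral>p. \<bar>f (ou_flow c t z + Lt t p)\<bar> \<partial>N2)"
      by (rule integral_abs_bound)
    also have "\<dots> \<le> (\<integral>p. K \<partial>N2)"
      by (intro integral_mono' N2.integrable_const K) (use K abs_ge_zero order_trans in blast)
    finally show ?thesis
      using that by (simp add: semigroup_eq N2.prob_space[simplified])
  qed
  \<comment> \<open>The times are n + 1, so that \<open>semigroup_eq\<close>, which requires t > 0,
    applies throughout.\<close>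
  have "(\<lambda>n. \<integral>z. ou_semigroup c \<sigma> (real (Suc n)) f z \<partial>\<mu>) \<longlonglongrightarrow> (\<integral>z. (\<integral>p. f (L p) \<partial>N2) \<partial>\<mu>)"
  proof (rule integral_dominated_convergence[where w = "\<lambda>_. K"])
    show "ou_semigroup c \<sigma> (real (Suc n)) f \<in> borel_measurable \<mu>" for n
      using semigroup_measurable[of "real (Suc n)" f] by (simp add: sets_mu cong: measurable_cong_sets)
    show "AE z in \<mu>. (\<lambda>n. ou_semigroup c \<sigma> (real (Suc n)) f z) \<longlonglongrightarrow> (\<integral>p. f (L p) \<partial>N2)"
      by (intro AE_I2 filterlim_compose[OF lim]
        filterlim_compose[OF filterlim_real_sequentially filterlim_Suc])
    show "AE z in \<mu>. norm (ou_semigroup c \<sigma> (real (Suc n)) f z) \<le> K" for n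
      using bnd[of "real (Suc n)"] by simp
  qed auto
  moreover have "(\<integral>z. ou_semigroup c \<sigma> (real (Suc n)) f z \<partial>\<mu>) = integral\<^sup>L \<mu> f" for n
    using invariant f by (simp add: ou_invariant_def)
  ultimately have "integral\<^sup>L \<mu> f = (\<integral>z. (\<integral>p. f (L p) \<partial>N2) \<partial>\<mu>)"
    by (simp add: LIMSEQ_const_iff)
  also have "\<dots> = integral\<^sup>L (distr N2 borel L) f"
    using \<mu>.prob_space by (simp add: integral_distr)
  finally show "integral\<^sup>L \<mu> f = integral\<^sup>L (distr N2 borel L) f" .
qed simp

lemma mu_density: "\<mu> = density lborel (gdens La Lb Ld)"
  unfolding mu_eq using L_pos by (intro distr_N2_tri) auto

text \<open>The Gaussian density is positive, so Lebesgue null sets, null sets of mu and null sets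
  pulled back along \<open>L\<close> correspond. This is the passage between classes of functions
  and integrals over \<open>N2\<close>.\<close>

lemma AE_mu_iff:
  assumes [measurable]: "Measurable.pred borel P"
  shows "(AE z in \<mu>. P z) \<longleftrightarrow> (AE z in lborel. P z)"
    and "(AE p in N2. P (L p)) \<longleftrightarrow> (AE z in lborel. P z)"
proof -
  have "gdens La Lb Ld z > 0" for z
    using L_pos by (intro gdens_pos) auto
  then show 1: "(AE z in \<mu>. P z) \<longleftrightarrow> (AE z in lborel. P z)"
    unfolding mu_density by (subst AE_density) auto
  then show "(AE p in N2. P (L p)) \<longleftrightarrow> (AE z in lborel. P z)"
    unfolding mu_eq by (subst (asm) AE_distr_iff) auto
qed

lemma stationary_measurable:
  "(\<lambda>(p, q). ou_flow c t (L p) + Lt t q) \<in> N2 \<Otimes>\<^sub>M N2 \<rightarrow>\<^sub>M borel"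
  by measurable

text \<open>
  The joint law of two Gaussian vectors need not be computed: the two sides agree on bounded
  continuous functions by the assumed invariance of \<open>\<mu>\<close>.
\<close>

lemma distr_stationary:
  assumes "t > 0"
  shows "distr (N2 \<Otimes>\<^sub>M N2) borel (\<lambda>(p, q). ou_flow c t (L p) + Lt t q) = \<mu>"
proof (rule measure_eqI_bounded_continuous)
  interpret P: pair_prob_space N2 N2 ..
  note m [measurable] = stationary_measurable[of t]
  show "finite_measure \<mu>" by (rule \<mu>.finite_measure_axioms)
  show "finite_measure (distr (N2 \<Otimes>\<^sub>M N2) borel (\<lambda>(p, q). ou_flow c t (L p) + Lt t q))"
    by (rule P.P.finite_measure_distr) (rule m)
  show "sets \<mu> = sets borel" by (rule sets_mu)
  fix f :: "real^2 \<Rightarrow> real" assume f: "continuous_on UNIV f" "bounded (range f)"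
  then obtain K where K: "\<And>z. \<bar>f z\<bar> \<le> K"
    by (auto simp: bounded_iff)
  have [measurable]: "f \<in> borel_measurable borel"
    using f(1) by (rule borel_measurable_continuous_onI)
  have [measurable]: "ou_semigroup c \<sigma> t f \<in> borel_measurable borel"
    using assms by (intro semigroup_measurable) simp_all
  have "integral\<^sup>L (distr (N2 \<Otimes>\<^sub>M N2) borel (\<lambda>(p, q). ou_flow c t (L p) + Lt t q)) f =
      (\<integral>(p, q). f (ou_flow c t (L p) + Lt t q) \<partial>(N2 \<Otimes>\<^sub>M N2))"
    by (subst integral_distr[OF m]) (simp_all add: split_beta')
  also have "\<dots> = (\<integral>p. \<integral>q. f (ou_flow c t (L p) + Lt t q) \<partial>N2 \<partial>N2)"
    by (rule P.integral_fst [symmetric], rule P.P.integrable_const_bound[where B = K])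
      (use K in \<open>auto simp: split_beta'\<close>)
  also have "\<dots> = (\<integral>p. ou_semigroup c \<sigma> t f (L p) \<partial>N2)"
    using assms by (simp add: semigroup_eq)
  also have "\<dots> = (\<integral>z. ou_semigroup c \<sigma> t f z \<partial>\<mu>)"
    unfolding mu_eq by (subst integral_distr) simp_all
  also have "\<dots> = integral\<^sup>L \<mu> f"
    using invariant f assms by (simp add: ou_invariant_def)
  finally show "integral\<^sup>L (distr (N2 \<Otimes>\<^sub>M N2) borel (\<lambda>(p, q). ou_flow c t (L p) + Lt t q)) f
    = integral\<^sup>L \<mu> f" .
qed simp

lemma integrable_stationary:
  fixes g :: "real^2 \<Rightarrow> real"
  assumes t: "t > 0" and [measurable]: "g \<in> borel_measurable borel"
    and int: "integrable N2 (\<lambda>p. g (L p))"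
  shows "integrable (N2 \<Otimes>\<^sub>M N2) (\<lambda>(p, q). g (ou_flow c t (L p) + Lt t q))"
proof -
  note m [measurable] = stationary_measurable[of t]
  have "integrable \<mu> g"
    unfolding mu_eq using int by (subst integrable_distr_eq) simp_all
  then have "integrable (distr (N2 \<Otimes>\<^sub>M N2) borel (\<lambda>(p, q). ou_flow c t (L p) + Lt t q)) g"
    by (simp add: distr_stationary[OF t])
  then show ?thesis
    by (subst (asm) integrable_distr_eq[OF m]) (simp_all add: split_beta')
qed

text \<open>Once flow plus noise is known to have law mu, Fubini extends the invariance from bounded
  continuous functions to all mu-integrable ones.\<close>

lemma integral_stationary:
  fixes g :: "real^2 \<Rightarrow> real"
  assumes t: "t > 0" and [measurable]: "g \<in> borel_measurable borel"
    and int: "integrable N2 (\<lambda>p. g (L p))"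
  shows "integrable N2 (\<lambda>p. \<integral>q. g (ou_flow c t (L p) + Lt t q) \<partial>N2)"
    and "(\<integral>p. \<integral>q. g (ou_flow c t (L p) + Lt t q) \<partial>N2 \<partial>N2) = (\<integral>p. g (L p) \<partial>N2)"
proof -
  interpret P: pair_prob_space N2 N2 ..
  note m [measurable] = stationary_measurable[of t]
  note i = integrable_stationary[OF assms]
  then show "integrable N2 (\<lambda>p. \<integral>q. g (ou_flow c t (L p) + Lt t q) \<partial>N2)"
    by (rule P.integrable_fst)
  have "(\<integral>p. \<integral>q. g (ou_flow c t (L p) + Lt t q) \<partial>N2 \<partial>N2) =
      (\<integral>(p, q). g (ou_flow c t (L p) + Lt t q) \<partial>(N2 \<Otimes>\<^sub>M N2))"
    by (rule P.integral_fst[OF i])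
  also have "\<dots> = integral\<^sup>L (distr (N2 \<Otimes>\<^sub>M N2) borel (\<lambda>(p, q). ou_flow c t (L p) + Lt t q)) g"
    by (subst integral_distr[OF m]) (simp_all add: split_beta')
  also have "\<dots> = (\<integral>p. g (L p) \<partial>N2)"
    unfolding distr_stationary[OF t] mu_eq by (subst integral_distr) simp_all
  finally show "(\<integral>p. \<integral>q. g (ou_flow c t (L p) + Lt t q) \<partial>N2 \<partial>N2) = (\<integral>p. g (L p) \<partial>N2)" .
qed

text \<open>By the Cameron-Martin formula, the mean of \<open>f\<close> under the translate of \<open>\<mu>\<close> by \<open>L (h, k)\<close>.\<close>

definition Phi :: "(real^2 \<Rightarrow> real) \<Rightarrow> real \<Rightarrow> real \<Rightarrow> real" where
  "Phi f h k = (\<integral>(x, y). exp (h * x + k * y - (h\<^sup>2 + k\<^sup>2) / 2) * f (L (x, y)) \<partial>N2)"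

lemma exp_growth_shift_density: "exp_growth (\<lambda>(x, y). exp (h * x + k * y - (h\<^sup>2 + k\<^sup>2) / 2))"
proof -
  have "(\<lambda>(x, y). exp (h * x + k * y - (h\<^sup>2 + k\<^sup>2) / 2)) =
      (\<lambda>p. exp (- ((h\<^sup>2 + k\<^sup>2) / 2)) * exp (h * fst p + k * snd p))"
    by (intro ext) (simp add: split_beta' flip: exp_add)
  then show ?thesis
    by (simp only: exp_growth_cmult exp_growth_exp)
qed

lemma Phi_integrable:
  assumes "sq_int (\<lambda>p. f (L p))"
  shows "integrable N2 (\<lambda>(x, y). exp (h * x + k * y - (h\<^sup>2 + k\<^sup>2) / 2) * f (L (x, y)))"
  using sq_int_mult_integrable[OF exp_growth_sq_int[OF exp_growth_shift_density] assms, of h k]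
  by (simp add: split_beta')

text \<open>The weighted form of \<open>Phi\<close> is continuous in f on L^2, the translated form
  fits the semigroup. Integrability is carried along because it has to be established for the weight
  times T(t)f.\<close>

lemma Phi_shift:
  assumes [measurable]: "f \<in> borel_measurable borel"
  shows "Phi f h k = (\<integral>p. f (L p + L (h, k)) \<partial>N2)"
    and "integrable N2 (\<lambda>(x, y). exp (h * x + k * y - (h\<^sup>2 + k\<^sup>2) / 2) * f (L (x, y))) \<longleftrightarrow>
      integrable N2 (\<lambda>p. f (L p + L (h, k)))"
  unfolding Phi_def
  using integral_N2_shift[of "\<lambda>p. f (L p)" h k] by (simp_all add: split_beta' tri_add)

text \<open>In the coordinates given by \<open>L\<close> the flow stays triangular; the change of
  coordinates only rescales the shear, by Ld/La.\<close>

lemma flow_L: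
  "ou_flow c t (L (h, k)) = L (exp (- c * t) * (h + Ld / La * t * k), exp (- c * t) * k)"
  using L_pos by (simp add: ou_flow_def tri_def algebra_simps)

text \<open>The flow is linear, so translating the start by u translates the end by exp(tB)u.
  Averaging over start and noise is then a stationary average of the translated function
  \<open>g\<close>.\<close>

lemma Phi_semigroup:
  assumes t: "t > 0" and [measurable]: "f \<in> borel_measurable borel" and sq: "sq_int (\<lambda>p. f (L p))"
  shows "integrable N2 (\<lambda>(x, y). exp (h * x + k * y - (h\<^sup>2 + k\<^sup>2) / 2) * ou_semigroup c \<sigma> t f (L (x, y)))"
    and "Phi (ou_semigroup c \<sigma> t f) h k = Phi f (exp (- c * t) * (h + Ld / La * t * k)) (exp (- c * t) * k)"
proof -
  define h' k' where "h' = exp (- c * t) * (h + Ld / La * t * k)" and "k' = exp (- c * t) * k"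
  have fl: "ou_flow c t (L (h, k)) = L (h', k')"
    by (simp only: flow_L h'_def k'_def)
  define g where "g z = f (z + L (h', k'))" for z
  have g [measurable]: "g \<in> borel_measurable borel"
    unfolding g_def by measurable
  have T [measurable]: "ou_semigroup c \<sigma> t f \<in> borel_measurable borel"
    using t by (intro semigroup_measurable) simp_all
  have "integrable N2 (\<lambda>p. g (L p))"
    using Phi_integrable[OF sq, of h' k'] by (simp add: Phi_shift(2) g_def)
  note S = integral_stationary[OF t g this]
  have eq: "ou_semigroup c \<sigma> t f (L p + L (h, k)) = (\<integral>q. g (ou_flow c t (L p) + Lt t q) \<partial>N2)" for p
    using t by (simp add: semigroup_eq ou_flow_add fl g_def add_ac)
  show "integrable N2 (\<lambda>(x, y). exp (h * x + k * y - (h\<^sup>2 + k\<^sup>2) / 2) * ou_semigroup c \<sigma> t f (L (x, y)))"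
    unfolding Phi_shift(2)[OF T] eq by (rule S(1))
  have "Phi (ou_semigroup c \<sigma> t f) h k = Phi f h' k'"
    unfolding Phi_shift(1)[OF T] eq S(2) by (simp add: Phi_shift(1) g_def)
  then show "Phi (ou_semigroup c \<sigma> t f) h k = Phi f (exp (- c * t) * (h + Ld / La * t * k)) (exp (- c * t) * k)"
    by (simp only: h'_def k'_def)
qed

end

section \<open>The generator\<close>

lemma rep_aefun_measurable [measurable]: "rep_aefun F \<in> borel_measurable borel"
  using Quotient_rep_reflp[OF Quotient_aefun] by blast

lemma ae_class_rep: "ae_class (rep_aefun F) = F"
  by (rule Quotient_abs_rep[OF Quotient_aefun])

lemma rep_ae_class:
  "f \<in> borel_measurable borel \<Longrightarrow> AE x in lborel. rep_aefun (ae_class f) x = f x"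
  using Quotient_rep_abs[OF Quotient_aefun, of f] by simp

lemma ae_class_eqI:
  "f \<in> borel_measurable borel \<Longrightarrow> g \<in> borel_measurable borel \<Longrightarrow> AE x in lborel. f x = g x \<Longrightarrow>
    ae_class f = ae_class g"
  using Quotient_rel_abs[OF Quotient_aefun, of f g] by simp

lemma ae_class_eqD:
  assumes "ae_class f = ae_class g" "f \<in> borel_measurable borel" "g \<in> borel_measurable borel"
  shows "AE x in lborel. f x = g x"
  using rep_ae_class[OF assms(2)] rep_ae_class[OF assms(3)] unfolding assms(1)
  by eventually_elim simp

lemma ae_class_plus:
  "f \<in> borel_measurable borel \<Longrightarrow> g \<in> borel_measurable borel \<Longrightarrow>
    ae_class f + ae_class g = ae_class (\<lambda>x. f x + g x)"
  by (simp add: plus_aefun.abs_eq)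

lemma ae_class_minus:
  "f \<in> borel_measurable borel \<Longrightarrow> g \<in> borel_measurable borel \<Longrightarrow>
    ae_class f - ae_class g = ae_class (\<lambda>x. f x - g x)"
  by (simp add: minus_aefun.abs_eq)

lemma ae_class_scaleR:
  "f \<in> borel_measurable borel \<Longrightarrow> a *\<^sub>R ae_class f = ae_class (\<lambda>x. a * f x)"
  by (simp add: scaleR_aefun.abs_eq)

lemma ae_class_0: "ae_class (\<lambda>_. 0) = 0"
  by (simp add: zero_aefun_def)

lemma add_scaleR_eq_ae_class:
  "F + a *\<^sub>R G = ae_class (\<lambda>x. rep_aefun F x + a * rep_aefun G x)"
  using ae_class_plus[of "rep_aefun F" "\<lambda>x. a * rep_aefun G x"] ae_class_scaleR[of "rep_aefun G" a]
  by (simp add: ae_class_rep)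

section \<open>The L^2 norm and the graph of the generator\<close>

context ou_process
begin

lemma nn_integral_mu:
  assumes [measurable]: "g \<in> borel_measurable borel"
  shows "(\<integral>\<^sup>+z. g z \<partial>\<mu>) = (\<integral>\<^sup>+p. g (L p) \<partial>N2)"
  unfolding mu_eq by (subst nn_integral_distr) auto

lemma AE_N2_L:
  assumes "AE z in lborel. P z" "Measurable.pred borel P"
  shows "AE p in N2. P (L p)"
  using assms AE_mu_iff by blast

lemma L2_normsq_ae_class:
  assumes [measurable]: "f \<in> borel_measurable borel"
  shows "L2_normsq \<mu> (ae_class f) = (\<integral>\<^sup>+p. ennreal ((f (L p))\<^sup>2) \<partial>N2)"
proof -
  have "L2_normsq \<mu> (ae_class f) = (\<integral>\<^sup>+p. ennreal ((rep_aefun (ae_class f) (L p))\<^sup>2) \<partial>N2)"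
    unfolding L2_normsq_def by (rule nn_integral_mu) simp
  also have "AE p in N2. rep_aefun (ae_class f) (L p) = f (L p)"
    by (rule AE_N2_L[OF rep_ae_class[OF assms]]) simp
  then have "(\<integral>\<^sup>+p. ennreal ((rep_aefun (ae_class f) (L p))\<^sup>2) \<partial>N2) = (\<integral>\<^sup>+p. ennreal ((f (L p))\<^sup>2) \<partial>N2)"
    by (intro nn_integral_cong_AE) auto
  finally show ?thesis .
qed

lemma L2_normsq_eq: "L2_normsq \<mu> F = (\<integral>\<^sup>+p. ennreal ((rep_aefun F (L p))\<^sup>2) \<partial>N2)"
  using L2_normsq_ae_class[of "rep_aefun F"] by (simp add: ae_class_rep)

lemma L2_iff: "F \<in> L2 \<mu> \<longleftrightarrow> sq_int (\<lambda>p. rep_aefun F (L p))"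
  unfolding L2_def L2_normsq_eq sq_int_def by (simp add: integrable_iff_bounded)

lemma L2_ae_class_iff:
  assumes [measurable]: "f \<in> borel_measurable borel"
  shows "ae_class f \<in> L2 \<mu> \<longleftrightarrow> sq_int (\<lambda>p. f (L p))"
  unfolding L2_def sq_int_def by (simp add: L2_normsq_ae_class integrable_iff_bounded)

text \<open>The pointwise bound (u + a v)^2 \<le> 2 u^2 + 2 a^2 v^2 stands in for the triangle
  inequality: \<open>L2_normsq\<close> is a squared norm in \<open>ennreal\<close>, and the factor 2
  is harmless in limits to 0.\<close>

lemma L2_normsq_add_scaleR:
  "L2_normsq \<mu> (F + a *\<^sub>R G) \<le> 2 * L2_normsq \<mu> F + ennreal (2 * a\<^sup>2) * L2_normsq \<mu> G"
proof -
  let ?f = "\<lambda>p. rep_aefun F (L p)" and ?g = "\<lambda>p. rep_aefun G (L p)"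
  have "L2_normsq \<mu> (F + a *\<^sub>R G) = (\<integral>\<^sup>+p. ennreal ((?f p + a * ?g p)\<^sup>2) \<partial>N2)"
    unfolding add_scaleR_eq_ae_class by (simp add: L2_normsq_ae_class)
  also have "\<dots> \<le> (\<integral>\<^sup>+p. 2 * ennreal ((?f p)\<^sup>2) + ennreal (2 * a\<^sup>2) * ennreal ((?g p)\<^sup>2) \<partial>N2)"
  proof (rule nn_integral_mono)
    fix p
    have "(u + a * v)\<^sup>2 \<le> 2 * u\<^sup>2 + (2 * a\<^sup>2) * v\<^sup>2" for u v :: real
      using sum_squares_bound[of u "a * v"] by (simp add: power2_sum power_mult_distrib)
    then have "ennreal ((?f p + a * ?g p)\<^sup>2) \<le> ennreal (2 * (?f p)\<^sup>2 + (2 * a\<^sup>2) * (?g p)\<^sup>2)"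
      by (rule ennreal_leI)
    then show "ennreal ((?f p + a * ?g p)\<^sup>2) \<le> 2 * ennreal ((?f p)\<^sup>2) + ennreal (2 * a\<^sup>2) * ennreal ((?g p)\<^sup>2)"
      by (simp add: ennreal_mult)
  qed
  also have "\<dots> = 2 * L2_normsq \<mu> F + ennreal (2 * a\<^sup>2) * L2_normsq \<mu> G"
    unfolding L2_normsq_eq by (simp add: nn_integral_add nn_integral_cmult)
  finally show ?thesis .
qed

lemma L2_add_scaleR: "F \<in> L2 \<mu> \<Longrightarrow> G \<in> L2 \<mu> \<Longrightarrow> F + a *\<^sub>R G \<in> L2 \<mu>"
proof -
  assume "F \<in> L2 \<mu>" "G \<in> L2 \<mu>"
  then have "2 * L2_normsq \<mu> F + ennreal (2 * a\<^sup>2) * L2_normsq \<mu> G < \<infinity>"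
    by (simp add: L2_def ennreal_mult_less_top)
  with L2_normsq_add_scaleR[of F a G] show ?thesis
    unfolding L2_def mem_Collect_eq by (rule order_le_less_trans)
qed

lemma L2_0: "0 \<in> L2 \<mu>"
  by (simp add: ae_class_0 [symmetric] L2_def L2_normsq_ae_class)

lemma L2_normsq_eq_0:
  assumes "L2_normsq \<mu> F = 0"
  shows "F = 0"
proof -
  have "AE p in N2. rep_aefun F (L p) = 0"
    using assms unfolding L2_normsq_eq by (subst (asm) nn_integral_0_iff_AE) auto
  then have "AE z in lborel. rep_aefun F z = 0"
    by (subst (asm) AE_mu_iff(2)) auto
  then have "ae_class (rep_aefun F) = ae_class (\<lambda>_. 0)"
    by (intro ae_class_eqI) auto
  then show ?thesis
    by (simp add: ae_class_rep ae_class_0)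
qed

text \<open>G - G' is the difference of the two errors at time t, and both tend to 0. Hence the
  description by \<open>THE\<close> in \<open>ou_A2\<close> does yield the generator.\<close>

lemma gen_graph_unique:
  assumes "ou_gen_graph c \<sigma> \<mu> F G" "ou_gen_graph c \<sigma> \<mu> F G'"
  shows "G = G'"
proof -
  define D where "D t = (1 / t) *\<^sub>R (ou_T2 c \<sigma> t F - F)" for t
  have l: "((\<lambda>t. L2_normsq \<mu> (D t - G)) \<longlongrightarrow> 0) (at_right 0)" "((\<lambda>t. L2_normsq \<mu> (D t - G')) \<longlongrightarrow> 0) (at_right 0)"
    using assms by (simp_all add: ou_gen_graph_def D_def)
  have "((\<lambda>t. 2 * L2_normsq \<mu> (D t - G') + ennreal (2 * (- 1)\<^sup>2) * L2_normsq \<mu> (D t - G)) \<longlongrightarrow> 2 * 0 + ennreal (2 * (- 1)\<^sup>2) * 0) (at_right 0)"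
    by (intro tendsto_add ennreal_tendsto_cmult l) auto
  moreover have "L2_normsq \<mu> (G - G') \<le> 2 * L2_normsq \<mu> (D t - G') + ennreal (2 * (- 1)\<^sup>2) * L2_normsq \<mu> (D t - G)" for t
    using L2_normsq_add_scaleR[of "D t - G'" "- 1" "D t - G"] by simp
  ultimately have "L2_normsq \<mu> (G - G') \<le> 2 * 0 + ennreal (2 * (- 1)\<^sup>2) * 0"
    by (intro tendsto_lowerbound[where F = "at_right (0::real)"]) auto
  then have "G - G' = 0"
    by (intro L2_normsq_eq_0) simp
  then show ?thesis by simp
qed

lemma A2_eq: "ou_gen_graph c \<sigma> \<mu> F G \<Longrightarrow> ou_A2 c \<sigma> \<mu> F = G"
  unfolding ou_A2_def using gen_graph_unique by blast

text \<open>Flow plus noise has law mu, so a Lebesgue null set is avoided for almost every start and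
  noise. This is why the integral formula does not depend on representatives.\<close>

lemma AE_stationary:
  assumes t: "t > 0" and P: "AE z in lborel. P z" and [measurable]: "Measurable.pred borel P"
  shows "AE p in N2. AE q in N2. P (ou_flow c t (L p) + Lt t q)"
proof -
  interpret Q: pair_prob_space N2 N2 ..
  note m [measurable] = stationary_measurable[of t]
  have "AE z in \<mu>. P z"
    using P by (subst AE_mu_iff) simp_all
  then have "AE x in N2 \<Otimes>\<^sub>M N2. P (case x of (p, q) \<Rightarrow> ou_flow c t (L p) + Lt t q)"
    unfolding distr_stationary[OF t, symmetric] by (subst (asm) AE_distr_iff[OF m]) auto
  then show ?thesis
    using Q.AE_pair by fastforce
qed

lemma AE_stationary_integrable:
  fixes g :: "real^2 \<Rightarrow> real"
  assumes t: "t > 0" and [measurable]: "g \<in> borel_measurable borel"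
    and int: "integrable N2 (\<lambda>p. g (L p))"
  shows "AE p in N2. integrable N2 (\<lambda>q. g (ou_flow c t (L p) + Lt t q))"
proof -
  interpret Q: pair_prob_space N2 N2 ..
  note i = integrable_stationary[OF assms]
  then show ?thesis
    by (rule Q.AE_integrable_fst)
qed

lemma T2_ae_class:
  assumes t: "t > 0" and f [measurable]: "f \<in> borel_measurable borel"
  shows "ou_T2 c \<sigma> t (ae_class f) = ae_class (ou_semigroup c \<sigma> t f)"
proof -
  have "AE p in N2. AE q in N2. rep_aefun (ae_class f) (ou_flow c t (L p) + Lt t q) = f (ou_flow c t (L p) + Lt t q)"
    by (rule AE_stationary[OF t rep_ae_class[OF f]]) simp
  then have "AE p in N2. ou_semigroup c \<sigma> t (rep_aefun (ae_class f)) (L p) = ou_semigroup c \<sigma> t f (L p)"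
    by eventually_elim (auto simp: semigroup_eq t intro!: integral_cong_AE)
  then have "AE z in lborel. ou_semigroup c \<sigma> t (rep_aefun (ae_class f)) z = ou_semigroup c \<sigma> t f z"
    using semigroup_measurable[OF t] by (subst (asm) AE_mu_iff(2)) auto
  then show ?thesis
    unfolding ou_T2_def using semigroup_measurable[OF t] by (intro ae_class_eqI) auto
qed

text \<open>For functions in L^2 Fubini makes the noise integrand integrable for almost every start,
  so the integrals add almost everywhere, and that is equality of classes.\<close>

lemma T2_add_scaleR:
  assumes t: "t > 0" and F: "F \<in> L2 \<mu>" and G: "G \<in> L2 \<mu>"
  shows "ou_T2 c \<sigma> t (F + a *\<^sub>R G) = ou_T2 c \<sigma> t F + a *\<^sub>R ou_T2 c \<sigma> t G"
proof -
  let ?f = "rep_aefun F" and ?g = "rep_aefun G"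
  note S [measurable] = semigroup_measurable[OF t rep_aefun_measurable]
  have [measurable]: "ou_semigroup c \<sigma> t (\<lambda>x. ?f x + a * ?g x) \<in> borel_measurable borel"
    by (rule semigroup_measurable[OF t]) simp
  have "AE p in N2. integrable N2 (\<lambda>q. ?f (ou_flow c t (L p) + Lt t q))"
    "AE p in N2. integrable N2 (\<lambda>q. ?g (ou_flow c t (L p) + Lt t q))"
    using F G by (auto intro!: AE_stationary_integrable[OF t] sq_int_integrable simp: L2_iff)
  then have "AE p in N2. ou_semigroup c \<sigma> t (\<lambda>x. ?f x + a * ?g x) (L p) =
      ou_semigroup c \<sigma> t ?f (L p) + a * ou_semigroup c \<sigma> t ?g (L p)"
    by eventually_elim (simp add: semigroup_eq t)
  then have "AE z in lborel. ou_semigroup c \<sigma> t (\<lambda>x. ?f x + a * ?g x) z =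
      ou_semigroup c \<sigma> t ?f z + a * ou_semigroup c \<sigma> t ?g z"
    by (subst (asm) AE_mu_iff(2)) auto
  then have "ou_T2 c \<sigma> t (F + a *\<^sub>R G) = ae_class (\<lambda>z. ou_semigroup c \<sigma> t ?f z + a * ou_semigroup c \<sigma> t ?g z)"
    unfolding add_scaleR_eq_ae_class by (subst T2_ae_class[OF t]) (auto intro!: ae_class_eqI)
  then show ?thesis
    by (simp add: ou_T2_def ae_class_scaleR ae_class_plus)
qed

lemma gen_graph_add_scaleR:
  assumes "ou_gen_graph c \<sigma> \<mu> F G" "ou_gen_graph c \<sigma> \<mu> F' G'"
  shows "ou_gen_graph c \<sigma> \<mu> (F + a *\<^sub>R F') (G + a *\<^sub>R G')"
proof -
  define D where "D F G t = (1 / t) *\<^sub>R (ou_T2 c \<sigma> t F - F) - G" for F G t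
  have L2: "F \<in> L2 \<mu>" "F' \<in> L2 \<mu>" "G \<in> L2 \<mu>" "G' \<in> L2 \<mu>"
    and l: "((\<lambda>t. L2_normsq \<mu> (D F G t)) \<longlongrightarrow> 0) (at_right 0)" "((\<lambda>t. L2_normsq \<mu> (D F' G' t)) \<longlongrightarrow> 0) (at_right 0)"
    using assms by (simp_all add: ou_gen_graph_def D_def)
  have "((\<lambda>t. 2 * L2_normsq \<mu> (D F G t) + ennreal (2 * a\<^sup>2) * L2_normsq \<mu> (D F' G' t)) \<longlongrightarrow> 2 * 0 + ennreal (2 * a\<^sup>2) * 0) (at_right 0)"
    by (intro tendsto_add ennreal_tendsto_cmult l) auto
  then have lim: "((\<lambda>t. 2 * L2_normsq \<mu> (D F G t) + ennreal (2 * a\<^sup>2) * L2_normsq \<mu> (D F' G' t)) \<longlongrightarrow> 0) (at_right 0)"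
    by simp
  have le: "L2_normsq \<mu> (D (F + a *\<^sub>R F') (G + a *\<^sub>R G') t) \<le>
      2 * L2_normsq \<mu> (D F G t) + ennreal (2 * a\<^sup>2) * L2_normsq \<mu> (D F' G' t)" if "t > 0" for t
  proof -
    have "D (F + a *\<^sub>R F') (G + a *\<^sub>R G') t = D F G t + a *\<^sub>R D F' G' t"
      unfolding D_def T2_add_scaleR[OF that L2(1,2)] by (simp add: algebra_simps)
    then show ?thesis
      using L2_normsq_add_scaleR by simp
  qed
  have "((\<lambda>t. L2_normsq \<mu> (D (F + a *\<^sub>R F') (G + a *\<^sub>R G') t)) \<longlongrightarrow> 0) (at_right 0)"
    by (rule tendsto_sandwich[OF _ eventually_mono[OF eventually_at_right_less le] tendsto_const lim]) simp
  then show ?thesis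
    using L2 by (simp add: ou_gen_graph_def D_def L2_add_scaleR)
qed

end

section \<open>The chain of polynomials\<close>

lemma bherm_eq_0: "k > n \<Longrightarrow> bherm v b w n k x y = 0"
  by (simp add: bherm_def)

lemma exp_growth_bherm:
  assumes "exp_growth f" "exp_growth g"
  shows "exp_growth (\<lambda>p. bherm v b w n k (f p) (g p))"
proof (cases "k \<le> n")
  case True
  then show ?thesis
    using assms unfolding bherm_def if_P[OF True]
    by (intro exp_growth_cmult exp_growth_sum exp_growth_mult exp_growth_const exp_growth_herm)
next
  case False
  then show ?thesis by (simp add: bherm_eq_0 exp_growth_const)
qed

lemma bherm_measurable [measurable]:
  "(\<lambda>z::real^2. bherm v b w n k (z $ 1) (z $ 2)) \<in> borel_measurable borel"
  unfolding bherm_def by (cases "k \<le> n") simp_all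

lemma exp_growth_tri:
  "exp_growth (\<lambda>p. (z + tri a b d p) $ 1)" "exp_growth (\<lambda>p. (z + tri a b d p) $ 2)"
  using exp_growth_linear[of "z $ 1" a b] exp_growth_linear[of "z $ 2" 0 d]
  by (simp_all add: tri_def split_beta' add.assoc)

text \<open>Both sides are polynomials in x, so their coefficients agree. The binomial theorem for
  divided powers is \<open>herm_add\<close> at variance 0.\<close>

lemma shifted_powers_eq:
  fixes u r :: "nat \<Rightarrow> real"
  assumes "\<And>x. (\<Sum>k\<le>n. x ^ k / fact k * u k) = e * (\<Sum>k\<le>n. (x + t) ^ k / fact k * r k)"
    and "k \<le> n"
  shows "u k = e * (\<Sum>j\<le>n - k. t ^ j / fact j * r (k + j))"
proof -
  define s where "s i = (\<Sum>j\<le>n - i. t ^ j / fact j * r (i + j))" for i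
  have "(\<Sum>k\<le>n. (x + t) ^ k / fact k * r k) = (\<Sum>i\<le>n. x ^ i / fact i * s i)" for x
  proof -
    have "(x + t) ^ k / fact k = (\<Sum>i\<le>k. x ^ i / fact i * (t ^ (k - i) / fact (k - i)))" for k
    proof -
      have "(x + t) ^ k / fact k = herm 0 k (x + t)" by (simp add: herm_var_0)
      also have "\<dots> = (\<Sum>i\<le>k. herm 0 i x * herm 0 (k - i) t)"
        using herm_add[of 0 0 k x t] by simp
      finally show ?thesis by (simp add: herm_var_0)
    qed
    then have "(\<Sum>k\<le>n. (x + t) ^ k / fact k * r k) =
        (\<Sum>k\<le>n. \<Sum>i\<le>k. x ^ i / fact i * (t ^ (k - i) / fact (k - i)) * r k)"
      by (simp only: sum_distrib_right)
    also have "\<dots> = (\<Sum>i\<le>n. \<Sum>j\<le>n - i. x ^ i / fact i * (t ^ j / fact j) * r (i + j))"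
      unfolding sum.Sigma[OF finite_atMost ballI[OF finite_atMost]]
      by (rule sum.reindex_bij_witness[where
          i = "\<lambda>(i, j). (i + j, i)" and j = "\<lambda>(k, i). (i, k - i)"]) auto
    also have "\<dots> = (\<Sum>i\<le>n. x ^ i / fact i * s i)"
      by (simp add: s_def sum_distrib_left mult.assoc)
    finally show ?thesis .
  qed
  note expand = this
  have "(\<Sum>i\<le>n. (u i / fact i - e * s i / fact i) * x ^ i) = 0" for x
  proof -
    have "(\<Sum>i\<le>n. (u i / fact i - e * s i / fact i) * x ^ i) =
        (\<Sum>i\<le>n. x ^ i / fact i * u i) - e * (\<Sum>i\<le>n. x ^ i / fact i * s i)"
      unfolding sum_distrib_left sum_subtractf [symmetric]
      by (intro sum.cong refl) (simp add: algebra_simps)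
    then show ?thesis
      using assms(1)[of x] expand[of x] by simp
  qed
  then have "u k / fact k - e * s k / fact k = 0"
    using polyfun_eq_0[of "\<lambda>i. u i / fact i - e * s i / fact i" n] assms(2) by blast
  then show ?thesis
    by (simp add: s_def)
qed

context ou_process
begin

text \<open>The R_k of the overview for degree n; the parameters are the entries of 2
  Q_infinity.\<close>

definition chain_poly :: "nat \<Rightarrow> nat \<Rightarrow> real^2 \<Rightarrow> real" where
  "chain_poly n k z = bherm (\<rho> + \<rho> / (2 * c\<^sup>2)) (\<rho> / (2 * c)) \<rho> n k (z $ 1) (z $ 2)"

text \<open>The variance of x + tau y under mu.\<close>

definition wave_var :: "real \<Rightarrow> real" where
  "wave_var \<tau> = (\<rho> + \<rho> / (2 * c\<^sup>2)) + 2 * (\<rho> / (2 * c)) * \<tau> + \<rho> * \<tau>\<^sup>2"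

lemma chain_poly_measurable [measurable]: "chain_poly n k \<in> borel_measurable borel"
  unfolding chain_poly_def by measurable

lemma exp_growth_chain_poly: "exp_growth (\<lambda>p. chain_poly n k (z + tri a b d p))"
  unfolding chain_poly_def by (intro exp_growth_bherm exp_growth_tri)

lemma plane_wave: "herm (wave_var \<tau>) n (z $ 1 + \<tau> * z $ 2) = (\<Sum>k\<le>n. \<tau> ^ k / fact k * chain_poly n k z)"
  unfolding wave_var_def chain_poly_def by (rule herm_plane_wave)

text \<open>The balance 2 Q_infinity - 2 Q_t = exp(tB) 2 Q_infinity exp(tB)^*, tested on w = (1,
  tau); the transposed flow sends w to exp(-ct) (1, tau + t).\<close>

lemma wave_var_flow:
  assumes t: "t > 0"
  shows "wave_var \<tau> - (chol_a c \<sigma> t)\<^sup>2 - (chol_b c \<sigma> t + \<tau> * chol_d c \<sigma> t)\<^sup>2 =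
    (exp (- c * t))\<^sup>2 * wave_var (\<tau> + t)"
proof -
  note ch = chol[OF c_pos sigma_pos t]
  define E where "E = exp (- 2 * c * t)"
  have E: "(exp (- c * t))\<^sup>2 = E"
    by (simp add: E_def power2_eq_square flip: exp_add)
  have s: "\<sigma>\<^sup>2 = c * \<rho>"
    using c_pos by (simp add: \<rho>_def)
  have "(chol_a c \<sigma> t)\<^sup>2 + (chol_b c \<sigma> t + \<tau> * chol_d c \<sigma> t)\<^sup>2 =
      ((chol_a c \<sigma> t)\<^sup>2 + (chol_b c \<sigma> t)\<^sup>2) + 2 * \<tau> * (chol_b c \<sigma> t * chol_d c \<sigma> t) + \<tau>\<^sup>2 * (chol_d c \<sigma> t)\<^sup>2"
    by (simp add: power2_eq_square algebra_simps)
  also have "\<dots> = 2 * c * \<rho> * ((exp_int0 c t + exp_int2 c t) + 2 * \<tau> * exp_int1 c t + \<tau>\<^sup>2 * exp_int0 c t)"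
    unfolding ch s by (simp add: algebra_simps)
  also have "\<dots> = wave_var \<tau> - E * wave_var (\<tau> + t)"
    unfolding exp_int0_def exp_int1_def exp_int2_def E_def[symmetric] wave_var_def
    using c_pos by (simp add: field_simps power2_eq_square power3_eq_cube)
  finally show ?thesis unfolding E by simp
qed

text \<open>Noise lowers the variance parameter by \<open>integral_N2_herm\<close>,
  \<open>wave_var_flow\<close> identifies what remains, and \<open>herm_scale\<close> extracts the
  factor exp(-ct)^n.\<close>

lemma semigroup_wave:
  assumes t: "t > 0"
  shows "ou_semigroup c \<sigma> t (\<lambda>z. herm (wave_var \<tau>) n (z $ 1 + \<tau> * z $ 2)) z =
    exp (- c * t) ^ n * herm (wave_var (\<tau> + t)) n (z $ 1 + (\<tau> + t) * z $ 2)"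
proof -
  let ?a = "chol_a c \<sigma> t" and ?b = "chol_b c \<sigma> t" and ?d = "chol_d c \<sigma> t"
  let ?e = "exp (- c * t)"
  have "ou_semigroup c \<sigma> t (\<lambda>z. herm (wave_var \<tau>) n (z $ 1 + \<tau> * z $ 2)) z =
      (\<integral>p. herm (wave_var \<tau>) n ((ou_flow c t z + Lt t p) $ 1 + \<tau> * (ou_flow c t z + Lt t p) $ 2) \<partial>N2)"
    using t by (subst semigroup_eq) simp_all
  also have "\<dots> = (\<integral>p. herm (wave_var \<tau>) n (?e * (z $ 1 + (\<tau> + t) * z $ 2) + ?a * fst p + (?b + \<tau> * ?d) * snd p) \<partial>N2)"
    by (intro Bochner_Integration.integral_cong refl arg_cong[where f = "herm (wave_var \<tau>) n"])
      (simp add: ou_flow_def tri_def split_beta algebra_simps)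
  also have "\<dots> = herm (?e\<^sup>2 * wave_var (\<tau> + t)) n (?e * (z $ 1 + (\<tau> + t) * z $ 2))"
    unfolding integral_N2_herm wave_var_flow[OF t] ..
  finally show ?thesis
    by (simp only: herm_scale)
qed

lemma semigroup_chain_poly:
  assumes t: "t > 0" and "k \<le> n"
  shows "ou_semigroup c \<sigma> t (chain_poly n k) z = exp (- c * t) ^ n * (\<Sum>j\<le>n - k. t ^ j / fact j * chain_poly n (k + j) z)"
proof (rule shifted_powers_eq[OF _ \<open>k \<le> n\<close>, where u = "\<lambda>k. ou_semigroup c \<sigma> t (chain_poly n k) z"])
  fix \<tau>
  have "(\<Sum>k\<le>n. \<tau> ^ k / fact k * ou_semigroup c \<sigma> t (chain_poly n k) z) =
      (\<Sum>k\<le>n. \<tau> ^ k / fact k * (\<integral>p. chain_poly n k (ou_flow c t z + Lt t p) \<partial>N2))"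
    by (simp add: semigroup_eq[OF t chain_poly_measurable])
  also have "\<dots> = (\<integral>p. (\<Sum>k\<le>n. \<tau> ^ k / fact k * chain_poly n k (ou_flow c t z + Lt t p)) \<partial>N2)"
    by (subst Bochner_Integration.integral_sum)
      (intro exp_growth_integrable exp_growth_cmult exp_growth_chain_poly, simp)
  also have "\<dots> = ou_semigroup c \<sigma> t (\<lambda>z. herm (wave_var \<tau>) n (z $ 1 + \<tau> * z $ 2)) z"
    unfolding plane_wave [symmetric] by (rule semigroup_eq [OF t, symmetric]) simp
  also have "\<dots> = exp (- c * t) ^ n * (\<Sum>k\<le>n. (\<tau> + t) ^ k / fact k * chain_poly n k z)"
    unfolding semigroup_wave[OF t] unfolding plane_wave ..
  finally show "(\<Sum>k\<le>n. \<tau> ^ k / fact k * ou_semigroup c \<sigma> t (chain_poly n k) z) =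
    exp (- c * t) ^ n * (\<Sum>k\<le>n. (\<tau> + t) ^ k / fact k * chain_poly n k z)" .
qed

definition chain :: "nat \<Rightarrow> nat \<Rightarrow> aefun" where
  "chain n k = ae_class (chain_poly n k)"

lemma exp_growth_chain_poly_L: "exp_growth (\<lambda>p. chain_poly n k (L p))"
  using exp_growth_chain_poly[of n k 0] by simp

lemma chain_L2: "chain n k \<in> L2 \<mu>"
  unfolding chain_def by (simp add: L2_ae_class_iff exp_growth_sq_int exp_growth_chain_poly_L)

lemma chain_eq_0: "k > n \<Longrightarrow> chain n k = 0"
  by (simp add: chain_def chain_poly_def [abs_def] bherm_eq_0 ae_class_0)

text \<open>The coefficient of R_(k+j) in (T(t)R_k - R_k)/t minus the claimed A_2 R_k: a difference
  quotient with its limit subtracted for j = 0, exp(-nct) - 1 for j = 1, and a positive power of t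
  times a bounded factor for larger j.\<close>

lemma tendsto_gen_coeff:
  "((\<lambda>t. (exp (- c * t) ^ n * (t ^ j / fact j) - (if j = 0 then 1 else 0)) / t
      + (if j = 0 then real n * c else 0) - (if j = 1 then 1 else 0)) \<longlongrightarrow> 0) (at_right 0)"
proof -
  have e: "exp (- c * t) ^ n = exp (- (real n * c) * t)" for t
    by (simp flip: exp_of_nat_mult)
  have d: "((\<lambda>t. exp (- (real n * c) * t)) has_real_derivative - (real n * c)) (at 0)"
    by (auto intro!: derivative_eq_intros)
  have l: "((\<lambda>t. exp (- (real n * c) * t)) \<longlongrightarrow> 1) (at_right 0)"
    by (auto intro!: tendsto_eq_intros)
  consider "j = 0" | "j = 1" | i where "j = Suc (Suc i)"
    by (metis One_nat_def not0_implies_Suc)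
  then show ?thesis
  proof cases
    case 1
    have "((\<lambda>t. (exp (- (real n * c) * t) - 1) / t) \<longlongrightarrow> - (real n * c)) (at_right 0)"
      using d by (auto simp: has_field_derivative_iff intro: tendsto_mono[OF at_within_le_at])
    from tendsto_add[OF this tendsto_const[of "real n * c"]] show ?thesis
      unfolding e by (simp add: 1)
  next
    case 2
    have "\<forall>\<^sub>F t in at_right 0. exp (- (real n * c) * t) - 1 =
        (exp (- c * t) ^ n * (t ^ j / fact j) - (if j = 0 then 1 else 0)) / t
      + (if j = 0 then real n * c else 0) - (if j = 1 then 1 else 0)"
      using eventually_at_right_less[of "0::real"] by eventually_elim (unfold e, simp add: 2)
    moreover have "((\<lambda>t. exp (- (real n * c) * t) - 1) \<longlongrightarrow> 0) (at_right 0)"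
      using tendsto_diff[OF l tendsto_const[of 1]] by simp
    ultimately show ?thesis by (rule Lim_transform_eventually[rotated])
  next
    case 3
    have "\<forall>\<^sub>F t in at_right 0. exp (- (real n * c) * t) * (t ^ Suc i / fact j) =
        (exp (- c * t) ^ n * (t ^ j / fact j) - (if j = 0 then 1 else 0)) / t
      + (if j = 0 then real n * c else 0) - (if j = 1 then 1 else 0)"
      using eventually_at_right_less[of "0::real"] by eventually_elim (unfold e, simp add: 3 del: fact_Suc)
    moreover have "((\<lambda>t. exp (- (real n * c) * t) * (t ^ Suc i / fact j)) \<longlongrightarrow> 1 * (0 ^ Suc i / fact j)) (at_right 0)"
      by (intro tendsto_intros l) simp
    ultimately show ?thesis
      by (auto intro: Lim_transform_eventually[rotated])
  qed
qed

lemma gen_graph_chain: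
  assumes "k \<le> n"
  shows "ou_gen_graph c \<sigma> \<mu> (chain n k) (chain n (k + 1) + (- real n * c) *\<^sub>R chain n k)"
proof -
  define \<phi> where "\<phi> j t = (exp (- c * t) ^ n * (t ^ j / fact j) - (if j = 0 then 1 else 0)) / t
      + (if j = 0 then real n * c else 0) - (if j = 1 then 1 else 0)" for j :: nat and t :: real
  \<comment> \<open>One term more than \<open>semigroup_chain_poly\<close> provides, so that j = 1
    occurs also for k = n; the added R_(n+1) is zero.\<close>
  define m where "m = n - k + 1"
  define C where "C = (\<integral>p. (\<Sum>j\<le>m. (chain_poly n (k + j) (L p))\<^sup>2) \<partial>N2)"
  define G where "G = chain n (k + 1) + (- real n * c) *\<^sub>R chain n k"
  have int: "integrable N2 (\<lambda>p. \<Sum>j\<le>m. (chain_poly n (k + j) (L p))\<^sup>2)"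
    by (intro exp_growth_integrable exp_growth_sum exp_growth_power exp_growth_chain_poly_L)
  have le: "L2_normsq \<mu> ((1 / t) *\<^sub>R (ou_T2 c \<sigma> t (chain n k) - chain n k) - G) \<le> ennreal ((\<Sum>j\<le>m. (\<phi> j t)\<^sup>2) * C)"
    if t: "t > 0" for t
  proof -
    define D where "D z = (\<Sum>j\<le>m. \<phi> j t * chain_poly n (k + j) z)" for z
    have [measurable]: "ou_semigroup c \<sigma> t (chain_poly n k) \<in> borel_measurable borel"
      by (rule semigroup_measurable[OF t chain_poly_measurable])
    have "(1 / t) * (ou_semigroup c \<sigma> t (chain_poly n k) z - chain_poly n k z) - (chain_poly n (k + 1) z + (- real n * c) * chain_poly n k z) = D z" for z
    proof -
      have "ou_semigroup c \<sigma> t (chain_poly n k) z = exp (- c * t) ^ n * (\<Sum>j\<le>m. t ^ j / fact j * chain_poly n (k + j) z)"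
        unfolding semigroup_chain_poly[OF t assms] m_def using assms by (simp add: chain_poly_def bherm_eq_0)
      also have "\<dots> = (\<Sum>j\<le>m. exp (- c * t) ^ n * (t ^ j / fact j) * chain_poly n (k + j) z)"
        by (simp add: sum_distrib_left mult.assoc)
      finally have 1: "ou_semigroup c \<sigma> t (chain_poly n k) z =
        (\<Sum>j\<le>m. exp (- c * t) ^ n * (t ^ j / fact j) * chain_poly n (k + j) z)" .
      have 2: "chain_poly n k z = (\<Sum>j\<le>m. (if j = 0 then 1 else 0) * chain_poly n (k + j) z)"
        "chain_poly n (k + 1) z = (\<Sum>j\<le>m. (if j = 1 then 1 else 0) * chain_poly n (k + j) z)"
        by (auto simp: if_distrib[where f = "\<lambda>x. x * _"] m_def cong: if_cong)
      let ?a = "\<lambda>j. exp (- c * t) ^ n * (t ^ j / fact j)"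
        and ?b = "\<lambda>j::nat. if j = 0 then 1 else 0 :: real" and ?c = "\<lambda>j::nat. if j = 1 then 1 else 0 :: real"
      have "(1 / t) * (ou_semigroup c \<sigma> t (chain_poly n k) z - chain_poly n k z) - (chain_poly n (k + 1) z + (- real n * c) * chain_poly n k z) =
          (1 / t) * ((\<Sum>j\<le>m. ?a j * chain_poly n (k + j) z) - (\<Sum>j\<le>m. ?b j * chain_poly n (k + j) z)) -
          ((\<Sum>j\<le>m. ?c j * chain_poly n (k + j) z) + (- real n * c) * (\<Sum>j\<le>m. ?b j * chain_poly n (k + j) z))"
        by (simp only: 1 2 [symmetric])
      also have "\<dots> = D z"
        unfolding D_def sum_distrib_left sum_subtractf [symmetric] sum.distrib [symmetric]
        by (rule sum.cong[OF refl]) (simp add: \<phi>_def algebra_simps diff_divide_distrib)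
      finally show ?thesis .
    qed
    then have "(1 / t) *\<^sub>R (ou_T2 c \<sigma> t (chain n k) - chain n k) - G = ae_class D"
      by (simp add: chain_def G_def T2_ae_class[OF t] ae_class_minus ae_class_scaleR ae_class_plus)
    moreover have [measurable]: "D \<in> borel_measurable borel"
      unfolding D_def by measurable
    ultimately have "L2_normsq \<mu> ((1 / t) *\<^sub>R (ou_T2 c \<sigma> t (chain n k) - chain n k) - G) = (\<integral>\<^sup>+p. ennreal ((D (L p))\<^sup>2) \<partial>N2)"
      by (simp add: L2_normsq_ae_class)
    \<comment> \<open>Cauchy-Schwarz for finite sums separates the dependence on t from the integral
      over p, which becomes the constant \<open>C\<close>.\<close>
    also have "\<dots> \<le> (\<integral>\<^sup>+p. ennreal ((\<Sum>j\<le>m. (\<phi> j t)\<^sup>2) * (\<Sum>j\<le>m. (chain_poly n (k + j) (L p))\<^sup>2)) \<partial>N2)"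
      unfolding D_def by (intro nn_integral_mono ennreal_leI Cauchy_Schwarz_ineq_sum)
    also have "\<dots> = ennreal ((\<Sum>j\<le>m. (\<phi> j t)\<^sup>2) * C)"
      unfolding C_def
      by (subst nn_integral_eq_integral) (auto intro!: int integrable_mult_right sum_nonneg mult_nonneg_nonneg)
    finally show ?thesis .
  qed
  have "((\<lambda>t. (\<Sum>j\<le>m. (\<phi> j t)\<^sup>2) * C) \<longlongrightarrow> (\<Sum>j\<le>m. 0\<^sup>2) * C) (at_right 0)"
    unfolding \<phi>_def by (intro tendsto_intros tendsto_gen_coeff)
  then have "((\<lambda>t. ennreal ((\<Sum>j\<le>m. (\<phi> j t)\<^sup>2) * C)) \<longlongrightarrow> ennreal ((\<Sum>j\<le>m. 0\<^sup>2) * C)) (at_right 0)"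
    by (rule tendsto_ennrealI)
  then have lim: "((\<lambda>t. ennreal ((\<Sum>j\<le>m. (\<phi> j t)\<^sup>2) * C)) \<longlongrightarrow> 0) (at_right 0)"
    by simp
  have "((\<lambda>t. L2_normsq \<mu> ((1 / t) *\<^sub>R (ou_T2 c \<sigma> t (chain n k) - chain n k) - G)) \<longlongrightarrow> 0) (at_right 0)"
    by (rule tendsto_sandwich[OF _ eventually_mono[OF eventually_at_right_less le] tendsto_const lim]) simp
  then show ?thesis
    unfolding ou_gen_graph_def G_def by (intro conjI chain_L2 L2_add_scaleR)
qed

text \<open>H_n(y) is continuous and not identically zero, so it is nonzero on a nonempty open set,
  which has positive measure. The shift structure later carries this from the last link to the
  others.\<close>

lemma chain_neq_0: "chain n n \<noteq> 0"
proof
  assume "chain n n = 0"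
  then have "ae_class (chain_poly n n) = ae_class (\<lambda>_. 0)"
    by (simp add: chain_def ae_class_0)
  then have ae: "AE z in lborel. chain_poly n n z = 0"
    by (rule ae_class_eqD) simp_all
  have R: "chain_poly n n z = fact n * herm \<rho> n (z $ 2)" for z
    by (simp add: chain_poly_def bherm_def)
  define S where "S = {z::real^2. chain_poly n n z \<noteq> 0}"
  have "continuous_on UNIV (chain_poly n n)"
    unfolding R [abs_def] by (intro continuous_intros continuous_on_compose2[OF herm_continuous[of UNIV]]) auto
  then have "open S"
    unfolding S_def by (intro open_Collect_neq) (auto intro: continuous_intros)
  moreover have "S \<noteq> {}"
  proof -
    obtain y where "herm \<rho> n y \<noteq> 0" using herm_not_zero by blast
    then have "vec2 0 y \<in> S" by (simp add: S_def R)
    then show ?thesis by blast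
  qed
  ultimately have "\<not> negligible S" by (rule open_not_negligible)
  moreover have "S \<in> null_sets lborel"
    using ae \<open>open S\<close> by (subst (asm) AE_iff_null) (auto simp: S_def)
  ultimately show False
    by (simp add: negligible_iff_null_sets null_sets_completionI)
qed

end

section \<open>Moments and uniqueness\<close>

lemma norm_exp_partial_sum_le:
  fixes z :: complex
  shows "norm (\<Sum>k<N. z ^ k / fact k) \<le> exp (norm z)"
proof -
  have "norm (\<Sum>k<N. z ^ k / fact k) \<le> (\<Sum>k<N. norm z ^ k / fact k)"
    by (rule norm_sum[THEN order_trans]) (simp add: norm_divide norm_power)
  also have "\<dots> \<le> (\<Sum>k. norm z ^ k / fact k)"
    using summable_exp[of "norm z"] by (intro sum_le_suminf) (auto simp: field_simps)
  also have "\<dots> = exp (norm z)"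
    by (simp add: exp_def field_simps)
  finally show ?thesis .
qed

lemma power_le_fact_exp: "0 \<le> x \<Longrightarrow> x ^ k \<le> fact k * exp (x::real)"
proof -
  assume x: "0 \<le> x"
  have "x ^ k / fact k \<le> (\<Sum>k. x ^ k / fact k)"
    using sum_le_suminf[of "\<lambda>k. x ^ k / fact k" "{k}"] summable_exp[of x] x by (simp add: field_simps)
  also have "\<dots> = exp x"
    by (simp add: exp_def field_simps)
  finally show ?thesis by (simp add: field_simps)
qed

lemma integrable_moment:
  fixes g X :: "'a \<Rightarrow> real"
  assumes [measurable]: "g \<in> borel_measurable M" "X \<in> borel_measurable M"
    and int: "\<And>a. integrable M (\<lambda>w. g w * exp (a * \<bar>X w\<bar>))"
  shows "integrable M (\<lambda>w. g w * X w ^ k)"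
proof (rule Bochner_Integration.integrable_bound)
  show "integrable M (\<lambda>w. fact k * (g w * exp (1 * \<bar>X w\<bar>)))"
    by (intro integrable_mult_right int)
  have "\<bar>g w\<bar> * \<bar>X w\<bar> ^ k \<le> \<bar>g w\<bar> * (fact k * exp \<bar>X w\<bar>)" for w
    by (intro mult_left_mono power_le_fact_exp) simp_all
  then show "AE w in M. norm (g w * X w ^ k) \<le> norm (fact k * (g w * exp (1 * \<bar>X w\<bar>)))"
    by (simp add: abs_mult power_abs mult_ac)
qed simp

text \<open>Dominated convergence, with |g| exp(|z| |X|) as a bound for all partial sums. Complex z
  serves the characteristic function, real z the Laplace transform.\<close>

lemma exp_moment_sums:
  fixes g X :: "'a \<Rightarrow> real" and z :: complex
  assumes [measurable]: "g \<in> borel_measurable M" "X \<in> borel_measurable M"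
    and int: "\<And>a. integrable M (\<lambda>w. g w * exp (a * \<bar>X w\<bar>))"
  shows "(\<lambda>k. z ^ k / fact k * of_real (\<integral>w. g w * X w ^ k \<partial>M)) sums
    (\<integral>w. of_real (g w) * exp (z * of_real (X w)) \<partial>M)"
proof -
  have im: "integrable M (\<lambda>w. g w * X w ^ k)" for k
    by (rule integrable_moment) (auto intro: int)
  have "(\<lambda>N. \<integral>w. of_real (g w) * (\<Sum>k<N. (z * of_real (X w)) ^ k / fact k) \<partial>M) \<longlonglongrightarrow>
      (\<integral>w. of_real (g w) * exp (z * of_real (X w)) \<partial>M)"
  proof (rule integral_dominated_convergence[where w = "\<lambda>w. \<bar>g w * exp (norm z * \<bar>X w\<bar>)\<bar>"])
    show "integrable M (\<lambda>w. \<bar>g w * exp (norm z * \<bar>X w\<bar>)\<bar>)"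
      using int by (rule integrable_abs)
    show "AE w in M. (\<lambda>N. of_real (g w) * (\<Sum>k<N. (z * of_real (X w)) ^ k / fact k))
        \<longlonglongrightarrow> of_real (g w) * exp (z * of_real (X w))"
    proof (rule AE_I2)
      fix w
      have "(\<lambda>k. (z * of_real (X w)) ^ k / fact k) sums exp (z * of_real (X w))"
        using exp_converges[of "z * of_real (X w)"] by (simp add: scaleR_conv_of_real field_simps)
      then show "(\<lambda>N. of_real (g w) * (\<Sum>k<N. (z * of_real (X w)) ^ k / fact k))
          \<longlonglongrightarrow> of_real (g w) * exp (z * of_real (X w))"
        unfolding sums_def by (intro tendsto_intros)
    qed
    show "AE w in M. norm (complex_of_real (g w) * (\<Sum>k<N. (z * of_real (X w)) ^ k / fact k))
        \<le> \<bar>g w * exp (norm z * \<bar>X w\<bar>)\<bar>" for N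
    proof (rule AE_I2)
      fix w
      show "norm (complex_of_real (g w) * (\<Sum>k<N. (z * of_real (X w)) ^ k / fact k))
        \<le> \<bar>g w * exp (norm z * \<bar>X w\<bar>)\<bar>"
        using norm_exp_partial_sum_le[of "z * of_real (X w)" N]
        by (simp add: norm_mult abs_mult mult_left_mono)
    qed
  qed measurable
  moreover have "(\<integral>w. of_real (g w) * (\<Sum>k<N. (z * of_real (X w)) ^ k / fact k) \<partial>M) =
      (\<Sum>k<N. z ^ k / fact k * of_real (\<integral>w. g w * X w ^ k \<partial>M))" for N
  proof -
    have "of_real (g w) * (\<Sum>k<N. (z * of_real (X w)) ^ k / fact k) =
        (\<Sum>k<N. z ^ k / fact k * complex_of_real (g w * X w ^ k))" for w
      by (simp add: sum_distrib_left power_mult_distrib mult_ac)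
    moreover have "(\<integral>w. (\<Sum>k<N. z ^ k / fact k * complex_of_real (g w * X w ^ k)) \<partial>M) =
      (\<Sum>k<N. \<integral>w. z ^ k / fact k * complex_of_real (g w * X w ^ k) \<partial>M)"
      by (rule Bochner_Integration.integral_sum) (intro integrable_mult_right integrable_of_real im)
    ultimately show ?thesis
      by (simp only: integral_mult_right_zero integral_complex_of_real)
  qed
  ultimately show ?thesis by (simp add: sums_def)
qed

lemma exp_moment_sums_real:
  fixes g X :: "'a \<Rightarrow> real" and s :: real
  assumes [measurable]: "g \<in> borel_measurable M" "X \<in> borel_measurable M"
    and int: "\<And>a. integrable M (\<lambda>w. g w * exp (a * \<bar>X w\<bar>))"
  shows "(\<lambda>k. s ^ k / fact k * (\<integral>w. g w * X w ^ k \<partial>M)) sums (\<integral>w. g w * exp (s * X w) \<partial>M)"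
proof -
  have "(\<lambda>k. complex_of_real (s ^ k / fact k * (\<integral>w. g w * X w ^ k \<partial>M))) sums
      complex_of_real (\<integral>w. g w * exp (s * X w) \<partial>M)"
  proof -
    have "(\<integral>w. complex_of_real (g w) * exp (of_real s * of_real (X w)) \<partial>M) =
        complex_of_real (\<integral>w. g w * exp (s * X w) \<partial>M)"
      unfolding integral_complex_of_real [symmetric] by (simp add: exp_of_real [symmetric])
    then show ?thesis
      using exp_moment_sums[OF assms(1,2) int, of "of_real s"] by simp
  qed
  then show ?thesis
    by (simp only: sums_of_real_iff)
qed

text \<open>
  The positive and negative parts of \<open>g\<close> give two distributions of \<open>X\<close> with the same characteristic
  function, since the exponential moments of \<open>g\<close> are finite.
\<close>

lemma moments_zero_imp_integral_indicator_zero: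
  fixes g X :: "'a \<Rightarrow> real"
  assumes [measurable]: "g \<in> borel_measurable M" "X \<in> borel_measurable M"
    and int: "\<And>a. integrable M (\<lambda>w. g w * exp (a * \<bar>X w\<bar>))"
    and zero: "\<And>k. (\<integral>w. g w * X w ^ k \<partial>M) = 0"
    and B [measurable]: "B \<in> sets borel"
  shows "(\<integral>w. g w * indicator B (X w) \<partial>M) = 0"
proof -
  have ig: "integrable M g"
    using int[of 0] by simp
  define p where "p w = max 0 (g w)" for w
  define q where "q w = max 0 (- g w)" for w
  have pq: "g w = p w - q w" "p w \<ge> 0" "q w \<ge> 0" for w
    by (simp_all add: p_def q_def)
  have [measurable]: "p \<in> borel_measurable M" "q \<in> borel_measurable M"
    unfolding p_def [abs_def] q_def [abs_def] by simp_all
  have ip: "integrable M p" and iq: "integrable M q"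
    unfolding p_def [abs_def] q_def [abs_def] using ig by simp_all
  have ib: "integrable M (\<lambda>w. h w * k w)" if "integrable M h" "\<And>w. norm (k w) \<le> 1" "k \<in> borel_measurable M"
    for h :: "'a \<Rightarrow> 'b::{real_normed_field, banach, second_countable_topology}" and k
  proof (rule Bochner_Integration.integrable_bound[OF that(1)])
    show "(\<lambda>w. h w * k w) \<in> borel_measurable M"
      using that by simp
    show "AE w in M. norm (h w * k w) \<le> norm (h w)"
      using that(2) by (auto simp: norm_mult intro!: mult_left_le)
  qed
  define m where "m = integral\<^sup>L M p"
  have m: "integral\<^sup>L M q = m"
    using zero[of 0] ip iq by (simp add: pq(1) m_def)
  show ?thesis
  \<comment> \<open>The zeroth moment gives both parts the same mass m. If m = 0 no normalisation is
    possible, but then g vanishes almost everywhere.\<close>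
  proof (cases "m = 0")
    case True
    then have "AE w in M. p w = 0" "AE w in M. q w = 0"
      using integral_nonneg_eq_0_iff_AE[OF ip] integral_nonneg_eq_0_iff_AE[OF iq] pq m by (auto simp: m_def)
    then have "AE w in M. g w * indicator B (X w) = 0"
      by eventually_elim (simp add: pq(1))
    then show ?thesis
      by (rule integral_eq_zero_AE)
  next
    case False
    moreover have "m \<ge> 0"
      unfolding m_def using pq by (intro Bochner_Integration.integral_nonneg) auto
    ultimately have mp: "m > 0" by simp
    define D where "D h = distr (density M (\<lambda>w. ennreal (h w / m))) borel X" for h
    have D: "real_distribution (D h)" "\<And>t. char (D h) t = (\<integral>w. complex_of_real (h w) * iexp (t * X w) \<partial>M) / m"
       "measure (D h) B = (\<integral>w. h w * indicator B (X w) \<partial>M) / m"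
      if h [measurable]: "h \<in> borel_measurable M" "\<And>w. h w \<ge> 0" "integrable M h" "integral\<^sup>L M h = m" for h
    proof -
      have "(\<integral>\<^sup>+w. ennreal (h w / m) \<partial>M) = 1"
        using h mp by (subst nn_integral_eq_integral) auto
      then have "prob_space (density M (\<lambda>w. ennreal (h w / m)))"
        by (intro prob_spaceI) (simp add: emeasure_density)
      then interpret P: prob_space "density M (\<lambda>w. ennreal (h w / m))" .
      show R: "real_distribution (D h)"
        unfolding D_def by (rule P.real_distribution_distr) simp
      show "char (D h) t = (\<integral>w. complex_of_real (h w) * iexp (t * X w) \<partial>M) / m" for t
      proof -
        have "char (D h) t = (\<integral>w. (h w / m) *\<^sub>R iexp (t * X w) \<partial>M)"
          unfolding char_def D_def using h(2) mp
          by (subst integral_distr) (auto simp: integral_density)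
        also have "\<dots> = (\<integral>w. complex_of_real (h w) * iexp (t * X w) / m \<partial>M)"
          by (simp add: scaleR_conv_of_real)
        finally show ?thesis by simp
      qed
      have "measure (D h) B = (\<integral>x. indicator B x \<partial>D h)"
        using R by (simp add: real_distribution_def real_distribution_axioms_def)
      also have "\<dots> = (\<integral>w. (h w / m) *\<^sub>R indicator B (X w) \<partial>M)"
        unfolding D_def using h(2) mp by (subst integral_distr) (auto simp: integral_density)
      finally show "measure (D h) B = (\<integral>w. h w * indicator B (X w) \<partial>M) / m"
        by simp
    qed
    note Dp = D[of p, OF _ pq(2) ip m_def[symmetric], simplified]
      and Dq = D[of q, OF _ pq(3) iq m, simplified]
    have "char (D p) = char (D q)"
    proof
      fix t
      have "(\<integral>w. complex_of_real (p w) * iexp (t * X w) \<partial>M) - (\<integral>w. complex_of_real (q w) * iexp (t * X w) \<partial>M)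
        = (\<integral>w. complex_of_real (p w) * iexp (t * X w) - complex_of_real (q w) * iexp (t * X w) \<partial>M)"
        by (rule Bochner_Integration.integral_diff [symmetric]) (auto intro!: ib ip iq integrable_of_real)
      also have "\<dots> = (\<integral>w. complex_of_real (g w) * exp ((\<i> * t) * of_real (X w)) \<partial>M)"
        by (simp add: pq(1) left_diff_distrib mult_ac)
      \<comment> \<open>At z = i t all terms of the moment series are zero.\<close>
      also have "\<dots> = 0"
        using sums_unique2[OF exp_moment_sums[OF assms(1,2) int, of "\<i> * t"]] by (simp add: zero)
      finally show "char (D p) t = char (D q) t"
        by (simp add: Dp Dq)
    qed
    then have "D p = D q"
      by (intro Levy_uniqueness Dp Dq)
    then have "(\<integral>w. p w * indicator B (X w) \<partial>M) = (\<integral>w. q w * indicator B (X w) \<partial>M)"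
      using Dp(3) Dq(3) mp by simp
    moreover have "(\<integral>w. g w * indicator B (X w) \<partial>M) =
        (\<integral>w. p w * indicator B (X w) \<partial>M) - (\<integral>w. q w * indicator B (X w) \<partial>M)"
      unfolding pq(1) left_diff_distrib
      by (rule Bochner_Integration.integral_diff) (auto intro!: ib ip iq simp: indicator_def)
    ultimately show ?thesis by simp
  qed
qed

lemma exp_growth_exp_abs: "exp_growth (\<lambda>p. exp (a * \<bar>h * fst p + k * snd p\<bar>))"
proof (rule exp_growthI[where C = 1 and a = "\<bar>a\<bar> * (\<bar>h\<bar> + \<bar>k\<bar>)"])
  fix p :: "real \<times> real"
  have "\<bar>h * fst p + k * snd p\<bar> \<le> \<bar>h\<bar> * \<bar>fst p\<bar> + \<bar>k\<bar> * \<bar>snd p\<bar>"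
    using abs_triangle_ineq[of "h * fst p" "k * snd p"] by (simp add: abs_mult)
  also have "\<dots> \<le> (\<bar>h\<bar> + \<bar>k\<bar>) * (\<bar>fst p\<bar> + \<bar>snd p\<bar>)"
    by (simp add: algebra_simps)
  finally have "\<bar>a\<bar> * \<bar>h * fst p + k * snd p\<bar> \<le> \<bar>a\<bar> * ((\<bar>h\<bar> + \<bar>k\<bar>) * (\<bar>fst p\<bar> + \<bar>snd p\<bar>))"
    by (rule mult_left_mono) simp
  moreover have "a * \<bar>h * fst p + k * snd p\<bar> \<le> \<bar>a\<bar> * \<bar>h * fst p + k * snd p\<bar>"
    by (rule mult_right_mono) simp_all
  ultimately show "\<bar>exp (a * \<bar>h * fst p + k * snd p\<bar>)\<bar> \<le>
      1 * exp (\<bar>a\<bar> * (\<bar>h\<bar> + \<bar>k\<bar>) * (\<bar>fst p\<bar> + \<bar>snd p\<bar>))"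
    by (simp add: mult.assoc)
qed measurable

text \<open>Rectangles form an intersection-stable generator, and the sets over which f integrates
  to zero are closed under complements and countable disjoint unions. A function integrating to zero
  over every measurable set vanishes almost everywhere.\<close>

lemma N2_integral_eq_zero_imp_AE:
  fixes f :: "real \<times> real \<Rightarrow> real"
  assumes f: "integrable N2 f"
    and rect: "\<And>A B. A \<in> sets borel \<Longrightarrow> B \<in> sets borel \<Longrightarrow>
      (\<integral>p. f p * indicator A (fst p) * indicator B (snd p) \<partial>N2) = 0"
  shows "AE p in N2. f p = 0"
proof (rule N2.density_zero[OF f])
  let ?G = "{A \<times> B |A B. A \<in> sets borel \<and> B \<in> sets borel} :: (real \<times> real) set set"
  have sets: "sets N2 = sigma_sets UNIV ?G"
  proof -
    have "sets N2 = sets ((borel :: real measure) \<Otimes>\<^sub>M (borel :: real measure))"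
      unfolding borel_prod by simp
    then show ?thesis by (simp add: sets_pair_measure)
  qed
  have int: "set_integrable N2 A f" if "A \<in> sets N2" for A
    unfolding set_integrable_def using that f by (rule integrable_mult_indicator)
  have all: "(LINT p|N2. f p) = 0"
    using rect[of UNIV UNIV] by simp
  fix A assume A: "A \<in> sets N2"
  have "Int_stable ?G"
    by (rule Int_stable_pair_measure_generator)
  moreover have "?G \<subseteq> Pow UNIV" by simp
  ultimately show "set_lebesgue_integral N2 A f = 0"
    using A[unfolded sets]
  proof (induction rule: sigma_sets_induct_disjoint)
    case (basic A)
    then obtain B C where BC: "A = B \<times> C" "B \<in> sets borel" "C \<in> sets borel"
      by auto
    have "set_lebesgue_integral N2 A f = (\<integral>p. f p * indicator B (fst p) * indicator C (snd p) \<partial>N2)"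
      unfolding set_lebesgue_integral_def BC(1)
      by (rule Bochner_Integration.integral_cong) (auto simp: indicator_def)
    then show ?case using rect BC by simp
  next
    case empty
    show ?case by (simp add: set_lebesgue_integral_def)
  next
    case (compl A)
    have "set_lebesgue_integral N2 (UNIV - A) f = (\<integral>p. f p - indicator A p *\<^sub>R f p \<partial>N2)"
      unfolding set_lebesgue_integral_def
      by (rule Bochner_Integration.integral_cong) (auto simp: indicator_def)
    also have "\<dots> = 0"
      using compl(2) int[unfolded sets, OF compl(1)] f all
      by (simp add: set_lebesgue_integral_def set_integrable_def)
    finally show ?case .
  next
    case (union A)
    have m: "A i \<in> sets N2" for i
      using union(2) unfolding sets by blast
    have "set_lebesgue_integral N2 (\<Union>i. A i) f = (\<Sum>i. set_lebesgue_integral N2 (A i) f)"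
      using union(1) m by (intro lebesgue_integral_countable_add int) (auto simp: disjoint_family_on_def)
    then show ?case
      using union(3) by simp
  qed
qed

text \<open>One variable at a time: with y^j as part of the weight, the moments in x give the
  indicator of A; with that indicator in the weight, the moments in y give the indicator of
  B.\<close>

lemma mixed_moments_zero_imp_AE:
  assumes f: "sq_int f"
    and zero: "\<And>i j. (\<integral>p. f p * fst p ^ i * snd p ^ j \<partial>N2) = 0"
  shows "AE p in N2. f p = 0"
proof (rule N2_integral_eq_zero_imp_AE)
  note [measurable] = sq_int_measurable[OF f]
  show "integrable N2 f"
    using f by (rule sq_int_integrable)
  fix A B :: "real set" assume [measurable]: "A \<in> sets borel" "B \<in> sets borel"
  have 1: "(\<integral>p. (f p * snd p ^ j) * indicator A (fst p) \<partial>N2) = 0" for j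
  proof (rule moments_zero_imp_integral_indicator_zero)
    show "integrable N2 (\<lambda>p. f p * snd p ^ j * exp (a * \<bar>fst p\<bar>))" for a
      using sq_int_exp_growth_integrable[OF f exp_growth_mult[OF exp_growth_power[OF exp_growth_snd] exp_growth_exp_abs[of a 1 0]], of j]
      by (simp add: mult.assoc)
    show "(\<integral>p. f p * snd p ^ j * fst p ^ k \<partial>N2) = 0" for k
      using zero[of k j] by (simp add: mult_ac)
  qed simp_all
  have i: "integrable N2 (\<lambda>p. f p * indicator A (fst p) * exp (a * \<bar>snd p\<bar>))" for a
  proof (rule Bochner_Integration.integrable_bound)
    show "integrable N2 (\<lambda>p. f p * exp (a * \<bar>0 * fst p + 1 * snd p\<bar>))"
      by (rule sq_int_exp_growth_integrable[OF f exp_growth_exp_abs])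
  qed (auto simp: indicator_def abs_mult)
  show "(\<integral>p. f p * indicator A (fst p) * indicator B (snd p) \<partial>N2) = 0"
  proof (rule moments_zero_imp_integral_indicator_zero[OF _ _ i])
    show "(\<integral>p. f p * indicator A (fst p) * snd p ^ k \<partial>N2) = 0" for k
      using 1[of k] by (simp add: mult_ac)
  qed simp_all
qed

lemma exp_remainder_le: "\<bar>exp s - 1 - s\<bar> \<le> s\<^sup>2 * exp \<bar>s::real\<bar>"
proof -
  have nn: "0 \<le> exp s - 1 - s"
    using exp_ge_add_one_self[of s] by linarith
  show ?thesis
  proof (cases "s \<ge> 0")
    case True
    have "exp s * (1 - s) \<le> exp s * exp (- s)"
      using exp_ge_add_one_self[of "- s"] by (intro mult_left_mono) simp_all
    then have *: "exp s - 1 \<le> s * exp s"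
      by (simp add: exp_minus algebra_simps)
    then have "s * (exp s - 1) \<le> s * (s * exp s)"
      using True by (rule mult_left_mono)
    then show ?thesis
      using * nn True by (simp add: power2_eq_square algebra_simps)
  next
    case False
    define u where "u = - s"
    have u: "u > 0" using False by (simp add: u_def)
    have "exp s * (1 + u) \<le> exp s * exp u"
      using exp_ge_add_one_self[of u] by (intro mult_left_mono) simp_all
    also have "\<dots> = 1" by (simp add: u_def flip: exp_add)
    \<comment> \<open>The product equals 1 + u^3.\<close>
    also have "1 \<le> (1 - u + u\<^sup>2) * (1 + u)"
      using u by (simp add: power2_eq_square algebra_simps)
    finally have "exp s \<le> 1 - u + u\<^sup>2"
      using u by (simp add: mult_le_cancel_right)
    then have "exp s - 1 - s \<le> s\<^sup>2 * 1"
      by (simp add: u_def)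
    also have "\<dots> \<le> s\<^sup>2 * exp \<bar>s\<bar>"
      by (intro mult_left_mono) simp_all
    finally show ?thesis using nn by simp
  qed
qed

section \<open>Laplace transforms of square integrable functions\<close>

definition laplace :: "(real \<times> real \<Rightarrow> real) \<Rightarrow> real \<times> real \<Rightarrow> real" where
  "laplace f q = (\<integral>p. f p * exp (fst q * fst p + snd q * snd p) \<partial>N2)"

text \<open>Differentiation under the integral sign with a quadratic remainder. Existence is what
  matters: it makes the chain rule available along flow lines, where the value of the derivative is
  supplied by the generator.\<close>

lemma laplace_has_derivative:
  assumes f: "sq_int f"
  shows "\<exists>D. (laplace f has_derivative D) (at q)"
proof -
  note [measurable] = sq_int_measurable[OF f]
  define e where "e p = exp (fst q * fst p + snd q * snd p)" for p :: "real \<times> real"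
  have ge: "exp_growth e" unfolding e_def by (rule exp_growth_exp)
  define A where "A = (\<integral>p. f p * (e p * fst p) \<partial>N2)"
  define B where "B = (\<integral>p. f p * (e p * snd p) \<partial>N2)"
  \<comment> \<open>For an increment u with |u1| + |u2| \<le> 1 the remainder of the integrand is at
    most (|u1| + |u2|)^2 times |f| times this weight; the factor exp(|x| + |y|) comes from
    \<open>exp_remainder_le\<close>.\<close>
  define w where "w p = e p * ((\<bar>fst p\<bar> + \<bar>snd p\<bar>)\<^sup>2 * exp (\<bar>fst p\<bar> + \<bar>snd p\<bar>))" for p :: "real \<times> real"
  have gs: "exp_growth (\<lambda>p. exp (\<bar>fst p\<bar> + \<bar>snd p\<bar>))"
    by (rule exp_growthI[where C = 1 and a = 1]) simp_all
  have ga: "exp_growth (\<lambda>p. \<bar>fst p\<bar> + \<bar>snd p\<bar>)"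
  proof (rule exp_growthI[where C = 1 and a = 1])
    show "\<bar>\<bar>fst p\<bar> + \<bar>snd p\<bar>\<bar> \<le> 1 * exp (1 * (\<bar>fst p\<bar> + \<bar>snd p\<bar>))" for p :: "real \<times> real"
      using abs_le_exp_abs[of "\<bar>fst p\<bar> + \<bar>snd p\<bar>"] by simp
  qed measurable
  have gw: "exp_growth w"
    unfolding w_def by (intro exp_growth_mult exp_growth_power ge gs ga)
  have iw: "integrable N2 (\<lambda>p. \<bar>f p * w p\<bar>)"
    by (intro integrable_abs sq_int_exp_growth_integrable f gw)
  define C where "C = (\<integral>p. \<bar>f p * w p\<bar> \<partial>N2)"
  define D where "D u = fst u * A + snd u * B" for u :: "real \<times> real"
  have lin: "bounded_linear D"
    unfolding D_def by (intro bounded_linear_add bounded_linear_mult_const bounded_linear_fst bounded_linear_snd)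
  have bound: "\<bar>laplace f (q + u) - laplace f q - D u\<bar> \<le> C * (\<bar>fst u\<bar> + \<bar>snd u\<bar>)\<^sup>2"
    if u: "\<bar>fst u\<bar> + \<bar>snd u\<bar> \<le> 1" for u
  proof -
    let ?s = "\<lambda>p. fst u * fst p + snd u * snd p"
    have i1: "integrable N2 (\<lambda>p. f p * (e p * exp (?s p)))"
      by (intro sq_int_exp_growth_integrable f exp_growth_mult ge exp_growth_exp)
    have i2: "integrable N2 (\<lambda>p. f p * e p)"
      by (intro sq_int_exp_growth_integrable f ge)
    have i3: "integrable N2 (\<lambda>p. f p * (e p * fst p))" "integrable N2 (\<lambda>p. f p * (e p * snd p))"
      by (intro sq_int_exp_growth_integrable f exp_growth_mult ge exp_growth_fst exp_growth_snd)+
    have eq: "f p * (e p * exp (?s p)) - f p * e p - (fst u * (f p * (e p * fst p)) + snd u * (f p * (e p * snd p)))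
        = f p * (e p * (exp (?s p) - 1 - ?s p))" for p
      by (simp add: algebra_simps)
    have pe: "exp (fst (q + u) * fst p + snd (q + u) * snd p) = e p * exp (?s p)" for p
      by (simp add: e_def algebra_simps flip: exp_add)
    have "laplace f (q + u) - laplace f q - D u = (\<integral>p. f p * (e p * exp (?s p)) \<partial>N2) - (\<integral>p. f p * e p \<partial>N2)
        - (fst u * A + snd u * B)"
      unfolding laplace_def pe D_def by (simp only: e_def)
    also have "\<dots> = (\<integral>p. f p * (e p * (exp (?s p) - 1 - ?s p)) \<partial>N2)"
      unfolding eq [symmetric] A_def B_def using i1 i2 i3 by simp
    finally have 1: "laplace f (q + u) - laplace f q - D u = (\<integral>p. f p * (e p * (exp (?s p) - 1 - ?s p)) \<partial>N2)" .
    have pw: "\<bar>f p * (e p * (exp (?s p) - 1 - ?s p))\<bar> \<le> (\<bar>fst u\<bar> + \<bar>snd u\<bar>)\<^sup>2 * \<bar>f p * w p\<bar>" for p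
    proof -
      define n where "n = \<bar>fst p\<bar> + \<bar>snd p\<bar>"
      define m where "m = \<bar>fst u\<bar> + \<bar>snd u\<bar>"
      have nm: "0 \<le> n" "0 \<le> m" "m \<le> 1" using u by (simp_all add: n_def m_def)
      have "\<bar>?s p\<bar> \<le> \<bar>fst u\<bar> * \<bar>fst p\<bar> + \<bar>snd u\<bar> * \<bar>snd p\<bar>"
        using abs_triangle_ineq[of "fst u * fst p" "snd u * snd p"] by (simp add: abs_mult)
      also have "\<dots> \<le> m * n"
        by (simp add: m_def n_def algebra_simps)
      finally have s: "\<bar>?s p\<bar> \<le> m * n" .
      have "\<bar>?s p\<bar> \<le> n"
        using s mult_right_mono[OF nm(3,1)] by simp
      moreover have "(?s p)\<^sup>2 \<le> (m * n)\<^sup>2"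
        using s nm by (simp add: abs_le_square_iff [symmetric] abs_mult)
      ultimately have "(?s p)\<^sup>2 * exp \<bar>?s p\<bar> \<le> (m * n)\<^sup>2 * exp n"
        by (intro mult_mono) simp_all
      then have "\<bar>exp (?s p) - 1 - ?s p\<bar> \<le> m\<^sup>2 * (n\<^sup>2 * exp n)"
        using exp_remainder_le[of "?s p"] by (simp add: power_mult_distrib)
      then have "\<bar>f p\<bar> * e p * \<bar>exp (?s p) - 1 - ?s p\<bar> \<le> \<bar>f p\<bar> * e p * (m\<^sup>2 * (n\<^sup>2 * exp n))"
        by (intro mult_left_mono) (simp_all add: e_def)
      moreover have "\<bar>f p * w p\<bar> = \<bar>f p\<bar> * (e p * (n\<^sup>2 * exp n))"
        by (simp add: w_def n_def e_def abs_mult)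
      moreover have "\<bar>f p * (e p * (exp (?s p) - 1 - ?s p))\<bar> = \<bar>f p\<bar> * e p * \<bar>exp (?s p) - 1 - ?s p\<bar>"
        by (simp add: abs_mult e_def)
      ultimately show ?thesis
        unfolding m_def [symmetric] by (simp add: mult_ac)
    qed
    have "\<bar>laplace f (q + u) - laplace f q - D u\<bar> \<le> (\<integral>p. \<bar>f p * (e p * (exp (?s p) - 1 - ?s p))\<bar> \<partial>N2)"
      unfolding 1 by (rule integral_abs_bound)
    also have "\<dots> \<le> (\<integral>p. (\<bar>fst u\<bar> + \<bar>snd u\<bar>)\<^sup>2 * \<bar>f p * w p\<bar> \<partial>N2)"
      by (intro integral_mono' integrable_mult_right iw pw) simp
    finally show ?thesis
      by (simp add: C_def mult.commute)
  qed
  have C0: "C \<ge> 0"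
    unfolding C_def by (intro Bochner_Integration.integral_nonneg) simp
  have "(laplace f has_derivative D) (at q)"
    unfolding has_derivative_iff_norm
  proof (intro conjI lin)
    have "((\<lambda>y. norm (laplace f y - laplace f q - D (y - q)) / norm (y - q)) \<longlongrightarrow> 0) (at q)"
    \<comment> \<open>The sum of the absolute coordinates is at most twice the norm: squaring gives
      the 4, and the radius 1/2 brings the increment into the range of \<open>bound\<close>.\<close>
    proof (rule tendsto_sandwich[where f = "\<lambda>_. 0" and h = "\<lambda>y. C * 4 * norm (y - q)"])
      have "((\<lambda>y. C * 4 * norm (y - q)) \<longlongrightarrow> C * 4 * norm (q - q)) (at q)"
        by (intro tendsto_intros)
      then show "((\<lambda>y. C * 4 * norm (y - q)) \<longlongrightarrow> 0) (at q)" by simp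
      have "\<forall>\<^sub>F y in at q. dist y q < 1 / 2"
        by (rule eventually_at_ball'[of "1/2" q UNIV, THEN eventually_mono]) (auto simp: dist_commute)
      then show "\<forall>\<^sub>F y in at q. norm (laplace f y - laplace f q - D (y - q)) / norm (y - q) \<le> C * 4 * norm (y - q)"
      proof eventually_elim
        case (elim y)
        define u where "u = y - q"
        have n: "\<bar>fst u\<bar> + \<bar>snd u\<bar> \<le> 2 * norm u"
          using norm_fst_le[of "fst u" "snd u"] norm_snd_le[of "snd u" "fst u"] by simp
        then have "\<bar>fst u\<bar> + \<bar>snd u\<bar> \<le> 1"
          using elim by (simp add: dist_norm u_def)
        then have "\<bar>laplace f (q + u) - laplace f q - D u\<bar> \<le> C * (\<bar>fst u\<bar> + \<bar>snd u\<bar>)\<^sup>2"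
          by (rule bound)
        also have "\<dots> \<le> C * (2 * norm u)\<^sup>2"
          using n C0 by (intro mult_left_mono power_mono) simp_all
        finally have "\<bar>laplace f y - laplace f q - D (y - q)\<bar> \<le> C * 4 * norm (y - q) * norm (y - q)"
          by (simp add: u_def power2_eq_square mult_ac)
        then show ?case
          by (cases "y = q") (simp_all add: divide_le_eq)
      qed
    qed simp_all
    then show "((\<lambda>y. norm (laplace f y - laplace f q - D (y - q)) / norm (y - q)) \<longlongrightarrow> 0) (at q within UNIV)"
      by simp
  qed
  then show ?thesis by blast
qed

section \<open>Eigenfunctions\<close>

text \<open>A form of degree m in (h, k); divided by m! it is the homogeneous term of degree m of
  the Laplace transform at 0.\<close>

definition dmoment :: "(real \<times> real \<Rightarrow> real) \<Rightarrow> nat \<Rightarrow> real \<Rightarrow> real \<Rightarrow> real" where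
  "dmoment f m h k = (\<integral>p. f p * (h * fst p + k * snd p) ^ m \<partial>N2)"

lemma laplace_sums:
  assumes f: "sq_int f"
  shows "(\<lambda>m. s ^ m / fact m * dmoment f m h k) sums laplace f (s * h, s * k)"
proof -
  note [measurable] = sq_int_measurable[OF f]
  have "(\<lambda>m. s ^ m / fact m * dmoment f m h k) sums (\<integral>p. f p * exp (s * (h * fst p + k * snd p)) \<partial>N2)"
    unfolding dmoment_def
    by (rule exp_moment_sums_real)
      (auto intro!: sq_int_exp_growth_integrable[OF f] exp_growth_exp_abs)
  moreover have "s * (h * fst p + k * snd p) = fst (s * h, s * k) * fst p + snd (s * h, s * k) * snd p" for p
    by (simp add: algebra_simps)
  ultimately show ?thesis
    by (simp only: laplace_def)
qed

text \<open>Once the lower terms vanish, the quotient is again a power series in s, and its value at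
  0 is the leading coefficient. Identities between Laplace transforms thereby pass to homogeneous
  terms.\<close>

lemma laplace_limit:
  assumes f: "sq_int f" and zero: "\<And>i. i < m \<Longrightarrow> dmoment f i h k = 0"
  shows "((\<lambda>s. laplace f (s * h, s * k) / s ^ m) \<longlongrightarrow> dmoment f m h k / fact m) (at 0)"
proof -
  define a where "a i = dmoment f (i + m) h k / fact (i + m)" for i
  have S: "(\<lambda>i. a i * s ^ i) sums (laplace f (s * h, s * k) / s ^ m)" if "s \<noteq> 0" for s
  proof -
    have "(\<lambda>i. s ^ (i + m) / fact (i + m) * dmoment f (i + m) h k) sums laplace f (s * h, s * k)"
      using laplace_sums[OF f, of s h k] zero by (subst sums_iff_shift) simp
    then have "(\<lambda>i. s ^ (i + m) / fact (i + m) * dmoment f (i + m) h k / s ^ m) sums (laplace f (s * h, s * k) / s ^ m)"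
      by (rule sums_divide)
    moreover have "s ^ (i + m) / fact (i + m) * dmoment f (i + m) h k / s ^ m = a i * s ^ i" for i
      using that by (simp add: a_def power_add)
    ultimately show ?thesis by simp
  qed
  have "((\<lambda>s. laplace f (s * h, s * k) / s ^ m) \<longlongrightarrow> a 0) (at 0)"
    by (rule powser_limit_0_strong[where s = 1 and a = a]) (use S in auto)
  then show ?thesis by (simp add: a_def)
qed

lemma dmoment_scale: "dmoment f m (a * h) (a * k) = a ^ m * dmoment f m h k"
proof -
  have "f p * (a * h * fst p + a * k * snd p) ^ m = a ^ m * (f p * (h * fst p + k * snd p) ^ m)" for p
  proof -
    have "a * h * fst p + a * k * snd p = a * (h * fst p + k * snd p)"
      by (simp add: algebra_simps)
    then show ?thesis by (simp add: power_mult_distrib)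
  qed
  then show ?thesis
    by (simp only: dmoment_def integral_mult_right_zero)
qed

lemma dmoment_expand:
  assumes f: "sq_int f"
  shows "dmoment f m h k = (\<Sum>i\<le>m. real (m choose i) * (\<integral>p. f p * fst p ^ i * snd p ^ (m - i) \<partial>N2) * h ^ i * k ^ (m - i))"
proof -
  have i: "integrable N2 (\<lambda>p. f p * fst p ^ i * snd p ^ j)" for i j
    unfolding mult.assoc
    by (intro sq_int_exp_growth_integrable f exp_growth_mult exp_growth_power exp_growth_fst exp_growth_snd)
  have "f p * (h * fst p + k * snd p) ^ m =
      (\<Sum>i\<le>m. (real (m choose i) * h ^ i * k ^ (m - i)) * (f p * fst p ^ i * snd p ^ (m - i)))" for p
    by (simp add: binomial_ring sum_distrib_left power_mult_distrib mult_ac)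
  moreover have "(\<integral>p. (\<Sum>i\<le>m. (real (m choose i) * h ^ i * k ^ (m - i)) * (f p * fst p ^ i * snd p ^ (m - i))) \<partial>N2)
      = (\<Sum>i\<le>m. \<integral>p. (real (m choose i) * h ^ i * k ^ (m - i)) * (f p * fst p ^ i * snd p ^ (m - i)) \<partial>N2)"
    by (intro Bochner_Integration.integral_sum integrable_mult_right i)
  ultimately have "dmoment f m h k = (\<Sum>i\<le>m. (real (m choose i) * h ^ i * k ^ (m - i)) * (\<integral>p. f p * fst p ^ i * snd p ^ (m - i) \<partial>N2))"
    by (simp only: dmoment_def integral_mult_right_zero)
  then show ?thesis
    by (simp add: mult_ac)
qed

text \<open>A translation of the variable preserves the leading coefficient, whereas multiplication
  by l \<noteq> 1 changes it unless it is 0.\<close>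

lemma poly_shift_eq_zero:
  fixes p :: "real poly"
  assumes "\<And>x. poly p (x + r) = l * poly p x" "l \<noteq> 1"
  shows "p = 0"
proof -
  have "pcompose p [:r, 1:] = smult l p"
    using assms(1) by (intro poly_ext) (simp add: poly_pcompose add.commute)
  then have eq: "lead_coeff (smult l p) = lead_coeff (pcompose p [:r, 1:])" by simp
  moreover have "lead_coeff (pcompose p [:r, 1:]) = lead_coeff p"
    by (subst lead_coeff_comp) simp_all
  ultimately have "(l - 1) * lead_coeff p = 0"
    unfolding lead_coeff_smult left_diff_distrib mult_1_left by simp
  then show ?thesis
    using assms(2) by simp
qed

text \<open>
  If all moments of degree less than \<open>m\<close> vanish, then the term of degree \<open>m\<close> of the Laplace
  transform is itself invariant. On the line \<open>k = 1\<close> it is a polynomial \<open>P\<close> with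
  \<open>P (x + r t) = exp ((m - n) c t) P x\<close>, so \<open>P = 0\<close> for \<open>m \<noteq> n\<close>, whereas for \<open>m = n\<close> it is constant.
\<close>

lemma flow_invariant_imp_zero:
  assumes f: "sq_int f" and c: "c > 0" and r: "r > 0"
    and flow: "\<And>t h k. exp (- ((exp (- c * t) * (h + r * t * k))\<^sup>2 + (exp (- c * t) * k)\<^sup>2) / 2) *
        laplace f (exp (- c * t) * (h + r * t * k), exp (- c * t) * k) =
        exp (- (real n * c) * t) * (exp (- (h\<^sup>2 + k\<^sup>2) / 2) * laplace f (h, k))"
    and zero: "(\<integral>p. f p * snd p ^ n \<partial>N2) = 0"
  shows "AE p in N2. f p = 0"
proof -
  define mm where "mm i j = (\<integral>p. f p * fst p ^ i * snd p ^ j \<partial>N2)" for i j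
  have main: "(\<forall>h k. dmoment f m h k = 0) \<and> (\<forall>i\<le>m. mm i (m - i) = 0)" for m
  proof (induction m rule: less_induct)
    case (less m)
    \<comment> \<open>The Gaussian factor is 1 at s = 0, so it does not affect the lowest
      term.\<close>
    have lim: "((\<lambda>s. exp (- ((s * h)\<^sup>2 + (s * k)\<^sup>2) / 2) * laplace f (s * h, s * k) / s ^ m) \<longlongrightarrow> dmoment f m h k / fact m) (at 0)"
      for h k
    proof -
      have "((\<lambda>s. exp (- ((s * h)\<^sup>2 + (s * k)\<^sup>2) / 2) * (laplace f (s * h, s * k) / s ^ m)) \<longlongrightarrow>
          exp (- ((0 * h)\<^sup>2 + (0 * k)\<^sup>2) / 2) * (dmoment f m h k / fact m)) (at 0)"
        using less(1) by (intro tendsto_intros laplace_limit f) auto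
      then show ?thesis by simp
    qed
    have inv: "dmoment f m (exp (- c * t) * (h + r * t * k)) (exp (- c * t) * k) = exp (- (real n * c) * t) * dmoment f m h k"
      for t h k
    proof -
      let ?h = "exp (- c * t) * (h + r * t * k)" and ?k = "exp (- c * t) * k"
      have "exp (- ((s * ?h)\<^sup>2 + (s * ?k)\<^sup>2) / 2) * laplace f (s * ?h, s * ?k) / s ^ m =
          exp (- (real n * c) * t) * (exp (- ((s * h)\<^sup>2 + (s * k)\<^sup>2) / 2) * laplace f (s * h, s * k) / s ^ m)" for s
      proof -
        have e: "exp (- c * t) * (s * h + r * t * (s * k)) = s * ?h" "exp (- c * t) * (s * k) = s * ?k"
          by (simp_all add: algebra_simps)
        show ?thesis
          using flow[of t "s * h" "s * k"] unfolding e by simp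
      qed
      then have "((\<lambda>s. exp (- (real n * c) * t) * (exp (- ((s * h)\<^sup>2 + (s * k)\<^sup>2) / 2) * laplace f (s * h, s * k) / s ^ m))
          \<longlongrightarrow> dmoment f m ?h ?k / fact m) (at 0)"
        using lim[of ?h ?k] by (simp only:)
      moreover have "((\<lambda>s. exp (- (real n * c) * t) * (exp (- ((s * h)\<^sup>2 + (s * k)\<^sup>2) / 2) * laplace f (s * h, s * k) / s ^ m))
          \<longlongrightarrow> exp (- (real n * c) * t) * (dmoment f m h k / fact m)) (at 0)"
        by (intro tendsto_mult_left lim)
      ultimately have "dmoment f m ?h ?k / fact m = exp (- (real n * c) * t) * (dmoment f m h k / fact m)"
        by (rule LIM_unique)
      then show ?thesis by simp
    qed
    define P where "P = (\<Sum>i\<le>m. monom (real (m choose i) * mm i (m - i)) i)"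
    have P: "poly P x = dmoment f m x 1" for x
      unfolding P_def dmoment_expand[OF f] mm_def by (simp add: poly_sum poly_monom)
    have shift: "poly P (x + r * t) = exp ((real m - real n) * c * t) * poly P x" for x t
    proof -
      have "exp (- c * t) ^ m * dmoment f m (x + r * t) 1 = exp (- (real n * c) * t) * dmoment f m x 1"
        using inv[of t x 1] dmoment_scale[of f m "exp (- c * t)" "x + r * t" 1] by simp
      moreover have "exp (- c * t) ^ m = exp (- (real m * c) * t)"
        by (simp flip: exp_of_nat_mult)
      ultimately have "exp (real m * c * t) * (exp (- (real m * c) * t) * dmoment f m (x + r * t) 1) =
          exp (real m * c * t) * (exp (- (real n * c) * t) * dmoment f m x 1)"
        by simp
      then show ?thesis
        unfolding P mult.assoc[symmetric] exp_add[symmetric] by (simp add: algebra_simps)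
    qed
    have "P = 0"
    proof (cases "m = n")
      case True
      \<comment> \<open>Now the exponential factor in \<open>shift\<close> is 1 and P is constant; P
        0 is the moment of \<open>snd p ^ n\<close>, zero by assumption. Shifts of either sign are
        available because t is any real number.\<close>
      have "poly P 0 = 0"
        using zero by (simp add: P dmoment_def True)
      then have "poly P x = 0" for x
        using shift[of 0 "x / r"] r by simp
      then show ?thesis
        using poly_all_0_iff_0 by blast
    next
      case False
      then have "exp ((real m - real n) * c * 1) \<noteq> 1"
        using c by simp
      with shift[of _ 1] show ?thesis
        by (intro poly_shift_eq_zero[of P r]) auto
    qed
    have mz: "\<forall>i\<le>m. mm i (m - i) = 0"
    proof (intro allI impI)
      fix i assume i: "i \<le> m"
      then have "coeff P i = real (m choose i) * mm i (m - i)"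
        unfolding P_def coeff_sum coeff_monom by (simp add: sum.delta)
      then show "mm i (m - i) = 0"
        using \<open>P = 0\<close> i by simp
    qed
    have "dmoment f m h k = (\<Sum>i\<le>m. real (m choose i) * mm i (m - i) * h ^ i * k ^ (m - i))" for h k
      unfolding mm_def by (rule dmoment_expand[OF f])
    with mz have "\<forall>h k. dmoment f m h k = 0"
      by simp
    then show ?case using mz by (rule conjI)
  qed
  have "mm i j = 0" for i j
    using main[of "i + j", THEN conjunct2, rule_format, of i] by simp
  then show ?thesis
    by (intro mixed_moments_zero_imp_AE[OF f]) (simp add: mm_def)
qed

section \<open>Translated means of an eigenfunction along the flow\<close>

context ou_process
begin

lemma Phi_laplace:
  "Phi f h k = exp (- (h\<^sup>2 + k\<^sup>2) / 2) * laplace (\<lambda>p. f (L p)) (h, k)"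
proof -
  have "(case p of (x, y) \<Rightarrow> exp (h * x + k * y - (h\<^sup>2 + k\<^sup>2) / 2) * f (L (x, y))) =
      exp (- (h\<^sup>2 + k\<^sup>2) / 2) * (f (L p) * exp (h * fst p + k * snd p))" for p
  proof -
    have "exp (u - s / 2) = exp (- s / 2) * exp u" for u s :: real
      by (simp flip: exp_add)
    then show ?thesis by (simp only: split_beta prod.collapse mult_ac)
  qed
  then show ?thesis
    unfolding Phi_def laplace_def fst_conv snd_conv integral_mult_right_zero [symmetric]
    by (intro arg_cong[where f = "integral\<^sup>L N2"] ext)
qed

lemma Phi_cong:
  assumes "f \<in> borel_measurable borel" "g \<in> borel_measurable borel" "AE z in lborel. f z = g z"
  shows "Phi f h k = Phi g h k"
proof -
  note [measurable] = assms(1,2)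
  have "AE p in N2. f (L p) = g (L p)"
    by (rule AE_N2_L[OF assms(3)]) simp
  then show ?thesis
    unfolding Phi_def by (intro integral_cong_AE) (auto simp: split_beta')
qed

text \<open>Cauchy-Schwarz, with K the squared norm of the Cameron-Martin weight. K is the same for
  all G, which lets \<open>Phi\<close> pass through limits in L^2.\<close>

lemma Phi_bound:
  "\<exists>K. \<forall>G. ennreal ((Phi (rep_aefun G) h k)\<^sup>2) \<le> ennreal K * L2_normsq \<mu> G"
proof -
  define w where "w = (\<lambda>(x, y). exp (h * x + k * y - (h\<^sup>2 + k\<^sup>2) / 2))"
  have gw: "exp_growth w" unfolding w_def by (rule exp_growth_shift_density)
  note [measurable] = exp_growth_measurable[OF gw]
  define K where "K = (\<integral>p. (w p)\<^sup>2 \<partial>N2)"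
  have K: "(\<integral>\<^sup>+p. ennreal ((w p)\<^sup>2) \<partial>N2) = ennreal K"
    unfolding K_def by (intro nn_integral_eq_integral exp_growth_integrable exp_growth_power gw) simp
  have "ennreal ((Phi (rep_aefun G) h k)\<^sup>2) \<le> ennreal K * L2_normsq \<mu> G" for G
  proof -
    let ?g = "\<lambda>p. rep_aefun G (L p)"
    have Phi: "Phi (rep_aefun G) h k = (\<integral>p. w p * ?g p \<partial>N2)"
      by (simp add: Phi_def w_def split_beta')
    have "ennreal \<bar>\<integral>p. w p * ?g p \<partial>N2\<bar> \<le> (\<integral>\<^sup>+p. ennreal \<bar>w p\<bar> * ennreal \<bar>?g p\<bar> \<partial>N2)"
    proof (cases "integrable N2 (\<lambda>p. w p * ?g p)")
      case True
      from integral_norm_bound_ennreal[OF this] show ?thesis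
        by (simp add: abs_mult ennreal_mult)
    qed (simp add: not_integrable_integral_eq)
    then have "(ennreal \<bar>\<integral>p. w p * ?g p \<partial>N2\<bar>)\<^sup>2 \<le> (\<integral>\<^sup>+p. ennreal \<bar>w p\<bar> * ennreal \<bar>?g p\<bar> \<partial>N2)\<^sup>2"
      by (intro power_mono) simp_all
    also have "\<dots> \<le> (\<integral>\<^sup>+p. (ennreal \<bar>w p\<bar>)\<^sup>2 \<partial>N2) * (\<integral>\<^sup>+p. (ennreal \<bar>?g p\<bar>)\<^sup>2 \<partial>N2)"
      by (rule Cauchy_Schwarz_nn_integral) simp_all
    also have "\<dots> = ennreal K * L2_normsq \<mu> G"
      unfolding L2_normsq_eq K [symmetric] by (simp add: ennreal_power)
    finally show ?thesis
      unfolding Phi by (simp add: ennreal_power)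
  qed
  then show ?thesis by blast
qed

text \<open>The continuous functional \<open>Phi\<close> is applied to the limit that defines the
  generator, and \<open>Phi_semigroup\<close> turns T(t)F into a moved argument. The result is a
  one-sided derivative at t = 0.\<close>

lemma Phi_gen_graph:
  assumes "ou_gen_graph c \<sigma> \<mu> F (\<gamma> *\<^sub>R F)"
  shows "((\<lambda>t. (Phi (rep_aefun F) (exp (- c * t) * (h + Ld / La * t * k)) (exp (- c * t) * k) - Phi (rep_aefun F) h k) / t)
    \<longlongrightarrow> \<gamma> * Phi (rep_aefun F) h k) (at_right 0)"
proof -
  let ?f = "rep_aefun F"
  define D where "D t = (1 / t) *\<^sub>R (ou_T2 c \<sigma> t F - F) - \<gamma> *\<^sub>R F" for t
  have lim: "((\<lambda>t. L2_normsq \<mu> (D t)) \<longlongrightarrow> 0) (at_right 0)" and F: "F \<in> L2 \<mu>"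
    using assms by (simp_all add: ou_gen_graph_def D_def)
  have sq: "sq_int (\<lambda>p. ?f (L p))" using F by (simp add: L2_iff)
  obtain K where K: "\<And>G. ennreal ((Phi (rep_aefun G) h k)\<^sup>2) \<le> ennreal K * L2_normsq \<mu> G"
    using Phi_bound[of h k] by blast
  have "((\<lambda>t. ennreal K * L2_normsq \<mu> (D t)) \<longlongrightarrow> ennreal K * 0) (at_right 0)"
    by (intro ennreal_tendsto_cmult lim) simp
  then have l2: "((\<lambda>t. ennreal K * L2_normsq \<mu> (D t)) \<longlongrightarrow> 0) (at_right 0)" by simp
  have "((\<lambda>t. ennreal ((Phi (rep_aefun (D t)) h k)\<^sup>2)) \<longlongrightarrow> ennreal 0) (at_right 0)"
    unfolding ennreal_0 by (rule tendsto_sandwich[OF _ _ tendsto_const l2]) (simp_all add: K)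
  then have "((\<lambda>t. (Phi (rep_aefun (D t)) h k)\<^sup>2) \<longlongrightarrow> 0) (at_right 0)"
    by (subst (asm) tendsto_ennreal_iff) simp_all
  then have "((\<lambda>t. sqrt ((Phi (rep_aefun (D t)) h k)\<^sup>2)) \<longlongrightarrow> sqrt 0) (at_right 0)"
    by (rule tendsto_real_sqrt)
  then have "((\<lambda>t. Phi (rep_aefun (D t)) h k) \<longlongrightarrow> 0) (at_right 0)"
    by (simp add: tendsto_rabs_zero_iff)
  then have "((\<lambda>t. Phi (rep_aefun (D t)) h k + \<gamma> * Phi ?f h k) \<longlongrightarrow> 0 + \<gamma> * Phi ?f h k) (at_right 0)"
    by (intro tendsto_add tendsto_const)
  then have main: "((\<lambda>t. Phi (rep_aefun (D t)) h k + \<gamma> * Phi ?f h k) \<longlongrightarrow> \<gamma> * Phi ?f h k) (at_right 0)"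
    by simp
  have "Phi (rep_aefun (D t)) h k + \<gamma> * Phi ?f h k =
     (Phi ?f (exp (- c * t) * (h + Ld / La * t * k)) (exp (- c * t) * k) - Phi ?f h k) / t" if t: "t > 0" for t
  proof -
    let ?S = "ou_semigroup c \<sigma> t ?f"
    let ?w = "\<lambda>p. exp (h * fst p + k * snd p - (h\<^sup>2 + k\<^sup>2) / 2)"
    have [measurable]: "?S \<in> borel_measurable borel"
      by (rule semigroup_measurable[OF t]) simp
    have "D t = ae_class (\<lambda>z. (1 / t) * (?S z - ?f z) - \<gamma> * ?f z)"
      using ae_class_minus[of ?S ?f] ae_class_scaleR[of ?f \<gamma>]
        ae_class_scaleR[of "\<lambda>z. ?S z - ?f z" "1 / t"] ae_class_minus[of "\<lambda>z. (1 / t) * (?S z - ?f z)" "\<lambda>z. \<gamma> * ?f z"]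
      by (simp add: D_def ou_T2_def ae_class_rep)
    then have "Phi (rep_aefun (D t)) h k = Phi (\<lambda>z. (1 / t) * (?S z - ?f z) - \<gamma> * ?f z) h k"
      by (simp only:) (rule Phi_cong, simp_all add: rep_ae_class)
    also have "\<dots> = (\<integral>p. (1 / t) * (?w p * ?S (L p) - ?w p * ?f (L p)) - \<gamma> * (?w p * ?f (L p)) \<partial>N2)"
      unfolding Phi_def by (intro Bochner_Integration.integral_cong) (auto simp: algebra_simps)
    also have "\<dots> = (1 / t) * ((\<integral>p. ?w p * ?S (L p) \<partial>N2) - (\<integral>p. ?w p * ?f (L p) \<partial>N2)) - \<gamma> * (\<integral>p. ?w p * ?f (L p) \<partial>N2)"
      using Phi_semigroup(1)[OF t _ sq, of h k] Phi_integrable[OF sq, of h k]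
      by (simp add: split_beta')
    also have "\<dots> = (1 / t) * (Phi ?S h k - Phi ?f h k) - \<gamma> * Phi ?f h k"
      by (simp add: Phi_def split_beta')
    finally show ?thesis
      by (simp add: Phi_semigroup(2)[OF t _ sq])
  qed
  then have "\<forall>\<^sub>F t in at_right 0. Phi (rep_aefun (D t)) h k + \<gamma> * Phi ?f h k =
     (Phi ?f (exp (- c * t) * (h + Ld / La * t * k)) (exp (- c * t) * k) - Phi ?f h k) / t"
    using eventually_at_right_less by (rule eventually_mono[rotated])
  with main show ?thesis
    by (rule Lim_transform_eventually)
qed

text \<open>Along the flow line y' = gamma y: the flow property moves the one-sided derivative from
  0 to every s, and differentiability of the Laplace transform makes it the full derivative. The
  formula thus covers negative t as well.\<close>

lemma Phi_eigen:
  assumes "ou_gen_graph c \<sigma> \<mu> F (\<gamma> *\<^sub>R F)"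
  shows "Phi (rep_aefun F) (exp (- c * t) * (h + Ld / La * t * k)) (exp (- c * t) * k) =
    exp (\<gamma> * t) * Phi (rep_aefun F) h k"
proof -
  let ?f = "rep_aefun F"
  define H where "H s = exp (- c * s) * (h + Ld / La * s * k)" for s
  define K where "K s = exp (- c * s) * k" for s
  define y where "y s = Phi ?f (H s) (K s)" for s
  have sq: "sq_int (\<lambda>p. ?f (L p))" using assms by (simp add: ou_gen_graph_def L2_iff)
  have der: "(y has_real_derivative \<gamma> * y s) (at s)" for s
  proof -
    define e where "e = exp (- c * s)"
    have ex: "((\<lambda>s. exp (- c * s)) has_real_derivative e * (- c)) (at s)"
      unfolding e_def by (rule DERIV_fun_exp[OF DERIV_cmult_Id])
    have lin: "((\<lambda>s. h + q * s * k) has_real_derivative q * k) (at s)" for q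
      by (auto intro!: derivative_eq_intros)
    obtain H' K' where HK: "(H has_real_derivative H') (at s)" "(K has_real_derivative K') (at s)"
      unfolding H_def K_def using DERIV_mult[OF ex lin[of "Ld / La"]] DERIV_cmult_right[OF ex] by blast
    obtain D where D: "(laplace (\<lambda>p. ?f (L p)) has_derivative D) (at (H s, K s))"
      using laplace_has_derivative[OF sq] by blast
    have "((\<lambda>s. (H s, K s)) has_derivative (\<lambda>x. (H' * x, K' * x))) (at s)"
      using HK by (intro has_derivative_Pair) (simp_all add: has_field_derivative_def)
    from has_derivative_compose[OF this D]
    have "(\<lambda>s. laplace (\<lambda>p. ?f (L p)) (H s, K s)) differentiable (at s)"
      unfolding differentiable_def by blast
    moreover have "(\<lambda>s. exp (- ((H s)\<^sup>2 + (K s)\<^sup>2) / 2)) differentiable (at s)"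
      using DERIV_fun_exp[OF DERIV_cdivide[OF DERIV_minus[OF DERIV_add[OF
        DERIV_power[OF HK(1)] DERIV_power[OF HK(2)]]]]]
      unfolding real_differentiable_def by blast
    ultimately have "y differentiable (at s)"
      unfolding y_def Phi_laplace by (intro differentiable_mult)
    then obtain y' where y': "(y has_real_derivative y') (at s)"
      by (auto simp: real_differentiable_def)
    have "((\<lambda>t. (y (s + t) - y s) / t) \<longlongrightarrow> y') (at_right 0)"
      using y' by (auto simp: DERIV_def intro: tendsto_mono[OF at_within_le_at])
    moreover have "((\<lambda>t. (y (s + t) - y s) / t) \<longlongrightarrow> \<gamma> * y s) (at_right 0)"
    proof -
      have "exp (- c * t) * (H s + Ld / La * t * K s) = H (s + t)" "exp (- c * t) * K s = K (s + t)" for t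
      proof -
        have ee: "exp (- c * (s + t)) = exp (- c * t) * exp (- c * s)"
          by (simp add: algebra_simps flip: exp_add)
        show "exp (- c * t) * (H s + Ld / La * t * K s) = H (s + t)" "exp (- c * t) * K s = K (s + t)"
          unfolding H_def K_def ee by (simp_all only: distrib_left distrib_right mult_ac add_ac)
      qed
      then show ?thesis
        using Phi_gen_graph[OF assms, of "H s" "K s"] by (simp add: y_def)
    qed
    ultimately have "y' = \<gamma> * y s"
      by (rule tendsto_unique[rotated]) simp
    then show ?thesis using y' by simp
  qed
  have "((\<lambda>s. y s * exp (- \<gamma> * s)) has_real_derivative 0) (at s)" for s
    by (rule DERIV_cong[OF DERIV_mult[OF der DERIV_fun_exp[OF DERIV_cmult_Id]]]) simp
  then have "y t * exp (- \<gamma> * t) = y 0 * exp (- \<gamma> * 0)"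
    by (rule DERIV_isconst_all[rule_format])
  then have "y t = exp (\<gamma> * t) * y 0"
    by (simp add: exp_minus field_simps)
  then show ?thesis
    by (simp add: y_def H_def K_def)
qed

lemma eigen_zero:
  assumes g: "ou_gen_graph c \<sigma> \<mu> F ((- real n * c) *\<^sub>R F)"
    and zero: "(\<integral>p. rep_aefun F (L p) * snd p ^ n \<partial>N2) = 0"
  shows "F = 0"
proof -
  have sq: "sq_int (\<lambda>p. rep_aefun F (L p))" using g by (simp add: ou_gen_graph_def L2_iff)
  have "AE p in N2. rep_aefun F (L p) = 0"
  proof (rule flow_invariant_imp_zero[OF sq c_pos, where r = "Ld / La" and n = n])
    show "0 < Ld / La" using L_pos by simp
    show "exp (- ((exp (- c * t) * (h + Ld / La * t * k))\<^sup>2 + (exp (- c * t) * k)\<^sup>2) / 2) *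
        laplace (\<lambda>p. rep_aefun F (L p)) (exp (- c * t) * (h + Ld / La * t * k), exp (- c * t) * k) =
        exp (- (real n * c) * t) * (exp (- (h\<^sup>2 + k\<^sup>2) / 2) * laplace (\<lambda>p. rep_aefun F (L p)) (h, k))" for t h k
      using Phi_eigen[OF g, of t h k] unfolding Phi_laplace by simp
  qed (rule zero)
  then have "L2_normsq \<mu> F = 0"
    unfolding L2_normsq_eq by (subst nn_integral_0_iff_AE) auto
  then show ?thesis by (rule L2_normsq_eq_0)
qed

text \<open>By \<open>eigen_zero\<close> the moment against \<open>snd p ^ n\<close> is injective on
  the eigenspace, which is therefore at most one-dimensional; a is chosen so that this moment of F -
  a R_n vanishes.\<close>

lemma eigenspace:
  assumes g: "ou_gen_graph c \<sigma> \<mu> F ((- real n * c) *\<^sub>R F)"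
  shows "\<exists>a. F = a *\<^sub>R chain n n"
proof -
  define l where "l G = (\<integral>p. rep_aefun G (L p) * snd p ^ n \<partial>N2)" for G
  have gR: "ou_gen_graph c \<sigma> \<mu> (chain n n) ((- real n * c) *\<^sub>R chain n n)"
    using gen_graph_chain[of n n] by (simp add: chain_eq_0)
  then have lR: "l (chain n n) \<noteq> 0"
    using eigen_zero[OF gR] chain_neq_0 by (auto simp: l_def)
  define a where "a = l F / l (chain n n)"
  have g': "ou_gen_graph c \<sigma> \<mu> (F + (- a) *\<^sub>R chain n n) ((- real n * c) *\<^sub>R (F + (- a) *\<^sub>R chain n n))"
    using gen_graph_add_scaleR[OF g gR, of "- a"] by (simp add: algebra_simps)
  have F: "F \<in> L2 \<mu>" using g by (simp add: ou_gen_graph_def)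
  have i: "integrable N2 (\<lambda>p. rep_aefun G (L p) * snd p ^ n)" if "G \<in> L2 \<mu>" for G
    using that by (intro sq_int_exp_growth_integrable exp_growth_power exp_growth_snd) (simp add: L2_iff)
  have ae: "AE p in N2. rep_aefun (F + (- a) *\<^sub>R chain n n) (L p) = rep_aefun F (L p) + (- a) * rep_aefun (chain n n) (L p)"
    unfolding add_scaleR_eq_ae_class by (rule AE_N2_L[OF rep_ae_class]) simp_all
  have "l (F + (- a) *\<^sub>R chain n n) = (\<integral>p. rep_aefun F (L p) * snd p ^ n + (- a) * (rep_aefun (chain n n) (L p) * snd p ^ n) \<partial>N2)"
    unfolding l_def
  proof (rule integral_cong_AE)
    show "AE p in N2. rep_aefun (F + (- a) *\<^sub>R chain n n) (L p) * snd p ^ n =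
        rep_aefun F (L p) * snd p ^ n + (- a) * (rep_aefun (chain n n) (L p) * snd p ^ n)"
      using ae by eventually_elim (simp only: distrib_right mult.assoc)
  qed measurable
  also have "\<dots> = l F + (- a) * l (chain n n)"
    unfolding l_def using i[OF F] i[OF chain_L2] by simp
  also have "\<dots> = 0"
    using lR by (simp add: a_def)
  finally have "F + (- a) *\<^sub>R chain n n = 0"
    using eigen_zero[OF g'] by (simp add: l_def)
  then show ?thesis
    by (auto simp: add_eq_0_iff intro!: exI[of _ a])
qed

end

section \<open>The spectral subspace\<close>

context ou_process
begin

text \<open>Linearity of the graph, applied to an element minus itself.\<close>

lemma gen_graph_0: "ou_gen_graph c \<sigma> \<mu> 0 0"
proof -
  have "ou_gen_graph c \<sigma> \<mu> (chain 0 0 + (- 1) *\<^sub>R chain 0 0)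
      ((chain 0 1 + (- real 0 * c) *\<^sub>R chain 0 0) + (- 1) *\<^sub>R (chain 0 1 + (- real 0 * c) *\<^sub>R chain 0 0))"
    using gen_graph_add_scaleR[OF gen_graph_chain[of 0 0] gen_graph_chain[of 0 0], of "- 1"] by simp
  then show ?thesis by simp
qed

definition eigval :: "nat \<Rightarrow> real" where
  "eigval n = - real n * c"

definition gamma_minus_A2 :: "nat \<Rightarrow> aefun \<Rightarrow> aefun" where
  "gamma_minus_A2 n F = eigval n *\<^sub>R F - ou_A2 c \<sigma> \<mu> F"

lemma domain_gen_graph: "F \<in> ou_domain c \<sigma> \<mu> \<Longrightarrow> ou_gen_graph c \<sigma> \<mu> F (ou_A2 c \<sigma> \<mu> F)"
  unfolding ou_domain_def using A2_eq by force

lemma gamma_minus_A2_add_scaleR: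
  assumes "F \<in> ou_domain c \<sigma> \<mu>" "G \<in> ou_domain c \<sigma> \<mu>"
  shows "F + a *\<^sub>R G \<in> ou_domain c \<sigma> \<mu>" "gamma_minus_A2 n (F + a *\<^sub>R G) = gamma_minus_A2 n F + a *\<^sub>R gamma_minus_A2 n G"
proof -
  have g: "ou_gen_graph c \<sigma> \<mu> (F + a *\<^sub>R G) (ou_A2 c \<sigma> \<mu> F + a *\<^sub>R ou_A2 c \<sigma> \<mu> G)"
    using assms by (intro gen_graph_add_scaleR domain_gen_graph)
  then show "F + a *\<^sub>R G \<in> ou_domain c \<sigma> \<mu>"
    by (auto simp: ou_domain_def)
  show "gamma_minus_A2 n (F + a *\<^sub>R G) = gamma_minus_A2 n F + a *\<^sub>R gamma_minus_A2 n G"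
    unfolding gamma_minus_A2_def A2_eq[OF g] by (simp add: algebra_simps)
qed

lemma chain_domain: "chain n k \<in> ou_domain c \<sigma> \<mu>"
proof (cases "k \<le> n")
  case True
  then show ?thesis using gen_graph_chain by (auto simp: ou_domain_def)
next
  case False
  then show ?thesis using gen_graph_0 by (auto simp: chain_eq_0 ou_domain_def)
qed

lemma gamma_minus_A2_chain: "gamma_minus_A2 n (chain n k) = - chain n (k + 1)"
proof (cases "k \<le> n")
  case True
  show ?thesis
    unfolding gamma_minus_A2_def A2_eq[OF gen_graph_chain[OF True]] by (simp add: eigval_def)
next
  case False
  then show ?thesis
    by (simp add: chain_eq_0 gamma_minus_A2_def A2_eq[OF gen_graph_0])
qed

lemma ou_pow_eq: "ou_pow c \<sigma> \<mu> (eigval n) k = (gamma_minus_A2 n ^^ k)"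
  unfolding ou_pow_def gamma_minus_A2_def [abs_def] ..

lemma gamma_minus_A2_scaleR:
  assumes "G \<in> ou_domain c \<sigma> \<mu>"
  shows "a *\<^sub>R G \<in> ou_domain c \<sigma> \<mu>" "gamma_minus_A2 n (a *\<^sub>R G) = a *\<^sub>R gamma_minus_A2 n G"
proof -
  have 0: "0 \<in> ou_domain c \<sigma> \<mu>" "gamma_minus_A2 n 0 = 0"
    using gen_graph_0 by (auto simp: ou_domain_def gamma_minus_A2_def A2_eq[OF gen_graph_0])
  show "a *\<^sub>R G \<in> ou_domain c \<sigma> \<mu>" "gamma_minus_A2 n (a *\<^sub>R G) = a *\<^sub>R gamma_minus_A2 n G"
    using gamma_minus_A2_add_scaleR(1)[OF 0(1) assms, of a] gamma_minus_A2_add_scaleR(2)[OF 0(1) assms, of n a] 0(2) by simp_all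
qed

lemma gamma_minus_A2_pow_chain: "(gamma_minus_A2 n ^^ j) (chain n k) = (- 1) ^ j *\<^sub>R chain n (k + j)"
  by (induction j) (simp_all add: gamma_minus_A2_scaleR chain_domain gamma_minus_A2_chain)

text \<open>Strong induction on k: applying gamma - A_2 to the relation n - k times annihilates the
  terms above k and moves R_k to a multiple of R_n, which is nonzero, while the coefficients below k
  are already known to vanish.\<close>

lemma chain_independent:
  assumes "(\<Sum>k\<le>n. a k *\<^sub>R chain n k) = 0" "k \<le> n"
  shows "a k = 0"
  using assms(2)
proof (induction k rule: less_induct)
  case (less k)
  \<comment> \<open>Additivity of the operator requires membership in its domain, so the induction
    over I carries both facts; i records how far the chain has been shifted.\<close>
  have dom: "(\<Sum>k\<in>I. b k *\<^sub>R chain n (k + i)) \<in> ou_domain c \<sigma> \<mu> \<and>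
      gamma_minus_A2 n (\<Sum>k\<in>I. b k *\<^sub>R chain n (k + i)) = (\<Sum>k\<in>I. (- b k) *\<^sub>R chain n (k + (i + 1)))"
    if "finite I" for I b i
    using that
  proof (induction I rule: finite_induct)
    case empty
    then show ?case using gen_graph_0 by (auto simp: ou_domain_def gamma_minus_A2_def A2_eq[OF gen_graph_0])
  next
    case (insert j I)
    then show ?case
      using gamma_minus_A2_add_scaleR[of "\<Sum>k\<in>I. b k *\<^sub>R chain n (k + i)" "chain n (j + i)"] chain_domain[of n "j + i"]
      by (simp add: gamma_minus_A2_chain add.commute)
  qed
  have "(\<Sum>k\<le>n. ((- 1) ^ i * a k) *\<^sub>R chain n (k + i)) = 0" for i
  proof (induction i)
    case (Suc i)
    then show ?case
      using dom[of "{..n}" "\<lambda>k. (- 1) ^ i * a k" i] by (simp add: gamma_minus_A2_def A2_eq[OF gen_graph_0])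
  qed (use assms(1) in simp)
  from this[of "n - k"] have "(\<Sum>j\<le>n. ((- 1) ^ (n - k) * a j) *\<^sub>R chain n (j + (n - k))) = 0" .
  moreover have "(\<Sum>j\<le>n. ((- 1) ^ (n - k) * a j) *\<^sub>R chain n (j + (n - k))) =
      (\<Sum>j\<in>{k}. ((- 1) ^ (n - k) * a j) *\<^sub>R chain n (j + (n - k)))"
  proof (rule sum.mono_neutral_right)
    show "\<forall>i\<in>{..n} - {k}. ((- 1) ^ (n - k) * a i) *\<^sub>R chain n (i + (n - k)) = 0"
    proof
      fix i assume i: "i \<in> {..n} - {k}"
      then consider "i < k" | "i > k" by force
      then show "((- 1) ^ (n - k) * a i) *\<^sub>R chain n (i + (n - k)) = 0"
      proof cases
        case 1
        then show ?thesis using less by simp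
      next
        case 2
        then show ?thesis using less.prems by (simp add: chain_eq_0)
      qed
    qed
  qed (use less.prems in auto)
  ultimately show ?case
    using less.prems chain_neq_0[of n] by simp
qed

lemma ker_pow_iff:
  "F \<in> ou_ker_pow c \<sigma> \<mu> (eigval n) k \<longleftrightarrow>
    F \<in> L2 \<mu> \<and> (\<forall>j<k. (gamma_minus_A2 n ^^ j) F \<in> ou_domain c \<sigma> \<mu>) \<and> (gamma_minus_A2 n ^^ k) F = 0"
  by (auto simp: ou_ker_pow_def ou_pow_domain_def ou_pow_eq)

lemma gamma_minus_A2_pow_add_scaleR:
  assumes "\<And>i. i < k \<Longrightarrow> (gamma_minus_A2 n ^^ i) F \<in> ou_domain c \<sigma> \<mu>" "\<And>i. i < k \<Longrightarrow> (gamma_minus_A2 n ^^ i) G \<in> ou_domain c \<sigma> \<mu>"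
    and "j \<le> k"
  shows "(gamma_minus_A2 n ^^ j) (F + a *\<^sub>R G) = (gamma_minus_A2 n ^^ j) F + a *\<^sub>R (gamma_minus_A2 n ^^ j) G"
  using assms(3)
proof (induction j)
  case (Suc j)
  then show ?case
    using gamma_minus_A2_add_scaleR(2)[of "(gamma_minus_A2 n ^^ j) F" "(gamma_minus_A2 n ^^ j) G" n a] assms(1,2) by simp
qed simp

lemma gamma_minus_A2_pow_chain_domain: "(gamma_minus_A2 n ^^ j) (chain n k) \<in> ou_domain c \<sigma> \<mu>"
  by (simp add: gamma_minus_A2_pow_chain gamma_minus_A2_scaleR chain_domain)

lemma kernel_gamma_minus_A2:
  assumes "G \<in> ou_domain c \<sigma> \<mu>" "gamma_minus_A2 n G = 0"
  shows "\<exists>a. G = a *\<^sub>R chain n n"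
proof -
  have "ou_A2 c \<sigma> \<mu> G = eigval n *\<^sub>R G"
    using assms(2) by (simp add: gamma_minus_A2_def)
  then show ?thesis
    using domain_gen_graph[OF assms(1)] by (intro eigenspace) (simp add: eigval_def)
qed

text \<open>For F in the next kernel, the k-fold image of F lies in the kernel of gamma - A_2 and so
  is a multiple of R_n. The k-fold image of R_(n-k) is (-1)^k R_n, hence adding a multiple of
  R_(n-k) brings F into the previous kernel. The bound on k makes n - k a genuine index.\<close>

lemma ker_pow_subset:
  "k \<le> n + 1 \<Longrightarrow> ou_ker_pow c \<sigma> \<mu> (eigval n) k \<subseteq> span ((\<lambda>j. chain n j) ` {..n})"
proof (induction k)
  case 0
  then show ?case by (auto simp: ker_pow_iff span_zero)
next
  case (Suc k)
  show ?case
  proof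
    fix F assume F: "F \<in> ou_ker_pow c \<sigma> \<mu> (eigval n) (Suc k)"
    then have dom: "\<And>j. j \<le> k \<Longrightarrow> (gamma_minus_A2 n ^^ j) F \<in> ou_domain c \<sigma> \<mu>" and 0: "gamma_minus_A2 n ((gamma_minus_A2 n ^^ k) F) = 0" and L: "F \<in> L2 \<mu>"
      by (auto simp: ker_pow_iff)
    obtain a where a: "(gamma_minus_A2 n ^^ k) F = a *\<^sub>R chain n n"
      using kernel_gamma_minus_A2[OF dom[of k] 0] by blast
    define b where "b = - (a * (- 1) ^ k)"
    define G where "G = chain n (n - k)"
    have Gk: "(gamma_minus_A2 n ^^ k) G = (- 1) ^ k *\<^sub>R chain n n"
      using Suc.prems by (simp add: G_def gamma_minus_A2_pow_chain)
    have pow: "(gamma_minus_A2 n ^^ j) (F + b *\<^sub>R G) = (gamma_minus_A2 n ^^ j) F + b *\<^sub>R (gamma_minus_A2 n ^^ j) G" if "j \<le> k" for j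
      by (rule gamma_minus_A2_pow_add_scaleR[where k = k]) (use dom that in \<open>auto simp: G_def gamma_minus_A2_pow_chain_domain\<close>)
    have "(gamma_minus_A2 n ^^ k) (F + b *\<^sub>R G) = 0"
      using pow[of k] by (simp add: a Gk b_def flip: power_add mult_2 scaleR_add_left)
    moreover have "(gamma_minus_A2 n ^^ j) (F + b *\<^sub>R G) \<in> ou_domain c \<sigma> \<mu>" if "j < k" for j
      using that dom pow[of j] by (simp add: G_def gamma_minus_A2_pow_chain_domain gamma_minus_A2_add_scaleR)
    ultimately have "F + b *\<^sub>R G \<in> ou_ker_pow c \<sigma> \<mu> (eigval n) k"
      using L by (simp add: ker_pow_iff L2_add_scaleR G_def chain_L2)
    then have "F + b *\<^sub>R G \<in> span ((\<lambda>j. chain n j) ` {..n})"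
      using Suc by auto
    moreover have "b *\<^sub>R G \<in> span ((\<lambda>j. chain n j) ` {..n})"
      unfolding G_def by (intro span_scale span_base) auto
    ultimately show "F \<in> span ((\<lambda>j. chain n j) ` {..n})"
      using span_diff by fastforce
  qed
qed

text \<open>The domain condition on the intermediate iterates has to be preserved as well; treating
  F + a G at once covers sums and multiples.\<close>

lemma subspace_ker_pow: "subspace (ou_ker_pow c \<sigma> \<mu> (eigval n) k)"
proof -
  have add: "F + a *\<^sub>R G \<in> ou_ker_pow c \<sigma> \<mu> (eigval n) k"
    if "F \<in> ou_ker_pow c \<sigma> \<mu> (eigval n) k" "G \<in> ou_ker_pow c \<sigma> \<mu> (eigval n) k" for F G a
  proof -
    have "(gamma_minus_A2 n ^^ j) (F + a *\<^sub>R G) = (gamma_minus_A2 n ^^ j) F + a *\<^sub>R (gamma_minus_A2 n ^^ j) G" if "j \<le> k" for j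
      by (rule gamma_minus_A2_pow_add_scaleR[OF _ _ that]) (use \<open>F \<in> _\<close> \<open>G \<in> _\<close> in \<open>auto simp: ker_pow_iff\<close>)
    then show ?thesis
      using that by (auto simp: ker_pow_iff L2_add_scaleR gamma_minus_A2_add_scaleR)
  qed
  have N0: "(gamma_minus_A2 n ^^ j) 0 = 0" for j
    by (induction j) (simp_all add: gamma_minus_A2_def A2_eq[OF gen_graph_0])
  have zero: "0 \<in> ou_ker_pow c \<sigma> \<mu> (eigval n) k"
    using gen_graph_0 by (auto simp: ker_pow_iff N0 L2_0 ou_domain_def)
  show ?thesis
    using zero add[of _ _ 1] add[OF zero] by (auto simp: subspace_def)
qed

lemma chain_ker_pow: "chain n k \<in> ou_ker_pow c \<sigma> \<mu> (eigval n) (n + 1)"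
proof -
  have "(gamma_minus_A2 n ^^ (n + 1)) (chain n k) = 0"
    unfolding gamma_minus_A2_pow_chain by (simp add: chain_eq_0)
  then show ?thesis
    unfolding ker_pow_iff using chain_L2 gamma_minus_A2_pow_chain_domain by blast
qed

lemma ker_pow_1: "ou_ker_pow c \<sigma> \<mu> (eigval n) 1 = span {chain n n}"
proof
  show "ou_ker_pow c \<sigma> \<mu> (eigval n) 1 \<subseteq> span {chain n n}"
  proof
    fix F assume "F \<in> ou_ker_pow c \<sigma> \<mu> (eigval n) 1"
    then obtain a where "F = a *\<^sub>R chain n n"
      using kernel_gamma_minus_A2[of F n] by (auto simp: ker_pow_iff)
    then show "F \<in> span {chain n n}"
      by (simp add: span_scale span_base)
  qed
  have "chain n n \<in> ou_ker_pow c \<sigma> \<mu> (eigval n) 1"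
    by (simp add: ker_pow_iff chain_L2 chain_domain gamma_minus_A2_chain chain_eq_0)
  then show "span {chain n n} \<subseteq> ou_ker_pow c \<sigma> \<mu> (eigval n) 1"
    by (intro span_minimal subspace_ker_pow) simp
qed

end

section \<open>From the chain to the iterates of G_n\<close>

theorem theorem2p1:
  fixes c \<sigma> \<rho> \<gamma> :: real and n :: nat and \<mu> :: "(real^2) measure" and f :: aefun
  assumes "c > 0" and "\<sigma> > 0" and "\<rho> = \<sigma>\<^sup>2 / c" and "\<gamma> = - real n * c"
    and "ou_invariant c \<sigma> \<mu>"
    and "f = ae_class (\<lambda>z. G_poly c \<rho> n (z $ 1))"
  shows "geometric_multiplicity c \<sigma> \<mu> \<gamma> = 1 \<and>
         inj_on (\<lambda>k. ou_pow c \<sigma> \<mu> \<gamma> k f) {0..n} \<and>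
         independent ((\<lambda>k. ou_pow c \<sigma> \<mu> \<gamma> k f) ` {0..n}) \<and>
         span ((\<lambda>k. ou_pow c \<sigma> \<mu> \<gamma> k f) ` {0..n}) = spectral_subspace c \<sigma> \<mu> n \<and>
         (\<forall>k\<le>n. f \<in> ou_pow_domain c \<sigma> \<mu> \<gamma> k \<and>
           ou_pow c \<sigma> \<mu> \<gamma> k f =
             ae_class (\<lambda>z. (-1) ^ k * (\<Sum>i = max 0 (n - 2 * k)..n - k.
               (- (\<rho> / (2 * c))) ^ (n - k - i) * real (k choose (n - k - i)) *
               G_poly c \<rho> i (z $ 1) * Hermite \<rho> (2 * k + i - n) (z $ 2)))) \<and>
         ou_pow c \<sigma> \<mu> \<gamma> n f = ae_class (\<lambda>z. (-1) ^ n * Hermite \<rho> n (z $ 2)) \<and>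
         eigenfunction c \<sigma> \<mu> \<gamma> (ou_pow c \<sigma> \<mu> \<gamma> n f)"
proof -
  interpret ou_process c \<sigma> \<mu>
    by unfold_locales (use assms in auto)
  have rho: "ou_process.\<rho> c \<sigma> = \<rho>"
    using assms(3) by (simp add: \<rho>_def)
  have gamma: "\<gamma> = eigval n"
    using assms(4) by (simp add: eigval_def)
  have rp: "\<rho> > 0" using rho rho_pos by simp
  have R: "chain_poly n k z = (\<Sum>i = n - 2 * k..n - k. (- (\<rho> / (2 * c))) ^ (n - k - i) * real (k choose (n - k - i)) *
       G_poly c \<rho> i (z $ 1) * Hermite \<rho> (2 * k + i - n) (z $ 2))" if "k \<le> n" for k z
    unfolding chain_poly_def rho by (rule bherm_eq_G_Hermite[OF rp that])
  \<comment> \<open>For k = 0 the range of i shrinks to i = n, where the second factor is H_0 =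
    1.\<close>
  have f: "f = chain n 0"
  proof -
    have "chain_poly n 0 = (\<lambda>z. G_poly c \<rho> n (z $ 1))"
      by (rule ext) (simp add: R Hermite_eq_herm[OF rp])
    then show ?thesis
      unfolding chain_def assms(6) by simp
  qed
  have pow: "ou_pow c \<sigma> \<mu> \<gamma> k f = (- 1) ^ k *\<^sub>R chain n k" for k
    unfolding gamma ou_pow_eq f gamma_minus_A2_pow_chain by simp
  have pow_ae: "ou_pow c \<sigma> \<mu> \<gamma> k f = ae_class (\<lambda>z. (- 1) ^ k * chain_poly n k z)" for k
    unfolding pow chain_def by (rule ae_class_scaleR) simp
  \<comment> \<open>The signs (-1)^k are absorbed into the coefficients, so independence of the
    iterates is that of the chain.\<close>
  have ind: "(\<Sum>k\<le>n. a k *\<^sub>R ou_pow c \<sigma> \<mu> \<gamma> k f) = 0 \<Longrightarrow> k \<le> n \<Longrightarrow> a k = 0" for a k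
    using chain_independent[where n = n and k = k and a = "\<lambda>k. a k * (- 1) ^ k"] by (simp add: pow)
  have inj: "inj_on (\<lambda>k. ou_pow c \<sigma> \<mu> \<gamma> k f) {0..n}"
  proof (rule inj_onI, rule ccontr)
    fix i j assume ij: "i \<in> {0..n}" "j \<in> {0..n}" "ou_pow c \<sigma> \<mu> \<gamma> i f = ou_pow c \<sigma> \<mu> \<gamma> j f" "i \<noteq> j"
    \<comment> \<open>If two iterates coincided, their difference would be a nontrivial linear
      relation.\<close>
    let ?a = "\<lambda>k. (if k = i then 1 else 0) - (if k = j then 1 else 0) :: real"
    have "(\<Sum>k\<le>n. ?a k *\<^sub>R ou_pow c \<sigma> \<mu> \<gamma> k f) = 0"
      using ij by (simp add: scaleR_diff_left sum_subtractf if_distrib[where f = "\<lambda>x. x *\<^sub>R _"] cong: if_cong)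
    from ind[OF this, of i] show False using ij by auto
  qed
  have indep: "independent ((\<lambda>k. ou_pow c \<sigma> \<mu> \<gamma> k f) ` {0..n})"
  proof (rule independent_if_scalars_zero)
    fix u x assume u: "(\<Sum>x\<in>(\<lambda>k. ou_pow c \<sigma> \<mu> \<gamma> k f) ` {0..n}. u x *\<^sub>R x) = 0"
      and x: "x \<in> (\<lambda>k. ou_pow c \<sigma> \<mu> \<gamma> k f) ` {0..n}"
    have "(\<Sum>k\<le>n. u (ou_pow c \<sigma> \<mu> \<gamma> k f) *\<^sub>R ou_pow c \<sigma> \<mu> \<gamma> k f) = 0"
      using u by (subst (asm) sum.reindex[OF inj]) (simp add: atLeast0AtMost)
    then show "u x = 0"
      using ind[of "\<lambda>k. u (ou_pow c \<sigma> \<mu> \<gamma> k f)"] x by auto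
  qed simp
  have span_eq: "span ((\<lambda>k. ou_pow c \<sigma> \<mu> \<gamma> k f) ` {0..n}) = spectral_subspace c \<sigma> \<mu> n"
  proof
    show "span ((\<lambda>k. ou_pow c \<sigma> \<mu> \<gamma> k f) ` {0..n}) \<subseteq> spectral_subspace c \<sigma> \<mu> n"
      unfolding spectral_subspace_def assms(4) [symmetric] gamma using chain_ker_pow[of n]
      by (intro span_minimal) (auto simp: pow [unfolded gamma] add.commute subspace_ker_pow intro!: subspace_scale)
    have "chain n k \<in> span ((\<lambda>k. ou_pow c \<sigma> \<mu> \<gamma> k f) ` {0..n})" if "k \<le> n" for k
    proof -
      have "chain n k = (- 1) ^ k *\<^sub>R ou_pow c \<sigma> \<mu> \<gamma> k f"
        by (simp add: pow flip: power_mult_distrib)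
      then show ?thesis
        using that by (simp only:) (intro span_scale span_base, auto)
    qed
    then have "span ((\<lambda>j. chain n j) ` {..n}) \<subseteq> span ((\<lambda>k. ou_pow c \<sigma> \<mu> \<gamma> k f) ` {0..n})"
      by (intro span_minimal) auto
    moreover have "spectral_subspace c \<sigma> \<mu> n \<subseteq> span ((\<lambda>j. chain n j) ` {..n})"
      unfolding spectral_subspace_def assms(4) [symmetric] gamma by (rule ker_pow_subset) simp
    ultimately show "spectral_subspace c \<sigma> \<mu> n \<subseteq> span ((\<lambda>k. ou_pow c \<sigma> \<mu> \<gamma> k f) ` {0..n})"
      by (rule order_trans[rotated])
  qed
  have geo: "geometric_multiplicity c \<sigma> \<mu> \<gamma> = 1"
  proof -
    have "dim (span {chain n n}) = card {chain n n}"
      by (rule dim_span_eq_card_independent) (simp add: chain_neq_0)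
    then show ?thesis
      by (simp add: geometric_multiplicity_def gamma ker_pow_1 [simplified])
  qed
  have dom: "f \<in> ou_pow_domain c \<sigma> \<mu> \<gamma> k" for k
  proof -
    have "f \<in> L2 \<mu>"
      unfolding f by (rule chain_L2)
    moreover have "ou_pow c \<sigma> \<mu> \<gamma> j f \<in> ou_domain c \<sigma> \<mu>" for j
      unfolding pow by (intro gamma_minus_A2_scaleR chain_domain)
    ultimately show ?thesis
      unfolding ou_pow_domain_def by blast
  qed
  \<comment> \<open>For k = n only i = 0 remains, and G_0 = 1.\<close>
  have top: "ou_pow c \<sigma> \<mu> \<gamma> n f = ae_class (\<lambda>z. (-1) ^ n * Hermite \<rho> n (z $ 2))"
    unfolding pow_ae using R[of n] by (simp add: G_poly_eq_herm[OF rp])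
  have eig: "eigenfunction c \<sigma> \<mu> \<gamma> (ou_pow c \<sigma> \<mu> \<gamma> n f)"
  proof -
    have d: "ou_pow c \<sigma> \<mu> \<gamma> n f \<in> ou_domain c \<sigma> \<mu>"
      unfolding pow by (intro gamma_minus_A2_scaleR chain_domain)
    have "gamma_minus_A2 n (ou_pow c \<sigma> \<mu> \<gamma> n f) = 0"
      unfolding pow by (simp add: gamma_minus_A2_scaleR chain_domain gamma_minus_A2_chain chain_eq_0)
    then have "ou_A2 c \<sigma> \<mu> (ou_pow c \<sigma> \<mu> \<gamma> n f) = \<gamma> *\<^sub>R ou_pow c \<sigma> \<mu> \<gamma> n f"
      by (simp add: gamma_minus_A2_def gamma)
    then show ?thesis
      unfolding eigenfunction_def using d chain_neq_0[of n] by (simp add: pow)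
  qed
  show ?thesis
    using geo inj indep span_eq dom top eig by (simp add: pow_ae R)
qed

end
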